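(* Let $(W_u)_{u\ge 0}$ be a complex Brownian motion with $W_0=1$, and for $u\ge 0$ let $\theta_u$ denote its argument (winding number) at time $u$. Then for any real numbers $a<b$, $$\lim_{u\to\infty}\frac{\log u}{2}\,\mathbb{P}[a<\theta_u<b]=\frac{1}{\pi}(b-a).$$
   Context: Complex Brownian motion is a standard two-dimensional real Brownian motion viewed as $\mathbb{C}$-valued. Almost surely $W$ never hits $0$, so by continuous lifting one can write $W_u=R_u e^{i\theta_u}$ with $R_u=|W_u|$, where $u\mapsto\theta_u$ is continuous and $\theta_0=0$. The process $\theta$ is called the winding number (argument) of $W$. *)

theory Defs
  imports "HOL-Probability.Probability"
begin

text \<open>Continuity is required of every sample path, not only almost every one: events such as
  \<open>a < winding (\<lambda>t. W t \<omega>) u\<close> depend on whole paths and need not be measurable otherwise,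
  since \<open>M\<close> is not assumed complete.\<close>

locale real_brownian_motion = prob_space M
  for M :: "'a measure" and x :: real and B :: "real \<Rightarrow> 'a \<Rightarrow> real" +
  assumes random_variable: "\<And>t. 0 \<le> t \<Longrightarrow> B t \<in> borel_measurable M"
    and start: "AE \<omega> in M. B 0 \<omega> = x"
    and continuous_paths: "\<And>\<omega>. \<omega> \<in> space M \<Longrightarrow> continuous_on {0..} (\<lambda>t. B t \<omega>)"
    and independent_increments:
      "\<And>(n::nat) t. 0 \<le> t 0 \<Longrightarrow> (\<forall>i<n. t i \<le> t (Suc i)) \<Longrightarrow>
         indep_vars (\<lambda>_. borel) (\<lambda>i \<omega>. B (t (Suc i)) \<omega> - B (t i) \<omega>) {..<n}"
    and gaussian_increments:
      "\<And>s t. 0 \<le> s \<Longrightarrow> s < t \<Longrightarrow>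
         distributed M lborel (\<lambda>\<omega>. B t \<omega> - B s \<omega>) (normal_density 0 (sqrt (t - s)))"

text \<open>The real and imaginary parts are required to be independent as processes, that is, as random
  variables with values in the product space of all functions on the half-line.\<close>

locale complex_brownian_motion = prob_space M
  for M :: "'a measure" and z :: complex and W :: "real \<Rightarrow> 'a \<Rightarrow> complex" +
  assumes Re_brownian: "real_brownian_motion M (Re z) (\<lambda>t \<omega>. Re (W t \<omega>))"
    and Im_brownian: "real_brownian_motion M (Im z) (\<lambda>t \<omega>. Im (W t \<omega>))"
    and Re_Im_independent:
      "indep_var (Pi\<^sub>M {0..} (\<lambda>_. borel)) (\<lambda>\<omega>. \<lambda>t\<in>{0..}. Re (W t \<omega>))
                 (Pi\<^sub>M {0..} (\<lambda>_. borel)) (\<lambda>\<omega>. \<lambda>t\<in>{0..}. Im (W t \<omega>))"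

definition continuous_argument :: "(real \<Rightarrow> complex) \<Rightarrow> (real \<Rightarrow> real) \<Rightarrow> bool" where
  "continuous_argument w \<theta> \<longleftrightarrow>
     continuous_on {0..} \<theta> \<and> \<theta> 0 = 0 \<and>
     (\<forall>t\<ge>0. w t = complex_of_real (cmod (w t)) * exp (\<i> * complex_of_real (\<theta> t)))"

text \<open>The winding number of a path at time \<open>u\<close>. The value \<open>0\<close> for paths that hit the origin is a
  convention; lemma \<open>continuous_argument_winding\<close> below shows that otherwise the definite
  description is meaningful.\<close>

definition winding :: "(real \<Rightarrow> complex) \<Rightarrow> real \<Rightarrow> real" where
  "winding w u =
     (if \<forall>t\<ge>0. w t \<noteq> 0 then THE a. \<exists>\<theta>. continuous_argument w \<theta> \<and> \<theta> u = a else 0)"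

lemma continuous_argument_unique:
  assumes 1: "continuous_argument w \<theta>" and 2: "continuous_argument w \<phi>"
    and nz: "\<forall>t\<ge>0. w t \<noteq> 0" and u: "0 \<le> u"
  shows "\<theta> u = \<phi> u"
proof (rule ccontr)
  assume neq: "\<theta> u \<noteq> \<phi> u"
  define d where "d t = \<bar>\<theta> t - \<phi> t\<bar>" for t
  have ex: "\<exists>k::int. \<theta> t - \<phi> t = 2 * pi * of_int k" if "0 \<le> t" for t
  proof -
    have "exp (\<i> * complex_of_real (\<theta> t)) = exp (\<i> * complex_of_real (\<phi> t))"
      using 1 2 nz that unfolding continuous_argument_def
      by (metis mult_left_cancel norm_eq_zero of_real_eq_0_iff)
    then obtain k :: int where
      "\<i> * complex_of_real (\<theta> t) = \<i> * complex_of_real (\<phi> t) + (of_int (2 * k) * pi) * \<i>"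
      unfolding exp_eq by blast
    then have "Im (\<i> * complex_of_real (\<theta> t)) =
        Im (\<i> * complex_of_real (\<phi> t) + (of_int (2 * k) * pi) * \<i>)" by (rule arg_cong)
    then have "\<theta> t - \<phi> t = 2 * pi * of_int k" by simp
    then show ?thesis ..
  qed
  have d: "d t = 2 * pi * of_int \<bar>k\<bar>" if "\<theta> t - \<phi> t = 2 * pi * of_int k" for t k
    using that by (simp add: d_def abs_mult)
  have "pi \<le> d u"
  proof -
    obtain k where k: "\<theta> u - \<phi> u = 2 * pi * of_int k" using ex[OF u] by blast
    with neq have "k \<noteq> 0" by auto
    then have "1 \<le> real_of_int \<bar>k\<bar>" by linarith
    then have "pi * 1 \<le> pi * (2 * real_of_int \<bar>k\<bar>)" by (intro mult_left_mono) auto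
    then show ?thesis using d[OF k] by simp
  qed
  moreover have "continuous_on {0..u} d" unfolding d_def
  proof (intro continuous_intros)
    show "continuous_on {0..u} \<theta>" "continuous_on {0..u} \<phi>"
      using 1 2 by (auto simp: continuous_argument_def elim: continuous_on_subset)
  qed
  moreover have "d 0 \<le> pi" using 1 2 by (simp add: d_def continuous_argument_def)
  ultimately obtain t where t: "0 \<le> t" "d t = pi"
    using IVT'[of d 0 pi u] u by auto
  obtain k where "\<theta> t - \<phi> t = 2 * pi * of_int k" using ex[OF t(1)] by blast
  from d[OF this] t(2) have "pi * (2 * of_int \<bar>k\<bar>) = pi * 1" by linarith
  then have "2 * real_of_int \<bar>k\<bar> = 1" by (simp only: mult_left_cancel[OF pi_neq_zero])
  then have "real_of_int (2 * \<bar>k\<bar>) = real_of_int 1" by (simp only: of_int_mult of_int_numeral of_int_1)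
  then have "2 * \<bar>k\<bar> = 1" by (simp only: of_int_eq_iff)
  then show False by presburger
qed

lemma winding_eq:
  assumes "continuous_argument w \<theta>" "\<forall>t\<ge>0. w t \<noteq> 0" "0 \<le> u"
  shows "winding w u = \<theta> u"
proof -
  have "(THE a. \<exists>\<phi>. continuous_argument w \<phi> \<and> \<phi> u = a) = \<theta> u"
  proof (rule the_equality)
    show "\<exists>\<phi>. continuous_argument w \<phi> \<and> \<phi> u = \<theta> u" using assms(1) by blast
  next
    fix a assume "\<exists>\<phi>. continuous_argument w \<phi> \<and> \<phi> u = a"
    then obtain \<phi> where "continuous_argument w \<phi>" "\<phi> u = a" by blast
    then show "a = \<theta> u" using continuous_argument_unique[OF _ assms(1,2,3)] by simp
  qed
  then show ?thesis using assms(2) by (simp add: winding_def)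
qed

lemma continuous_argument_winding:
  assumes "continuous_on {0..} w" "w 0 = 1" "\<forall>t\<ge>0. w t \<noteq> 0"
  shows "continuous_argument w (winding w)"
proof -
  have "contractible {0::real..}" by (simp add: convex_imp_contractible)
  then obtain g where g: "continuous_on {0..} g" "\<And>t. t \<in> {0..} \<Longrightarrow> w t = exp (g t)"
    using continuous_logarithm_on_contractible[of "{0..}" w] assms(1,3) by auto
  define \<theta> where "\<theta> t = Im (g t) - Im (g 0)" for t
  have e0: "exp (\<i> * complex_of_real (Im (g 0))) = 1"
  proof -
    have "exp (g 0) = 1" using g(2)[of 0] assms(2) by simp
    then have "Re (g 0) = 0" by (simp add: exp_eq_1)
    then have "g 0 = \<i> * complex_of_real (Im (g 0))" by (simp add: complex_eq_iff)
    with \<open>exp (g 0) = 1\<close> show ?thesis by simp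
  qed
  have "w t = complex_of_real (cmod (w t)) * exp (\<i> * complex_of_real (\<theta> t))" if "t \<ge> 0" for t
  proof -
    have "exp (\<i> * complex_of_real (\<theta> t)) = exp (\<i> * complex_of_real (Im (g t)))"
      using e0 by (simp add: \<theta>_def algebra_simps exp_diff)
    moreover have "w t = complex_of_real (exp (Re (g t))) * exp (\<i> * complex_of_real (Im (g t)))"
      using g(2)[of t] that exp_eq_polar[of "g t"] by (simp add: cis_conv_exp)
    ultimately show ?thesis using g(2)[of t] that by (simp add: norm_mult)
  qed
  moreover have cont: "continuous_on {0..} \<theta>" unfolding \<theta>_def using g(1) by (intro continuous_intros)
  ultimately have *: "continuous_argument w \<theta>" by (simp add: continuous_argument_def \<theta>_def)
  have eq: "winding w t = \<theta> t" if "t \<ge> 0" for t using winding_eq[OF * assms(3) that] .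
  have "continuous_on {0..} (winding w)"
    by (rule continuous_on_eq[OF cont]) (simp add: eq)
  with * eq show ?thesis by (simp add: continuous_argument_def)
qed

end

theory Submission
  imports Defs "HOL-Complex_Analysis.Complex_Analysis" "HOL-Real_Asymp.Real_Asymp"
begin

text \<open>The proof computes the characteristic function of the winding number \<open>\<Theta> u\<close> and inverts it. Write
  \<open>R\<close> for \<open>cmod (W u)\<close>.

  The power \<open>z powr \<nu>\<close>, lifted to the universal cover of the punctured plane, is harmonic there, and
  multiplication by a Gaussian weight \<open>exp (- R\<^sup>2 / (2 * s))\<close> moves the centre of a Gaussian law only
  along its own ray. This gives Weber's integral in the form of lemma \<open>weber_identity\<close>:
  \<open>R powr \<nu> * exp (- R\<^sup>2 / (2 * s)) * exp (\<i> * \<nu> * \<Theta> u)\<close> has expectation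
  \<open>(s / (s + u)) powr (1 + \<nu>) * exp (- 1 / (2 * (s + u)))\<close>. No stochastic calculus enters: along a grid
  the lifted power is the product of the principal powers of the quotients of successive positions.
  In a single step the Gaussian mean of the principal power differs from the value at the centre only
  through the jumps that reach as far as the origin (\<open>gauss_power_mean\<close>), and the sum of these errors
  tends to zero with the mesh because negative moments of order less than two are bounded
  (\<open>gauss_negative_moment\<close>).

  For the product to converge to the lifted power the path must stay away from the origin
  (\<open>AE_V_nonzero\<close>). This follows from the maximal inequality for a potential of Gaussian kernels, whose
  value near the origin grows like a logarithm.

  Integrating Weber's identity against \<open>x powr (\<nu> / 2 - 1)\<close> in \<open>x = 1 / s\<close> replaces the radial weight by
  the constant \<open>2 powr (\<nu> / 2) * Gamma (\<nu> / 2)\<close>. Hence the characteristic function of \<open>\<Theta> u\<close> at \<open>\<nu> > 0\<close> is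
  real and equals \<open>spitzer_const \<nu> * u powr (- \<nu> / 2)\<close> up to a factor between \<open>exp (- 1 / (2 * u))\<close> and
  one (\<open>char_\<Theta>_law_bounds\<close>). Put \<open>l = ln u / 2\<close>, so that \<open>u powr (- \<nu> / 2) = exp (- l * \<nu>)\<close>. Since the
  characteristic function is integrable, Fourier inversion expresses \<open>l * P (a < \<Theta> u < b)\<close> as
  \<open>1 / (2 * \<pi>)\<close> times an integral which the substitution \<open>t = s / l\<close> turns into one that converges
  dominatedly to the integral of \<open>(b - a) * exp (- \<bar>s\<bar>)\<close> over the line, that is, to \<open>2 * (b - a)\<close>.\<close>

section \<open>Lebesgue measure on the complex plane\<close>

text \<open>The branch cut is the only discontinuity of \<open>Ln\<close>; on the negative half-line \<open>Ln\<close>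
  is a real logarithm plus \<open>\<i> * \<pi>\<close>.\<close>

lemma borel_measurable_Ln [measurable]: "(Ln :: complex \<Rightarrow> complex) \<in> borel_measurable borel"
proof -
  have "continuous_on (- \<real>\<^sub>\<le>\<^sub>0) (Ln :: complex \<Rightarrow> complex)"
    by (intro continuous_on_Ln) auto
  moreover have "open (- \<real>\<^sub>\<le>\<^sub>0 :: complex set)"
    using closed_nonpos_Reals_complex by (simp add: open_Compl)
  ultimately have [measurable]: "(\<lambda>z::complex. if z \<in> - \<real>\<^sub>\<le>\<^sub>0 then Ln z else 0) \<in> borel_measurable borel"
    by (intro borel_measurable_continuous_on_if) auto
  have "(\<lambda>z::complex. (if z \<in> - \<real>\<^sub>\<le>\<^sub>0 then Ln z else 0) +
      (if Re z < 0 \<and> Im z = 0 then complex_of_real (ln (- Re z)) + \<i> * complex_of_real pi else 0) +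
      (if z = 0 then Ln 0 else 0)) \<in> borel_measurable borel"
    by measurable
  also have "(\<lambda>z::complex. (if z \<in> - \<real>\<^sub>\<le>\<^sub>0 then Ln z else 0) +
      (if Re z < 0 \<and> Im z = 0 then complex_of_real (ln (- Re z)) + \<i> * complex_of_real pi else 0) +
      (if z = 0 then Ln 0 else 0)) = Ln"
  proof
    fix z :: complex
    have *: "Ln z = complex_of_real (ln (- Re z)) + \<i> * complex_of_real pi" if "Re z < 0" "Im z = 0"
    proof -
      have "z = - complex_of_real (- Re z)" using that by (simp add: complex_eq_iff)
      moreover have "Ln (- complex_of_real (- Re z)) = Ln (complex_of_real (- Re z)) + \<i> * complex_of_real pi"
        using that by (subst Ln_minus) (auto simp: mult.commute)
      moreover have "Ln (complex_of_real (- Re z)) = complex_of_real (ln (- Re z))"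
        using that by (intro Ln_of_real) auto
      ultimately show ?thesis by simp
    qed
    show "(if z \<in> - \<real>\<^sub>\<le>\<^sub>0 then Ln z else 0) +
      (if Re z < 0 \<and> Im z = 0 then complex_of_real (ln (- Re z)) + \<i> * complex_of_real pi else 0) +
      (if z = 0 then Ln 0 else 0) = Ln z"
    proof (cases "z = 0")
      case False
      then have "\<not> (Re z = 0 \<and> Im z = 0)" by (simp add: complex_eq_iff)
      then show ?thesis using * False by (auto simp: complex_nonpos_Reals_iff)
    qed simp
  qed
  finally show ?thesis .
qed

lemma borel_measurable_complex_powr [measurable (raw)]:
  fixes f :: "'a \<Rightarrow> complex"
  assumes [measurable]: "f \<in> borel_measurable M"
  shows "(\<lambda>x. f x powr c) \<in> borel_measurable M"
  unfolding powr_def by measurable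

lemma lborel_complex_eq_distr:
  "(lborel :: complex measure) = distr (lborel \<Otimes>\<^sub>M lborel) borel (\<lambda>(x, y). Complex x y)"
proof (rule lborel_eqI)
  have m [measurable]: "(\<lambda>(x, y). Complex x y) \<in> borel_measurable (borel \<Otimes>\<^sub>M borel)"
    by (simp add: borel_measurable_complex_iff case_prod_beta)
  fix l u :: complex assume le: "\<And>b. b \<in> Basis \<Longrightarrow> l \<bullet> b \<le> u \<bullet> b"
  have "emeasure (distr (lborel \<Otimes>\<^sub>M lborel) borel (\<lambda>(x, y). Complex x y)) (box l u) =
    emeasure (lborel \<Otimes>\<^sub>M lborel) ({Re l<..<Re u} \<times> {Im l<..<Im u})"
    by (subst emeasure_distr)
       (auto simp: space_pair_measure box_def Basis_complex_def intro!: arg_cong2[where f=emeasure])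
  also have "\<dots> = ennreal (Re u - Re l) * ennreal (Im u - Im l)"
    using le[of 1] le[of \<i>]
    by (subst lborel.emeasure_pair_measure_Times) (auto simp: Basis_complex_def)
  also have "\<dots> = (\<Prod>b\<in>Basis. (u - l) \<bullet> b)"
    using le[of 1] le[of \<i>] by (simp add: Basis_complex_def ennreal_mult)
  finally show "emeasure (distr (lborel \<Otimes>\<^sub>M lborel) borel (\<lambda>(x, y). Complex x y)) (box l u) =
     ennreal (\<Prod>b\<in>Basis. (u - l) \<bullet> b)" .
qed simp

lemma measurable_Complex [measurable]:
  "(\<lambda>p. Complex (fst p) (snd p)) \<in> borel_measurable (borel \<Otimes>\<^sub>M borel)"
  by (simp add: borel_measurable_complex_iff)

lemma nn_integral_lborel_complex:
  assumes [measurable]: "f \<in> borel_measurable borel"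
  shows "(\<integral>\<^sup>+z. f z \<partial>(lborel::complex measure)) = (\<integral>\<^sup>+x. \<integral>\<^sup>+y. f (Complex x y) \<partial>lborel \<partial>lborel)"
  by (subst lborel_complex_eq_distr)
     (simp add: nn_integral_distr case_prod_beta lborel.nn_integral_fst[symmetric])

lemma nn_integral_lborel_complex_swap:
  assumes [measurable]: "f \<in> borel_measurable borel"
  shows "(\<integral>\<^sup>+z. f z \<partial>(lborel::complex measure)) = (\<integral>\<^sup>+y. \<integral>\<^sup>+x. f (Complex x y) \<partial>lborel \<partial>lborel)"
  unfolding nn_integral_lborel_complex[OF assms]
  by (rule lborel_pair.Fubini'[symmetric]) (simp add: case_prod_beta)

lemma nn_integral_lborel_plus:
  fixes a :: "'a::euclidean_space"
  assumes [measurable]: "f \<in> borel_measurable borel"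
  shows "(\<integral>\<^sup>+x. f (a + x) \<partial>lborel) = (\<integral>\<^sup>+x. f x \<partial>lborel)"
  by (subst (2) lborel_distr_plus[symmetric, of a]) (simp add: nn_integral_distr)

text \<open>Tonelli's theorem reduces a shear of the plane to translations of the lines parallel to it.\<close>

lemma nn_integral_lborel_shear:
  assumes [measurable]: "f \<in> borel_measurable borel"
  shows "(\<integral>\<^sup>+z. f (Complex (Re z + a * Im z) (Im z)) \<partial>lborel) = (\<integral>\<^sup>+z. f z \<partial>lborel)"
    and "(\<integral>\<^sup>+z. f (Complex (Re z) (Im z + a * Re z)) \<partial>lborel) = (\<integral>\<^sup>+z. f z \<partial>lborel)"
proof -
  have [measurable]: "(\<lambda>z. Complex (Re z + a * Im z) (Im z)) \<in> borel_measurable borel"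
    "(\<lambda>z. Complex (Re z) (Im z + a * Re z)) \<in> borel_measurable borel"
    "\<And>y. (\<lambda>x. Complex x y) \<in> borel_measurable borel" "\<And>y. (\<lambda>x. Complex y x) \<in> borel_measurable borel"
    by (simp_all add: borel_measurable_complex_iff)
  have "(\<integral>\<^sup>+x. f (Complex (x + a * y) y) \<partial>lborel) = (\<integral>\<^sup>+x. f (Complex x y) \<partial>lborel)" for y
    using nn_integral_lborel_plus[of "\<lambda>x. f (Complex x y)" "a * y"] by (simp add: add.commute)
  then show "(\<integral>\<^sup>+z. f (Complex (Re z + a * Im z) (Im z)) \<partial>lborel) = (\<integral>\<^sup>+z. f z \<partial>lborel)"
    by (simp add: nn_integral_lborel_complex_swap)
  have "(\<integral>\<^sup>+y. f (Complex x (y + a * x)) \<partial>lborel) = (\<integral>\<^sup>+y. f (Complex x y) \<partial>lborel)" for x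
    using nn_integral_lborel_plus[of "\<lambda>y. f (Complex x y)" "a * x"] by (simp add: add.commute)
  then show "(\<integral>\<^sup>+z. f (Complex (Re z) (Im z + a * Re z)) \<partial>lborel) = (\<integral>\<^sup>+z. f z \<partial>lborel)"
    by (simp add: nn_integral_lborel_complex)
qed

text \<open>A rotation by an angle other than \<open>\<pi>\<close> is a product of three shears.\<close>

lemma nn_integral_lborel_rotation_aux:
  assumes [measurable]: "f \<in> borel_measurable borel" and "cmod c = 1" "c \<noteq> -1"
  shows "(\<integral>\<^sup>+z. f (c * z) \<partial>lborel) = (\<integral>\<^sup>+z. f z \<partial>lborel)"
proof -
  \<comment> \<open>the sine of the angle and minus the tangent of its half\<close>
  define b where "b = Im c"
  define a where "a = - Im c / (1 + Re c)"
  have n: "Re c ^ 2 + Im c ^ 2 = 1" using assms(2) by (simp add: cmod_def)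
  have ne: "1 + Re c \<noteq> 0"
  proof
    assume "1 + Re c = 0"
    then have "Re c = -1" by simp
    with n have "Im c = 0" by simp
    with \<open>Re c = -1\<close> assms(3) show False by (simp add: complex_eq_iff)
  qed
  have ab: "1 + a * b = Re c"
  proof -
    have "b * b = (1 - Re c) * (1 + Re c)" using n by (simp add: b_def power2_eq_square algebra_simps)
    then show ?thesis using ne by (simp add: a_def b_def[symmetric] field_simps)
  qed
  have a2: "a + a * (1 + a * b) = - Im c"
    proof -
    have "a + a * Re c = a * (1 + Re c)" by (simp add: algebra_simps)
    then show ?thesis unfolding ab using ne by (simp add: a_def)
  qed
  define S where "S z = Complex (Re z + a * Im z) (Im z)" for z
  define T where "T z = Complex (Re z) (Im z + b * Re z)" for z
  have [measurable]: "S \<in> borel_measurable borel" "T \<in> borel_measurable borel"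
    unfolding S_def T_def by (simp_all add: borel_measurable_complex_iff)
  have eq: "S (T (S z)) = c * z" for z
  proof -
    have "Re (S (T (S z))) = (1 + a * b) * Re z + (a + a * (1 + a * b)) * Im z"
      by (simp add: S_def T_def algebra_simps)
    moreover have "Im (S (T (S z))) = b * Re z + (1 + a * b) * Im z"
      by (simp add: S_def T_def algebra_simps)
    ultimately show ?thesis unfolding ab a2[unfolded ab] by (simp add: complex_eq_iff b_def)
  qed
  have "(\<integral>\<^sup>+z. f (c * z) \<partial>lborel) = (\<integral>\<^sup>+z. f (S (T (S z))) \<partial>lborel)" by (simp add: eq)
  also have "\<dots> = (\<integral>\<^sup>+z. f (S (T z)) \<partial>lborel)"
    using nn_integral_lborel_shear(1)[of "\<lambda>z. f (S (T z))" a, folded S_def] by simp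
  also have "\<dots> = (\<integral>\<^sup>+z. f (S z) \<partial>lborel)"
    using nn_integral_lborel_shear(2)[of "\<lambda>z. f (S z)" b, folded T_def] by simp
  also have "\<dots> = (\<integral>\<^sup>+z. f z \<partial>lborel)"
    using nn_integral_lborel_shear(1)[of f a, folded S_def] by simp
  finally show ?thesis .
qed

lemma lborel_complex_distr_rotation:
  assumes "cmod c = 1"
  shows "distr lborel borel ((*) c) = (lborel :: complex measure)"
proof (rule measure_eqI)
  fix A assume "A \<in> sets (distr lborel borel ((*) c))"
  then have [measurable]: "A \<in> sets borel" by simp
  have "emeasure (distr lborel borel ((*) c)) A = (\<integral>\<^sup>+z. indicator A (c * z) \<partial>lborel)"
    by (subst nn_integral_indicator[symmetric], simp, subst nn_integral_distr) auto
  also have "\<dots> = (\<integral>\<^sup>+z. indicator A z \<partial>lborel)"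
  proof (cases "c = -1")
    case True
    have "(\<integral>\<^sup>+z. indicator A (c * z) \<partial>lborel) = (\<integral>\<^sup>+z. (\<lambda>z. indicator A (\<i> * z) :: ennreal) (\<i> * z) \<partial>lborel)"
      using True by (simp add: mult.assoc[symmetric])
    also have "\<dots> = (\<integral>\<^sup>+z. indicator A z \<partial>lborel)"
      by (subst nn_integral_lborel_rotation_aux; simp add: complex_eq_iff)
         (subst nn_integral_lborel_rotation_aux; simp add: complex_eq_iff)
    finally show ?thesis .
  qed (use assms in \<open>simp add: nn_integral_lborel_rotation_aux\<close>)
  also have "\<dots> = emeasure lborel A" by simp
  finally show "emeasure (distr lborel borel ((*) c)) A = emeasure lborel A" .
qed simp

section \<open>The Gaussian law of the plane\<close>

definition gdens :: "real \<Rightarrow> complex \<Rightarrow> real" where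
  "gdens v w = exp (- (cmod w)\<^sup>2 / (2 * v)) / (2 * pi * v)"

text \<open>The law of a pair of independent centred normal variables of variance \<open>v\<close>; the parameter is the
  variance of each coordinate, as for Brownian motion at time \<open>v\<close>.\<close>

definition gauss :: "real \<Rightarrow> complex measure" where
  "gauss v = density lborel (gdens v)"

lemma gdens_nonneg: "0 < v \<Longrightarrow> 0 \<le> gdens v w"
  by (simp add: gdens_def)

lemma borel_measurable_gdens [measurable]: "gdens v \<in> borel_measurable borel"
  unfolding gdens_def by measurable

lemma sets_gauss [simp, measurable_cong]: "sets (gauss v) = sets borel"
  and space_gauss [simp]: "space (gauss v) = UNIV"
  by (simp_all add: gauss_def)

lemma gdens_Complex:
  assumes "0 < v"
  shows "gdens v (Complex x y) = normal_density 0 (sqrt v) x * normal_density 0 (sqrt v) y"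
  using assms
  by (simp add: gdens_def normal_density_def cmod_def mult_exp_exp diff_divide_distrib)

lemma distr_normal_pair:
  assumes v: "0 < v"
  shows "distr (density lborel (normal_density 0 (sqrt v)) \<Otimes>\<^sub>M density lborel (normal_density 0 (sqrt v)))
     borel (\<lambda>p. Complex (fst p) (snd p)) = gauss v"
proof -
  interpret N: prob_space "density lborel (normal_density 0 (sqrt v))"
    using v by (intro prob_space_normal_density) auto
  have "gauss v = density (distr (lborel \<Otimes>\<^sub>M lborel) borel (\<lambda>p. Complex (fst p) (snd p))) (gdens v)"
    unfolding gauss_def by (subst lborel_complex_eq_distr) (simp add: case_prod_beta')
  also have "\<dots> = distr (density (lborel \<Otimes>\<^sub>M lborel) (\<lambda>p. gdens v (Complex (fst p) (snd p)))) borel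
      (\<lambda>p. Complex (fst p) (snd p))"
    by (subst density_distr) auto
  also have "density (lborel \<Otimes>\<^sub>M lborel) (\<lambda>p. gdens v (Complex (fst p) (snd p))) =
     density lborel (normal_density 0 (sqrt v)) \<Otimes>\<^sub>M density lborel (normal_density 0 (sqrt v))"
    by (subst pair_measure_density)
       (auto simp: gdens_Complex[OF v] ennreal_mult' case_prod_beta' N.sigma_finite_measure_axioms
          sigma_finite_lborel)
  finally show ?thesis by simp
qed

lemma prob_space_gauss:
  assumes v: "0 < v"
  shows "prob_space (gauss v)"
proof -
  interpret N: prob_space "density lborel (normal_density 0 (sqrt v))"
    using v by (intro prob_space_normal_density) auto
  interpret NN: pair_prob_space "density lborel (normal_density 0 (sqrt v))" "density lborel (normal_density 0 (sqrt v))" ..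
  show ?thesis
    unfolding distr_normal_pair[OF v, symmetric]
    by (intro NN.prob_space_distr) (auto simp: borel_measurable_complex_iff)
qed

lemma emeasure_gauss_UNIV [simp]: "0 < v \<Longrightarrow> emeasure (gauss v) UNIV = 1"
  using prob_space.emeasure_space_1[OF prob_space_gauss] by simp

lemma gauss_distr_rotation:
  assumes c: "cmod c = 1"
  shows "distr (gauss v) borel ((*) c) = gauss v"
proof -
  have "gauss v = density (distr lborel borel ((*) c)) (gdens v)"
    by (simp add: gauss_def lborel_complex_distr_rotation[OF c])
  also have "\<dots> = distr (density lborel (\<lambda>w. gdens v (c * w))) borel ((*) c)"
    by (subst density_distr) auto
  also have "(\<lambda>w. gdens v (c * w)) = gdens v"
    by (simp add: gdens_def norm_mult c fun_eq_iff)
  finally show ?thesis by (simp add: gauss_def)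
qed

lemma nn_integral_gauss_shift:
  fixes f :: "complex \<Rightarrow> ennreal"
  assumes [measurable]: "f \<in> borel_measurable borel" and v: "0 < v"
  shows "(\<integral>\<^sup>+w. f (z + w) \<partial>gauss v) = (\<integral>\<^sup>+y. gdens v (y - z) * f y \<partial>lborel)"
proof -
  have "(\<integral>\<^sup>+w. f (z + w) \<partial>gauss v) = (\<integral>\<^sup>+w. gdens v w * f (z + w) \<partial>lborel)"
    by (simp add: gauss_def nn_integral_density)
  also have "\<dots> = (\<integral>\<^sup>+y. gdens v (y - z) * f y \<partial>lborel)"
    using nn_integral_lborel_plus[of "\<lambda>y. gdens v (y - z) * f y" z] by simp
  finally show ?thesis .
qed

lemma integral_gauss_shift:
  fixes f :: "complex \<Rightarrow> complex"
  assumes [measurable]: "f \<in> borel_measurable borel" and v: "0 < v"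
  shows "(\<integral>w. f (z + w) \<partial>gauss v) = (\<integral>y. gdens v (y - z) *\<^sub>R f y \<partial>lborel)"
proof -
  have "(\<integral>w. f (z + w) \<partial>gauss v) = (\<integral>w. gdens v w *\<^sub>R f (z + w) \<partial>lborel)"
    unfolding gauss_def using v by (intro integral_density) (auto simp: gdens_nonneg)
  also have "\<dots> = (\<integral>y. gdens v (y - z) *\<^sub>R f y \<partial>distr lborel borel ((+) z))"
    by (subst integral_distr) auto
  finally show ?thesis by (simp add: lborel_distr_plus)
qed

text \<open>Completing the square: a centred Gaussian weight turns the Gaussian law around \<open>z\<close> into a
  multiple of the Gaussian law around a point of the same ray.\<close>

lemma gdens_tilt:
  assumes "0 < d" "0 < S"
  shows "gdens d (y - z) * exp (- (cmod y)\<^sup>2 / (2 * S)) =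
    S / (S + d) * exp (- (cmod z)\<^sup>2 / (2 * (S + d))) *
    gdens (S * d / (S + d)) (y - of_real (S / (S + d)) * z)"
proof -
  have pos: "0 < S + d" using assms by simp
  define k where "k = S / (S + d)"
  define q where "q = S * d / (S + d)"
  have q: "0 < q" using assms by (simp add: q_def)
  have *: "- ((a - b)\<^sup>2) / (2 * d) - a\<^sup>2 / (2 * S) =
        - b\<^sup>2 / (2 * (S + d)) - (a - k * b)\<^sup>2 / (2 * q)" for a b :: real
    using assms pos unfolding k_def q_def
    by (simp add: divide_simps power2_eq_square) (simp add: algebra_simps)
  have "- (cmod (y - z))\<^sup>2 / (2 * d) + - (cmod y)\<^sup>2 / (2 * S) =
     (- ((Re y - Re z)\<^sup>2) / (2 * d) - (Re y)\<^sup>2 / (2 * S)) + (- ((Im y - Im z)\<^sup>2) / (2 * d) - (Im y)\<^sup>2 / (2 * S))"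
    by (simp add: cmod_power2 add_divide_distrib diff_divide_distrib)
  also have "\<dots> = - (cmod z)\<^sup>2 / (2 * (S + d)) + - (cmod (y - of_real k * z))\<^sup>2 / (2 * q)"
    unfolding * by (simp add: cmod_power2 add_divide_distrib diff_divide_distrib)
  finally have e: "exp (- (cmod (y - z))\<^sup>2 / (2 * d)) * exp (- (cmod y)\<^sup>2 / (2 * S)) =
     exp (- (cmod z)\<^sup>2 / (2 * (S + d))) * exp (- (cmod (y - of_real k * z))\<^sup>2 / (2 * q))"
    by (simp only: exp_add[symmetric])
  have "gdens d (y - z) * exp (- (cmod y)\<^sup>2 / (2 * S)) =
     (exp (- (cmod (y - z))\<^sup>2 / (2 * d)) * exp (- (cmod y)\<^sup>2 / (2 * S))) / (2 * pi * d)"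
    by (simp add: gdens_def)
  also have "\<dots> = (q / d) * exp (- (cmod z)\<^sup>2 / (2 * (S + d))) * gdens q (y - of_real k * z)"
    unfolding e using assms q by (simp add: gdens_def)
  also have "q / d = k" using assms by (simp add: k_def q_def)
  finally show ?thesis by (simp only: k_def q_def)
qed

lemma integral_gauss_tilt:
  fixes f :: "complex \<Rightarrow> complex"
  assumes [measurable]: "f \<in> borel_measurable borel" and "0 < d" "0 < S"
  shows "(\<integral>w. exp (- (cmod (z + w))\<^sup>2 / (2 * S)) *\<^sub>R f (z + w) \<partial>gauss d) =
    (S / (S + d) * exp (- (cmod z)\<^sup>2 / (2 * (S + d)))) *\<^sub>R
      (\<integral>w. f (of_real (S / (S + d)) * z + w) \<partial>gauss (S * d / (S + d)))"
proof -
  have "(\<integral>w. exp (- (cmod (z + w))\<^sup>2 / (2 * S)) *\<^sub>R f (z + w) \<partial>gauss d) =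
    (\<integral>y. (gdens d (y - z) * exp (- (cmod y)\<^sup>2 / (2 * S))) *\<^sub>R f y \<partial>lborel)"
    using assms by (subst integral_gauss_shift[where f="\<lambda>y. exp (- (cmod y)\<^sup>2 / (2 * S)) *\<^sub>R f y"]) auto
  also have "\<dots> = (S / (S + d) * exp (- (cmod z)\<^sup>2 / (2 * (S + d)))) *\<^sub>R
     (\<integral>y. gdens (S * d / (S + d)) (y - of_real (S / (S + d)) * z) *\<^sub>R f y \<partial>lborel)"
    unfolding gdens_tilt[OF assms(2,3)] integral_scaleR_right[symmetric] by (simp only: scaleR_scaleR)
  also have "(\<integral>y. gdens (S * d / (S + d)) (y - of_real (S / (S + d)) * z) *\<^sub>R f y \<partial>lborel) =
     (\<integral>w. f (of_real (S / (S + d)) * z + w) \<partial>gauss (S * d / (S + d)))"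
    using assms by (subst integral_gauss_shift) auto
  finally show ?thesis .
qed

text \<open>Gaussian kernels are stable under convolution: their variances add.\<close>

lemma nn_integral_gauss_exp:
  assumes "0 < d" "0 < S"
  shows "(\<integral>\<^sup>+w. exp (- (cmod (z + w))\<^sup>2 / (2 * S)) \<partial>gauss d) =
    ennreal (S / (S + d) * exp (- (cmod z)\<^sup>2 / (2 * (S + d))))"
proof -
  let ?c = "S / (S + d) * exp (- (cmod z)\<^sup>2 / (2 * (S + d)))"
  have "(\<integral>\<^sup>+w. exp (- (cmod (z + w))\<^sup>2 / (2 * S)) \<partial>gauss d) =
    (\<integral>\<^sup>+y. ennreal (gdens d (y - z) * exp (- (cmod y)\<^sup>2 / (2 * S))) \<partial>lborel)"
    using assms by (subst nn_integral_gauss_shift[where f="\<lambda>y. ennreal (exp (- (cmod y)\<^sup>2 / (2 * S)))"])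
      (auto simp: ennreal_mult' gdens_nonneg)
  also have "\<dots> = (\<integral>\<^sup>+y. ?c * ennreal (gdens (S * d / (S + d)) (y - of_real (S / (S + d)) * z)) \<partial>lborel)"
    unfolding gdens_tilt[OF assms] using assms by (subst ennreal_mult') auto
  also have "\<dots> = ?c * (\<integral>\<^sup>+y. ennreal (gdens (S * d / (S + d)) (y - of_real (S / (S + d)) * z)) \<partial>lborel)"
    using assms by (subst nn_integral_cmult) auto
  also have "(\<integral>\<^sup>+y. ennreal (gdens (S * d / (S + d)) (y - of_real (S / (S + d)) * z)) \<partial>lborel) = 1"
    using nn_integral_gauss_shift[of "\<lambda>_. 1" "S * d / (S + d)" "of_real (S / (S + d)) * z"] assms
    by (simp del: of_real_divide)
  finally show ?thesis by simp
qed

section \<open>Gaussian means of complex powers\<close>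

text \<open>The circle parametrised by the fraction of a full turn, so that circle averages are integrals
  over the unit interval.\<close>

definition turn :: "real \<Rightarrow> complex" where
  "turn t = exp (2 * of_real pi * \<i> * of_real t)"

lemma norm_turn [simp]: "cmod (turn t) = 1"
proof -
  have "turn t = cis (2 * pi * t)" by (simp add: turn_def cis_conv_exp mult_ac)
  then show ?thesis by simp
qed

lemma continuous_turn [continuous_intros]: "continuous_on A turn"
  unfolding turn_def by (intro continuous_intros)

lemma borel_measurable_turn [measurable]: "turn \<in> borel_measurable borel"
  by (intro borel_measurable_continuous_onI continuous_turn)

text \<open>Cauchy's integral formula at the centre of the unit disc, written as an average over the circle.\<close>

lemma circle_mean_value:
  assumes "f holomorphic_on cball 0 1"
  shows "((\<lambda>t. f (turn t)) has_integral f 0) {0..1}"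
proof -
  have "((\<lambda>u. f u / (u - 0)) has_contour_integral (2 * of_real pi * \<i> * f 0)) (circlepath 0 1)"
    using assms by (intro Cauchy_integral_circlepath_simple) auto
  then have "((\<lambda>t. f (circlepath 0 1 t) / (circlepath 0 1 t) *
       vector_derivative (circlepath 0 1) (at t within {0..1})) has_integral (2 * of_real pi * \<i> * f 0)) {0..1}"
    by (simp add: has_contour_integral_def)
  then have "((\<lambda>t. (2 * of_real pi * \<i>) * f (turn t)) has_integral (2 * of_real pi * \<i> * f 0)) {0..1}"
    by (rule has_integral_eq[rotated])
       (auto simp: circlepath turn_def vector_derivative_circlepath01[of _ 0 1, unfolded circlepath, simplified])
  from has_integral_mult_right[OF this, of "inverse (2 * of_real pi * \<i>)"] show ?thesis
    by (simp add: field_simps)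
qed

text \<open>For \<open>cmod c < 1\<close> the points \<open>1 + c * z\<close> of the unit disc avoid the branch cut, so that the principal
  power is holomorphic and has the mean value property.\<close>

lemma circle_mean_powr:
  assumes "cmod c < 1"
  shows "set_integrable lborel {0..1} (\<lambda>t. (1 + c * turn t) powr \<nu>)"
    and "(LBINT t:{0..1}. (1 + c * turn t) powr \<nu>) = 1"
proof -
  have np: "1 + c * z \<notin> \<real>\<^sub>\<le>\<^sub>0" if "cmod z \<le> 1" for z
  proof
    assume "1 + c * z \<in> \<real>\<^sub>\<le>\<^sub>0"
    then have "Re (c * z) \<le> -1" by (simp add: complex_nonpos_Reals_iff)
    then have "1 \<le> cmod (c * z)" using abs_Re_le_cmod[of "c * z"] by linarith
    also have "\<dots> \<le> cmod c * 1" unfolding norm_mult using that by (intro mult_left_mono) auto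
    finally show False using assms by simp
  qed
  have "(\<lambda>z. (1 + c * z) powr \<nu>) holomorphic_on cball 0 1"
    using np by (intro holomorphic_intros) auto
  from circle_mean_value[OF this]
  have hi: "((\<lambda>t. (1 + c * turn t) powr \<nu>) has_integral 1) {0..1}" by simp
  have "continuous_on {0..1} (\<lambda>t. (1 + c * turn t) powr \<nu>)"
  proof (rule continuous_on_eq)
    show "continuous_on {0..1} (\<lambda>t. exp (\<nu> * Ln (1 + c * turn t)))"
      using np by (intro continuous_intros) auto
    show "exp (\<nu> * Ln (1 + c * turn t)) = (1 + c * turn t) powr \<nu>" for t
      using np[of "turn t"] by (auto simp: powr_def)
  qed
  then show si: "set_integrable lborel {0..1} (\<lambda>t. (1 + c * turn t) powr \<nu>)"
    by (simp add: borel_integrable_compact set_integrable_def)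
  from set_borel_integral_eq_integral(2)[OF si] hi
  show "(LBINT t:{0..1}. (1 + c * turn t) powr \<nu>) = 1" by (simp add: integral_unique)
qed

text \<open>The Gaussian law is invariant under rotations: averaging over all of them and exchanging the
  integrals replaces a function by its averages over circles.\<close>

lemma gauss_circle_average:
  fixes g :: "complex \<Rightarrow> complex"
  assumes v: "0 < v" and g: "integrable (gauss v) g"
  shows "(\<integral>w. g w \<partial>gauss v) = (\<integral>w. (LBINT t:{0..1}. g (turn t * w)) \<partial>gauss v)"
    and "integrable (gauss v) (\<lambda>w. LBINT t:{0..1}. g (turn t * w))"
proof -
  interpret G: prob_space "gauss v" by (rule prob_space_gauss[OF v])
  define U where "U = (density lborel (indicator {0..1}) :: real measure)"
  interpret U: finite_measure U
    by (rule finite_measureI) (auto simp: U_def emeasure_density)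
  interpret P: pair_sigma_finite U "gauss v" ..
  have sU [measurable_cong]: "sets U = sets borel" by (simp add: U_def)
  have [measurable]: "g \<in> borel_measurable borel"
    using borel_measurable_integrable[OF g] by simp
  have intU: "(\<integral>t. f t \<partial>U) = (LBINT t:{0..1}. f t)" if [measurable]: "f \<in> borel_measurable borel"
    for f :: "real \<Rightarrow> complex"
    unfolding U_def set_lebesgue_integral_def
    by (subst integral_density[of _ _ "indicator {0..1}", symmetric]) (auto simp: ennreal_indicator)
  have rot: "(\<integral>w. g (turn t * w) \<partial>gauss v) = (\<integral>w. g w \<partial>gauss v)" for t
    by (subst (2) gauss_distr_rotation[of "turn t", symmetric], simp, subst integral_distr) auto
  have nrot: "(\<integral>\<^sup>+w. norm (g (turn t * w)) \<partial>gauss v) = (\<integral>\<^sup>+w. norm (g w) \<partial>gauss v)" for t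
    by (subst (2) gauss_distr_rotation[of "turn t", symmetric], simp, subst nn_integral_distr) auto
  have int: "integrable (U \<Otimes>\<^sub>M gauss v) (\<lambda>(t, w). g (turn t * w))"
  proof (rule integrableI_bounded)
    have "(\<integral>\<^sup>+x. norm (case x of (t, w) \<Rightarrow> g (turn t * w)) \<partial>(U \<Otimes>\<^sub>M gauss v)) =
      (\<integral>\<^sup>+t. (\<integral>\<^sup>+w. norm (g (turn t * w)) \<partial>gauss v) \<partial>U)"
      by (subst G.nn_integral_fst[symmetric]) auto
    also have "\<dots> = (\<integral>\<^sup>+w. norm (g w) \<partial>gauss v) * emeasure U (space U)"
      unfolding nrot by simp
    also have "emeasure U (space U) = 1" by (simp add: U_def emeasure_density)
    also have "(\<integral>\<^sup>+w. norm (g w) \<partial>gauss v) * 1 < \<infinity>"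
      using g by (simp add: integrable_iff_bounded)
    finally show "(\<integral>\<^sup>+x. norm (case x of (t, w) \<Rightarrow> g (turn t * w)) \<partial>(U \<Otimes>\<^sub>M gauss v)) < \<infinity>" .
  qed measurable
  have "(\<integral>w. (\<integral>t. g (turn t * w) \<partial>U) \<partial>gauss v) = (\<integral>t. (\<integral>w. g (turn t * w) \<partial>gauss v) \<partial>U)"
    using P.Fubini_integral[OF int] by simp
  also have "\<dots> = measure U (space U) *\<^sub>R (\<integral>w. g w \<partial>gauss v)" unfolding rot by simp
  also have "measure U (space U) = 1" by (simp add: U_def measure_def emeasure_density)
  finally show "(\<integral>w. g w \<partial>gauss v) = (\<integral>w. (LBINT t:{0..1}. g (turn t * w)) \<partial>gauss v)"
    by (simp add: intU)
  show "integrable (gauss v) (\<lambda>w. LBINT t:{0..1}. g (turn t * w))"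
    using P.integrable_snd[OF int] by (simp add: intU)
qed

lemma powr_le_exp:
  fixes p :: real
  assumes "0 \<le> p"
  obtains C where "0 \<le> C" "\<And>y. 0 \<le> y \<Longrightarrow> y powr p \<le> C * exp y"
proof
  define n where "n = nat \<lceil>p\<rceil>"
  have n: "p \<le> real n" unfolding n_def by (rule real_nat_ceiling_ge)
  show "0 \<le> 1 + (fact n :: real)" by (simp add: add_nonneg_nonneg)
  fix y :: real assume y: "0 \<le> y"
  have f: "y ^ n \<le> fact n * exp y"
  proof -
    have "(\<Sum>k\<in>{n}. inverse (fact k) *\<^sub>R y ^ k) \<le> (\<Sum>k. inverse (fact k) *\<^sub>R y ^ k)"
      using y summable_exp_generic[of y] by (intro sum_le_suminf) auto
    then show ?thesis by (simp add: exp_def field_simps)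
  qed
  show "y powr p \<le> (1 + fact n) * exp y"
  proof (cases "y \<le> 1")
    case True
    have "y powr p \<le> 1" using True y assms by (simp add: powr_le1)
    also have "\<dots> \<le> exp y" using y by simp
    also have "\<dots> \<le> (1 + fact n) * exp y" by simp
    finally show ?thesis .
  next
    case False
    then have "y powr p \<le> y powr real n" using n by (intro powr_mono) auto
    also have "\<dots> = y ^ n" using False by (simp add: powr_realpow)
    also note f
    also have "fact n * exp y \<le> (1 + fact n) * exp y" by simp
    finally show ?thesis .
  qed
qed

text \<open>A power of \<open>(cmod w)\<^sup>2 / (4 * v)\<close> is dominated by its exponential, which costs half of the Gaussian
  exponent and leaves twice the density of variance \<open>2 * v\<close>.\<close>

lemma gauss_moment:
  fixes p :: real
  assumes p: "0 \<le> p"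
  obtains C where "0 \<le> C"
    "\<And>v. 0 < v \<Longrightarrow> (\<integral>\<^sup>+w. ennreal (cmod w powr p) \<partial>gauss v) \<le> ennreal (C * v powr (p / 2))"
proof -
  obtain C where C: "0 \<le> C" "\<And>y. 0 \<le> y \<Longrightarrow> y powr (p / 2) \<le> C * exp y"
    using powr_le_exp[of "p / 2"] p by auto
  have "(\<integral>\<^sup>+w. ennreal (cmod w powr p) \<partial>gauss v) \<le> ennreal (2 * C * 4 powr (p / 2) * v powr (p / 2))"
    if v: "0 < v" for v
  proof -
    have "cmod w powr p \<le> C * (4 * v) powr (p / 2) * exp ((cmod w)\<^sup>2 / (4 * v))" for w
    proof -
      have "cmod w powr p = ((cmod w)\<^sup>2) powr (p / 2)"
        by (cases "w = 0") (auto simp: powr_powr simp flip: powr_numeral)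
      also have "(cmod w)\<^sup>2 = 4 * v * ((cmod w)\<^sup>2 / (4 * v))" using v by simp
      also have "\<dots> powr (p / 2) = (4 * v) powr (p / 2) * ((cmod w)\<^sup>2 / (4 * v)) powr (p / 2)"
        using v by (subst powr_mult) auto
      also have "\<dots> \<le> (4 * v) powr (p / 2) * (C * exp ((cmod w)\<^sup>2 / (4 * v)))"
        using v by (intro mult_left_mono C) auto
      finally show ?thesis by (simp add: mult_ac)
    qed
    then have "(\<integral>\<^sup>+w. ennreal (cmod w powr p) \<partial>gauss v) \<le>
       (\<integral>\<^sup>+w. ennreal (C * (4 * v) powr (p / 2) * exp ((cmod w)\<^sup>2 / (4 * v))) \<partial>gauss v)"
      by (intro nn_integral_mono ennreal_leI)
    also have "\<dots> = (\<integral>\<^sup>+w. ennreal (gdens v w) * ennreal (C * (4 * v) powr (p / 2) * exp ((cmod w)\<^sup>2 / (4 * v))) \<partial>lborel)"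
      unfolding gauss_def by (subst nn_integral_density) auto
    also have "\<dots> = (\<integral>\<^sup>+w. ennreal (2 * C * (4 * v) powr (p / 2)) * ennreal (gdens (2 * v) w) \<partial>lborel)"
    proof (rule nn_integral_cong)
      fix w
      have "exp (- (cmod w)\<^sup>2 / (2 * v)) * exp ((cmod w)\<^sup>2 / (4 * v)) = exp (- (cmod w)\<^sup>2 / (2 * (2 * v)))"
        unfolding exp_add[symmetric] using v by (simp add: field_simps)
      then have "gdens v w * (C * (4 * v) powr (p / 2) * exp ((cmod w)\<^sup>2 / (4 * v))) =
         2 * C * (4 * v) powr (p / 2) * gdens (2 * v) w"
        using v by (simp add: gdens_def divide_simps)
      then show "ennreal (gdens v w) * ennreal (C * (4 * v) powr (p / 2) * exp ((cmod w)\<^sup>2 / (4 * v))) =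
         ennreal (2 * C * (4 * v) powr (p / 2)) * ennreal (gdens (2 * v) w)"
        using v C(1) by (simp add: ennreal_mult'[symmetric] gdens_nonneg)
    qed
    also have "\<dots> = ennreal (2 * C * (4 * v) powr (p / 2)) * (\<integral>\<^sup>+w. ennreal (gdens (2 * v) w) \<partial>lborel)"
      by (subst nn_integral_cmult) auto
    also have "(\<integral>\<^sup>+w. ennreal (gdens (2 * v) w) \<partial>lborel) = 1"
      using emeasure_gauss_UNIV[of "2 * v"] v by (simp add: gauss_def emeasure_density)
    finally show ?thesis using v by (simp add: powr_mult mult_ac)
  qed
  with that[of "2 * C * 4 powr (p / 2)"] C(1) show ?thesis by simp
qed

text \<open>The circle averages of the principal power around \<open>z\<close> equal its value at the centre as long as the
  circle does not reach the origin. Only jumps \<open>w\<close> with \<open>cmod w \<ge> cmod z\<close> contribute an error; there the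
  power is at most a constant times \<open>(cmod w / cmod z) powr p\<close> for each \<open>p \<ge> \<nu>\<close>, and the moment of order
  \<open>p\<close> of the Gaussian law gives the bound.\<close>

lemma gauss_power_mean:
  fixes \<nu> p :: real
  assumes \<nu>: "0 < \<nu>" and p: "\<nu> \<le> p"
  obtains C where "0 \<le> C"
    "\<And>z v. z \<noteq> 0 \<Longrightarrow> 0 < v \<Longrightarrow>
       cmod ((\<integral>w. ((z + w) / z) powr of_real \<nu> \<partial>gauss v) - 1) \<le> C * v powr (p / 2) * cmod z powr (- p)"
proof -
  obtain C where C: "0 \<le> C"
    "\<And>v. 0 < v \<Longrightarrow> (\<integral>\<^sup>+w. ennreal (cmod w powr p) \<partial>gauss v) \<le> ennreal (C * v powr (p / 2))"
    using gauss_moment[of p] \<nu> p by auto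
  define B where "B = 2 * 2 powr \<nu>"
  have B: "0 \<le> B" "1 \<le> B" "1 + 2 powr \<nu> \<le> B"
    using \<nu> ge_one_powr_ge_zero[of 2 \<nu>] by (simp_all add: B_def)
  \<comment> \<open>the error of a jump that is at least as long as the distance to the origin\<close>
  have bound: "cmod ((1 + c) powr of_real \<nu> - 1) \<le> B * cmod c powr p" if c: "1 \<le> cmod c" for c
  proof -
    have c1: "1 \<le> cmod c powr \<nu>" using c \<nu> by (simp add: ge_one_powr_ge_zero)
    have "cmod ((1 + c) powr of_real \<nu> - 1) \<le> cmod ((1 + c) powr of_real \<nu>) + 1"
      using norm_triangle_ineq4[of "(1 + c) powr of_real \<nu>" 1] by simp
    also have "cmod ((1 + c) powr of_real \<nu>) = cmod (1 + c) powr \<nu>" by (simp add: norm_powr_real_powr')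
    also have "\<dots> \<le> (2 * cmod c) powr \<nu>"
      using \<nu> c norm_triangle_ineq[of 1 c] by (intro powr_mono2) auto
    also have "\<dots> = 2 powr \<nu> * cmod c powr \<nu>" by (simp add: powr_mult)
    also have "\<dots> + 1 \<le> 2 powr \<nu> * cmod c powr \<nu> + 2 powr \<nu> * cmod c powr \<nu>"
      using mult_mono[of 1 "2 powr \<nu>" 1 "cmod c powr \<nu>"] c1 \<nu>
      by (simp add: ge_one_powr_ge_zero mult.commute)
    also have "\<dots> = B * cmod c powr \<nu>" by (simp add: B_def)
    also have "\<dots> \<le> B * cmod c powr p"
      using c p B by (intro mult_left_mono powr_mono) auto
    finally show ?thesis by simp
  qed
  have int: "integrable (gauss v) (\<lambda>w. ((z + w) / z) powr of_real \<nu>)" if z: "z \<noteq> 0" and v: "0 < v" for z v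
  proof -
    interpret G: prob_space "gauss v" by (rule prob_space_gauss[OF v])
    have "integrable (gauss v) (\<lambda>w. cmod w powr p)"
      using C(2)[OF v] by (intro integrableI_bounded) (auto simp: top.not_eq_extremum le_less_trans)
    then have "integrable (gauss v) (\<lambda>w. B * (1 / cmod z) powr p * cmod w powr p + 2 powr \<nu> + 1)"
      by simp
    then show ?thesis
    proof (rule Bochner_Integration.integrable_bound)
      show "AE w in gauss v. norm (((z + w) / z) powr of_real \<nu>) \<le>
        norm (B * (1 / cmod z) powr p * cmod w powr p + 2 powr \<nu> + 1)"
      proof (rule AE_I2)
        fix w
        have e: "(z + w) / z = 1 + w / z" using z by (simp add: field_simps)
        have "cmod ((1 + w / z) powr of_real \<nu>) \<le> B * cmod (w / z) powr p + 2 powr \<nu> + 1"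
        proof (cases "1 \<le> cmod (w / z)")
          case True
          then show ?thesis
            using bound[OF True] norm_triangle_sub[of "(1 + w / z) powr of_real \<nu>" 1, unfolded norm_one]
              powr_ge_zero[of 2 \<nu>]
            by linarith
        next
          case False
          then have "cmod (1 + w / z) \<le> 2" using norm_triangle_ineq[of 1 "w / z"] by simp
          then have "cmod (1 + w / z) powr \<nu> \<le> 2 powr \<nu>" using \<nu> by (intro powr_mono2) auto
          moreover have "0 \<le> B * cmod (w / z) powr p" using B by simp
          ultimately show ?thesis by (simp add: norm_powr_real_powr')
        qed
        also have "B * cmod (w / z) powr p = B * (1 / cmod z) powr p * cmod w powr p"
          by (simp add: norm_divide powr_divide)
        finally show "norm (((z + w) / z) powr of_real \<nu>) \<le>
          norm (B * (1 / cmod z) powr p * cmod w powr p + 2 powr \<nu> + 1)"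
          unfolding e using abs_ge_self order_trans by (metis real_norm_def)
      qed
    qed auto
  qed
  have "cmod ((\<integral>w. ((z + w) / z) powr of_real \<nu> \<partial>gauss v) - 1) \<le> B * C * v powr (p / 2) * cmod z powr (- p)"
    if z: "z \<noteq> 0" and v: "0 < v" for z v
  proof -
    interpret G: prob_space "gauss v" by (rule prob_space_gauss[OF v])
    define g where "g w = ((z + w) / z) powr of_real \<nu> - 1" for w
    have g: "integrable (gauss v) g" unfolding g_def using int[OF z v] by simp
    let ?b = "\<lambda>w. B * cmod z powr (- p) * cmod w powr p"
    define A where "A w = (LBINT t:{0..1}. g (turn t * w))" for w
    have A: "integrable (gauss v) A" unfolding A_def by (rule gauss_circle_average[OF v g])
    have gt: "g (turn t * w) = (1 + w / z * turn t) powr of_real \<nu> - 1" for t w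
    proof -
      have "(z + turn t * w) / z = 1 + w / z * turn t" using z by (simp add: field_simps)
      then show ?thesis by (simp add: g_def)
    qed
    have [measurable]: "g \<in> borel_measurable borel" unfolding g_def by measurable
    have Abd: "cmod (A w) \<le> ?b w" for w
    proof (cases "cmod (w / z) < 1")
      case True
      let ?h = "\<lambda>t. (1 + w / z * turn t) powr of_real \<nu>"
      have "A w = (LBINT t:{0..1}. ?h t) - (LBINT t:{0..1::real}. 1)"
        unfolding A_def gt by (intro set_integral_diff circle_mean_powr(1) True) (simp add: set_integrable_def)
      also have "\<dots> = 0" unfolding circle_mean_powr(2)[OF True] by (simp add: set_lebesgue_integral_def)
      finally show ?thesis using B by simp
    next
      case False
      then have le: "1 \<le> cmod (w / z)" by simp
      have "cmod (g (turn t * w)) \<le> ?b w" for t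
      proof -
        have "cmod (g (turn t * w)) \<le> B * cmod (w / z * turn t) powr p"
          unfolding gt by (rule bound) (use le in \<open>simp add: norm_mult norm_divide\<close>)
        also have "\<dots> = ?b w"
          by (simp add: norm_mult norm_divide powr_divide powr_minus field_simps)
        finally show ?thesis .
      qed
      note gb = this
      have gi: "set_integrable lborel {0..1} (\<lambda>t. g (turn t * w))"
        unfolding set_integrable_def
        by (rule integrableI_bounded_set_indicator[where B="?b w"])
           (simp_all add: gb)
      have "cmod (A w) \<le> (LBINT t:{0..1}. cmod (g (turn t * w)))"
        unfolding A_def by (rule set_integral_norm_bound[OF gi])
      also have "\<dots> \<le> (LBINT t:{0..1::real}. ?b w)"
        using gi gb by (intro set_integral_mono set_integrable_norm) (auto simp: set_integrable_def)
      finally show ?thesis by (simp add: set_lebesgue_integral_def)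
    qed
    have "cmod ((\<integral>w. ((z + w) / z) powr of_real \<nu> \<partial>gauss v) - 1) = cmod (\<integral>w. g w \<partial>gauss v)"
      unfolding g_def using int[OF z v] by (subst Bochner_Integration.integral_diff) (auto simp: G.prob_space[simplified])
    also have "(\<integral>w. g w \<partial>gauss v) = (\<integral>w. A w \<partial>gauss v)"
      unfolding A_def by (rule gauss_circle_average[OF v g])
    also have "ennreal (cmod (\<integral>w. A w \<partial>gauss v)) \<le> (\<integral>\<^sup>+w. ennreal (cmod (A w)) \<partial>gauss v)"
      by (rule integral_norm_bound_ennreal[OF A])
    also have "\<dots> \<le> (\<integral>\<^sup>+w. ennreal (B * cmod z powr (- p)) * ennreal (cmod w powr p) \<partial>gauss v)"
      using Abd B by (intro nn_integral_mono) (simp add: ennreal_mult'[symmetric] ennreal_leI)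
    also have "\<dots> = ennreal (B * cmod z powr (- p)) * (\<integral>\<^sup>+w. ennreal (cmod w powr p) \<partial>gauss v)"
      by (intro nn_integral_cmult) auto
    also have "\<dots> \<le> ennreal (B * cmod z powr (- p)) * ennreal (C * v powr (p / 2))"
      by (intro mult_left_mono C v) auto
    also have "\<dots> = ennreal (B * C * v powr (p / 2) * cmod z powr (- p))"
      using B C by (simp add: ennreal_mult'[symmetric] mult_ac)
    finally show ?thesis using B C by (simp add: ennreal_le_iff)
  qed
  with that[of "B * C"] B C show ?thesis by simp
qed

section \<open>Negative moments of the Gaussian law\<close>

lemma nn_integral_abs_powr_finite:
  fixes a :: real
  assumes "a < 1"
  shows "(\<integral>\<^sup>+x. indicator {-1..1} x * ennreal (\<bar>x\<bar> powr (- a)) \<partial>lborel) < \<infinity>"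
proof -
  let ?f = "\<lambda>x. indicator {0..1} x * ennreal (x powr (- a))"
  have "((\<lambda>x. x powr (- a)) has_integral 1 powr (- a + 1) / (- a + 1)) {0..1}"
    using assms by (intro has_integral_powr_from_0) auto
  then have "(\<integral>\<^sup>+x. indicator {0..1} x * ennreal (x powr (- a)) \<partial>lborel) = ennreal (1 / (1 - a))"
    using nn_integral_has_integral_lebesgue'[of "{0..1}" "\<lambda>x. x powr (- a)"] by (simp add: mult.commute)
  moreover have "(\<integral>\<^sup>+x. ?f (- x) \<partial>lborel) = (\<integral>\<^sup>+x. ?f x \<partial>lborel)"
    by (subst (2) lborel_distr_uminus[symmetric], subst nn_integral_distr) auto
  moreover have "(\<integral>\<^sup>+x. indicator {-1..1} x * ennreal (\<bar>x\<bar> powr (- a)) \<partial>lborel) \<le> (\<integral>\<^sup>+x. ?f x + ?f (- x) \<partial>lborel)"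
    by (intro nn_integral_mono) (auto split: split_indicator)
  moreover have "(\<integral>\<^sup>+x. ?f x + ?f (- x) \<partial>lborel) = (\<integral>\<^sup>+x. ?f x \<partial>lborel) + (\<integral>\<^sup>+x. ?f (- x) \<partial>lborel)"
    by (intro nn_integral_add) auto
  ultimately show ?thesis by (auto intro: le_less_trans simp: ennreal_add_less_top)
qed

text \<open>The density of the Gaussian law around \<open>1\<close> is bounded near the origin uniformly in the
  variance, so that only the integrability of \<open>cmod y powr - r\<close> at the origin of the plane matters;
  it holds for \<open>r < 2\<close> because \<open>cmod y powr - r\<close> is at most
  \<open>\<bar>Re y\<bar> powr (- r / 2) * \<bar>Im y\<bar> powr (- r / 2)\<close>.\<close>

lemma gauss_negative_moment:
  fixes r :: real
  assumes r: "0 \<le> r" "r < 2"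
  obtains C where "0 \<le> C"
    "\<And>v. 0 < v \<Longrightarrow> (\<integral>\<^sup>+w. ennreal (cmod (1 + w) powr (- r)) \<partial>gauss v) \<le> ennreal C"
proof -
  define h where "h x = indicator {-1..1} x * ennreal (\<bar>x\<bar> powr (- (r / 2)))" for x :: real
  have [measurable]: "h \<in> borel_measurable borel" unfolding h_def by measurable
  have hfin: "(\<integral>\<^sup>+x. h x \<partial>lborel) < \<infinity>"
    unfolding h_def using r by (intro nn_integral_abs_powr_finite) auto
  let ?I = "\<lambda>y::complex. indicator {y. cmod y < 1 / 2} y :: ennreal"
  have "(\<integral>\<^sup>+y. ?I y * ennreal (cmod y powr (- r)) \<partial>lborel) \<le> (\<integral>\<^sup>+x. (\<integral>\<^sup>+y. h x * h y \<partial>lborel) \<partial>lborel)"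
  proof -
    let ?i = "\<lambda>x y. ?I (Complex x y) * ennreal (cmod (Complex x y) powr (- r))"
    have "(\<integral>\<^sup>+y. ?i x y \<partial>lborel) \<le> (\<integral>\<^sup>+y. h x * h y \<partial>lborel)"
      if x: "x \<noteq> 0" for x
    proof (rule nn_integral_mono_AE)
      have "AE y in lborel. y \<noteq> (0::real)" by (rule AE_lborel_singleton)
      then show "AE y in lborel. ?i x y \<le> h x * h y"
      proof eventually_elim
        case (elim y)
        show ?case
        proof (cases "cmod (Complex x y) < 1 / 2")
          case True
          have "\<bar>x\<bar> \<le> 1 / 2" "\<bar>y\<bar> \<le> 1 / 2"
            using True abs_Re_le_cmod[of "Complex x y"] abs_Im_le_cmod[of "Complex x y"] by auto
          then have "x \<in> {-1..1}" "y \<in> {-1..1}" by (auto simp: abs_le_iff)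
          then have h: "h x * h y = ennreal (\<bar>x\<bar> powr (- (r / 2)) * \<bar>y\<bar> powr (- (r / 2)))"
            by (simp add: h_def ennreal_mult')
          have "cmod (Complex x y) powr (- r) = ((cmod (Complex x y))\<^sup>2) powr (- (r / 2))"
            using x by (simp add: powr_powr flip: powr_numeral)
          also have "\<dots> \<le> (\<bar>x\<bar> * \<bar>y\<bar>) powr (- (r / 2))"
          proof (rule powr_mono2')
            have "2 * (\<bar>x\<bar> * \<bar>y\<bar>) \<le> x\<^sup>2 + y\<^sup>2"
              using sum_squares_bound[of "\<bar>x\<bar>" "\<bar>y\<bar>"] by (simp add: mult.assoc)
            moreover have "0 \<le> \<bar>x\<bar> * \<bar>y\<bar>" by simp
            ultimately show "\<bar>x\<bar> * \<bar>y\<bar> \<le> (cmod (Complex x y))\<^sup>2"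
              unfolding cmod_power2 complex.sel by linarith
          qed (use x elim r in auto)
          also have "\<dots> = \<bar>x\<bar> powr (- (r / 2)) * \<bar>y\<bar> powr (- (r / 2))" by (simp add: powr_mult)
          finally show ?thesis unfolding h using True by (simp add: ennreal_leI)
        qed simp
      qed
    qed
    then have "AE x in lborel. (\<integral>\<^sup>+y. ?i x y \<partial>lborel) \<le> (\<integral>\<^sup>+y. h x * h y \<partial>lborel)"
      using AE_lborel_singleton[of "0::real"] by (auto elim: eventually_mono)
    then show ?thesis
      by (subst nn_integral_lborel_complex) (auto intro!: nn_integral_mono_AE)
  qed
  also have "\<dots> = (\<integral>\<^sup>+x. h x \<partial>lborel) * (\<integral>\<^sup>+y. h y \<partial>lborel)"
    by (simp add: nn_integral_cmult nn_integral_multc)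
  also have "\<dots> < \<infinity>" using hfin by (simp add: ennreal_mult_less_top)
  finally obtain K where K: "0 \<le> K" "(\<integral>\<^sup>+y. ?I y * ennreal (cmod y powr (- r)) \<partial>lborel) = ennreal K"
    by (cases "\<integral>\<^sup>+y. ?I y * ennreal (cmod y powr (- r)) \<partial>lborel" rule: ennreal_cases) auto
  have "(\<integral>\<^sup>+w. ennreal (cmod (1 + w) powr (- r)) \<partial>gauss v) \<le> ennreal (2 powr r + 2 * K)" if v: "0 < v" for v
  proof -
    have "(\<integral>\<^sup>+w. ennreal (cmod (1 + w) powr (- r)) \<partial>gauss v) = (\<integral>\<^sup>+y. ennreal (gdens v (y - 1)) * ennreal (cmod y powr (- r)) \<partial>lborel)"
      using v by (intro nn_integral_gauss_shift) auto
    also have "\<dots> \<le> (\<integral>\<^sup>+y. ennreal (2 powr r) * ennreal (gdens v (y - 1)) + 2 * (?I y * ennreal (cmod y powr (- r))) \<partial>lborel)"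
    proof (rule nn_integral_mono)
      fix y :: complex
      show "ennreal (gdens v (y - 1)) * ennreal (cmod y powr (- r)) \<le>
         ennreal (2 powr r) * ennreal (gdens v (y - 1)) + 2 * (?I y * ennreal (cmod y powr (- r)))"
      proof (cases "cmod y < 1 / 2")
        case True
        have "1 / 2 \<le> cmod (y - 1)"
          using True norm_triangle_ineq2[of 1 y] by (simp add: norm_minus_commute)
        then have "(1 / 2)\<^sup>2 \<le> (cmod (y - 1))\<^sup>2" by (intro power_mono) auto
        then have "exp (- (cmod (y - 1))\<^sup>2 / (2 * v)) \<le> exp (- (1 / (8 * v)))"
          using v by (simp add: field_simps power2_eq_square)
        also have "exp (- (1 / (8 * v))) \<le> 8 * v"
        proof -
          have "1 / (8 * v) \<le> exp (1 / (8 * v))" using exp_ge_add_one_self[of "1 / (8 * v)"] by linarith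
          then show ?thesis using v by (simp add: exp_minus field_simps)
        qed
        \<comment> \<open>at distance \<open>1 / 2\<close> from the centre the density is at most \<open>4 / \<pi>\<close>, whatever the variance\<close>
        finally have "gdens v (y - 1) \<le> 8 * v / (2 * pi * v)"
          unfolding gdens_def using v by (intro divide_right_mono) auto
        also have "\<dots> \<le> 2" using v pi_gt3 by (simp add: field_simps)
        finally have "ennreal (gdens v (y - 1)) \<le> 2" by (metis ennreal_leI ennreal_numeral zero_le_numeral)
        then have "ennreal (gdens v (y - 1)) * ennreal (cmod y powr (- r)) \<le> 2 * ennreal (cmod y powr (- r))"
          by (intro mult_right_mono) auto
        then show ?thesis using True by (simp add: add_increasing)
      next
        case False
        have "cmod y powr (- r) \<le> (1 / 2) powr (- r)"
          using False r by (intro powr_mono2') auto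
        also have "\<dots> = 2 powr r" by (simp add: powr_divide powr_minus field_simps)
        finally have "gdens v (y - 1) * cmod y powr (- r) \<le> 2 powr r * gdens v (y - 1)"
          using v by (subst mult.commute) (intro mult_right_mono gdens_nonneg)
        then have "ennreal (gdens v (y - 1)) * ennreal (cmod y powr (- r)) \<le> ennreal (2 powr r) * ennreal (gdens v (y - 1))"
          using v by (simp add: ennreal_mult'[symmetric] gdens_nonneg ennreal_leI)
        then show ?thesis by (simp add: add_increasing2)
      qed
    qed
    also have "\<dots> = ennreal (2 powr r) * (\<integral>\<^sup>+y. ennreal (gdens v (y - 1)) \<partial>lborel) + 2 * ennreal K"
      unfolding K(2)[symmetric] by (simp add: nn_integral_add nn_integral_cmult)
    also have "(\<integral>\<^sup>+y. ennreal (gdens v (y - 1)) \<partial>lborel) = 1"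
      using nn_integral_gauss_shift[of "\<lambda>_. 1" v 1] v by simp
    finally show ?thesis using K(1) by (simp add: ennreal_mult' flip: ennreal_numeral)
  qed
  moreover have "0 \<le> 2 powr r + 2 * K" using K by simp
  ultimately show ?thesis using that by blast
qed

section \<open>Increments of complex Brownian motion\<close>

context complex_brownian_motion
begin

interpretation R: real_brownian_motion M "Re z" "\<lambda>t \<omega>. Re (W t \<omega>)" by (rule Re_brownian)
interpretation I: real_brownian_motion M "Im z" "\<lambda>t \<omega>. Im (W t \<omega>)" by (rule Im_brownian)

lemma measurable_W: "0 \<le> t \<Longrightarrow> W t \<in> borel_measurable M"
proof -
  show "0 \<le> t \<Longrightarrow> ?thesis"
    using R.random_variable[of t] I.random_variable[of t] by (simp add: borel_measurable_complex_iff)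
qed

lemma AE_start: "AE \<omega> in M. W 0 \<omega> = z"
proof -
  show ?thesis using R.start I.start by eventually_elim (simp add: complex_eq_iff)
qed

lemma continuous_path: "\<omega> \<in> space M \<Longrightarrow> continuous_on {0..} (\<lambda>t. W t \<omega>)"
proof -
  assume \<omega>: "\<omega> \<in> space M"
  have "continuous_on {0..} (\<lambda>t. complex_of_real (Re (W t \<omega>)) + \<i> * complex_of_real (Im (W t \<omega>)))"
    using R.continuous_paths[OF \<omega>] I.continuous_paths[OF \<omega>]
    by (intro continuous_on_add continuous_on_mult_left continuous_on_of_real)
  then show ?thesis by (rule continuous_on_eq) (simp add: complex_eq_iff)
qed

text \<open>The independence of the coordinate processes, restricted to finitely many increments.\<close>

lemma prob_Re_Im_increments:
  fixes s t :: "nat \<Rightarrow> real"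
  assumes J: "finite J" and s: "\<And>j. 0 \<le> s j" and t: "\<And>j. 0 \<le> t j"
    and [measurable]: "\<And>j. P j \<in> sets borel" "\<And>j. Q j \<in> sets borel"
  shows "prob {\<omega>\<in>space M. \<forall>j\<in>J. Re (W (t j) \<omega> - W (s j) \<omega>) \<in> P j \<and> Im (W (t j) \<omega> - W (s j) \<omega>) \<in> Q j} =
    prob {\<omega>\<in>space M. \<forall>j\<in>J. Re (W (t j) \<omega> - W (s j) \<omega>) \<in> P j} *
    prob {\<omega>\<in>space M. \<forall>j\<in>J. Im (W (t j) \<omega> - W (s j) \<omega>) \<in> Q j}"
proof -
  define E where "E P = {x \<in> space (Pi\<^sub>M {0::real..} (\<lambda>_. borel)). \<forall>j\<in>J. x (t j) - x (s j) \<in> P j}"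
    for P :: "nat \<Rightarrow> real set"
  have E: "E P \<in> sets (Pi\<^sub>M {0::real..} (\<lambda>_. borel))" if [measurable]: "\<And>j. P j \<in> sets borel" for P
  proof -
    have [measurable]: "t j \<in> {0..}" "s j \<in> {0..}" for j using s t by auto
    show ?thesis unfolding E_def using J by measurable
  qed
  from indep_varD[OF Re_Im_independent E E, of P Q]
  show ?thesis using s t
    by (auto simp: E_def space_PiM PiE_def extensional_def vimage_def Int_def conj_commute ball_conj_distrib
        intro!: arg_cong2[where f="(*)"] arg_cong[where f=prob])
qed

lemma increment_law:
  assumes "0 \<le> s" "s < t"
  shows "distr M borel (\<lambda>\<omega>. W t \<omega> - W s \<omega>) = gauss (t - s)"
proof -
  let ?N = "density lborel (normal_density 0 (sqrt (t - s)))"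
  have [measurable]: "W t \<in> borel_measurable M" "W s \<in> borel_measurable M"
    using assms by (auto intro: measurable_W)
  have d: "distr M borel f = ?N" if "distributed M lborel f (normal_density 0 (sqrt (t - s)))" for f
    using distributed_distr_eq_density[OF that] by (simp cong: distr_cong)
  have XR: "distr M borel (\<lambda>\<omega>. Re (W t \<omega>) - Re (W s \<omega>)) = ?N"
    by (rule d) (rule R.gaussian_increments[OF assms])
  have XI: "distr M borel (\<lambda>\<omega>. Im (W t \<omega>) - Im (W s \<omega>)) = ?N"
    by (rule d) (rule I.gaussian_increments[OF assms])
  have [measurable]: "t \<in> {0..}" "s \<in> {0..}" using assms by auto
  have "indep_var borel ((\<lambda>x. x t - x s) \<circ> (\<lambda>\<omega>. \<lambda>t\<in>{0..}. Re (W t \<omega>)))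
     borel ((\<lambda>x. x t - x s) \<circ> (\<lambda>\<omega>. \<lambda>t\<in>{0..}. Im (W t \<omega>)))"
    by (rule indep_var_compose[OF Re_Im_independent]) measurable
  then have "indep_var borel (\<lambda>\<omega>. Re (W t \<omega>) - Re (W s \<omega>)) borel (\<lambda>\<omega>. Im (W t \<omega>) - Im (W s \<omega>))"
    using assms by (simp add: comp_def)
  then have "distr M (borel \<Otimes>\<^sub>M borel) (\<lambda>\<omega>. (Re (W t \<omega>) - Re (W s \<omega>), Im (W t \<omega>) - Im (W s \<omega>))) = ?N \<Otimes>\<^sub>M ?N"
    unfolding indep_var_distribution_eq XR XI by simp
  then have "gauss (t - s) = distr (distr M (borel \<Otimes>\<^sub>M borel) (\<lambda>\<omega>. (Re (W t \<omega>) - Re (W s \<omega>), Im (W t \<omega>) - Im (W s \<omega>))))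
     borel (\<lambda>p. Complex (fst p) (snd p))"
    using distr_normal_pair[of "t - s"] assms by simp
  also have "\<dots> = distr M borel (\<lambda>\<omega>. W t \<omega> - W s \<omega>)"
    by (subst distr_distr) (auto simp: comp_def complex_eq_iff intro!: distr_cong)
  finally show ?thesis ..
qed

text \<open>The increments of each coordinate are independent and the two coordinate processes are
  independent of each other, so probabilities of events described by rectangles factorise. Rectangles
  are stable under intersection and generate the Borel sets of the plane.\<close>

lemma increments_indep:
  fixes t :: "nat \<Rightarrow> real"
  assumes t0: "0 \<le> t 0" and mono: "\<And>i. t i \<le> t (Suc i)"
  shows "indep_vars (\<lambda>_. borel) (\<lambda>i \<omega>. W (t (Suc i)) \<omega> - W (t i) \<omega>) {..<n}"
proof -
  define D where "D i \<omega> = W (t (Suc i)) \<omega> - W (t i) \<omega>" for i \<omega>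
  have t: "0 \<le> t i" for i using t0 mono by (induction i) (auto intro: order_trans)
  have [measurable]: "D i \<in> borel_measurable M" for i
    unfolding D_def using t by (intro borel_measurable_diff measurable_W)
  have iR: "indep_vars (\<lambda>_. borel) (\<lambda>i \<omega>. Re (D i \<omega>)) {..<n}"
    using R.independent_increments[of t n] t0 mono by (simp add: D_def)
  have iI: "indep_vars (\<lambda>_. borel) (\<lambda>i \<omega>. Im (D i \<omega>)) {..<n}"
    using I.independent_increments[of t n] t0 mono by (simp add: D_def)
  have fac: "prob {\<omega>\<in>space M. \<forall>j\<in>J. Re (D j \<omega>) \<in> P j \<and> Im (D j \<omega>) \<in> Q j} =
    prob {\<omega>\<in>space M. \<forall>j\<in>J. Re (D j \<omega>) \<in> P j} * prob {\<omega>\<in>space M. \<forall>j\<in>J. Im (D j \<omega>) \<in> Q j}"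
    if "finite J" "\<And>j. P j \<in> sets borel" "\<And>j. Q j \<in> sets borel" for J P Q
    unfolding D_def using that t by (intro prob_Re_Im_increments) auto
  define rect where "rect i A B = {\<omega>\<in>space M. Re (D i \<omega>) \<in> A \<and> Im (D i \<omega>) \<in> B}" for i A B
  define F where "F i = {rect i A B |A B. A \<in> sets borel \<and> B \<in> sets borel}" for i
  have "indep_sets F {..<n}"
  proof (rule indep_setsI)
    show "F i \<subseteq> events" for i by (auto simp: F_def rect_def)
    fix A J assume J: "J \<noteq> {}" "J \<subseteq> {..<n}" "finite J" and A: "\<forall>j\<in>J. A j \<in> F j"
    then obtain P Q where PQ: "\<And>j. j \<in> J \<Longrightarrow> A j = rect j (P j) (Q j) \<and> P j \<in> sets borel \<and> Q j \<in> sets borel"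
      unfolding F_def by simp metis
    define P' where "P' j = (if j \<in> J then P j else UNIV)" for j
    define Q' where "Q' j = (if j \<in> J then Q j else UNIV)" for j
    have PQ': "P' j \<in> sets borel" "Q' j \<in> sets borel" for j
      using PQ by (auto simp: P'_def Q'_def)
    have A': "A j = rect j (P' j) (Q' j)" if "j \<in> J" for j using PQ that by (simp add: P'_def Q'_def)
    have pr: "prob {\<omega>\<in>space M. \<forall>j\<in>J. X j \<omega> \<in> P j} = (\<Prod>j\<in>J. prob {\<omega>\<in>space M. X j \<omega> \<in> P j})"
      if "indep_vars (\<lambda>_. borel) X {..<n}" "\<And>j. P j \<in> sets borel" for X :: "nat \<Rightarrow> 'a \<Rightarrow> real" and P
      using indep_varsD[OF that(1) J(1,3,2), of P] that(2) J(1)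
      by (auto simp: vimage_def Int_def conj_commute intro!: arg_cong[where f=prob] elim!: trans[rotated])
    have "(\<Inter>j\<in>J. A j) = {\<omega>\<in>space M. \<forall>j\<in>J. Re (D j \<omega>) \<in> P' j \<and> Im (D j \<omega>) \<in> Q' j}"
      using J(1) A' by (auto simp: rect_def)
    then have "prob (\<Inter>j\<in>J. A j) = prob {\<omega>\<in>space M. \<forall>j\<in>J. Re (D j \<omega>) \<in> P' j} * prob {\<omega>\<in>space M. \<forall>j\<in>J. Im (D j \<omega>) \<in> Q' j}"
      using fac[OF J(3) PQ'] by simp
    also have "\<dots> = (\<Prod>j\<in>J. prob {\<omega>\<in>space M. Re (D j \<omega>) \<in> P' j}) * (\<Prod>j\<in>J. prob {\<omega>\<in>space M. Im (D j \<omega>) \<in> Q' j})"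
      using PQ' by (subst (1 2) pr) (auto intro: iR iI)
    also have "\<dots> = (\<Prod>j\<in>J. prob {\<omega>\<in>space M. Re (D j \<omega>) \<in> P' j} * prob {\<omega>\<in>space M. Im (D j \<omega>) \<in> Q' j})"
      by (simp add: prod.distrib)
    also have "\<dots> = (\<Prod>j\<in>J. prob (A j))"
      using fac[of "{j}" P' Q' for j] PQ' A' by (intro prod.cong) (simp_all add: rect_def)
    finally show "prob (\<Inter>j\<in>J. A j) = (\<Prod>j\<in>J. prob (A j))" .
  qed
  moreover have "Int_stable (F i)" for i
  proof (rule Int_stableI)
    fix a b assume "a \<in> F i" "b \<in> F i"
    then obtain A B A' B' where "a = rect i A B" "b = rect i A' B'"
      "A \<in> sets borel" "B \<in> sets borel" "A' \<in> sets borel" "B' \<in> sets borel" by (auto simp: F_def)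
    moreover have "rect i A B \<inter> rect i A' B' = rect i (A \<inter> A') (B \<inter> B')" by (auto simp: rect_def)
    ultimately show "a \<inter> b \<in> F i" unfolding F_def by blast
  qed
  ultimately have sg: "indep_sets (\<lambda>i. sigma_sets (space M) (F i)) {..<n}" by (intro indep_sets_sigma)
  have "indep_sets (\<lambda>i. {D i -` A \<inter> space M |A. A \<in> sets borel}) {..<n}"
  proof (rule indep_sets_mono_sets[OF sg])
    fix i
    have Fs: "F i \<subseteq> Pow (space M)" by (auto simp: F_def rect_def)
    have [measurable]: "(\<lambda>\<omega>. Re (D i \<omega>)) \<in> borel_measurable (sigma (space M) (F i))"
    proof (rule measurableI)
      fix A :: "real set" assume "A \<in> sets borel"
      moreover have "(\<lambda>\<omega>. Re (D i \<omega>)) -` A \<inter> space M = rect i A UNIV" by (auto simp: rect_def)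
      ultimately have "(\<lambda>\<omega>. Re (D i \<omega>)) -` A \<inter> space M \<in> F i"
        unfolding F_def using sets.top[of borel] by (metis (mono_tags, lifting) mem_Collect_eq space_borel)
      then show "(\<lambda>\<omega>. Re (D i \<omega>)) -` A \<inter> space (sigma (space M) (F i)) \<in> sets (sigma (space M) (F i))"
        using Fs by (auto simp: space_measure_of sets_measure_of)
    qed simp
    have [measurable]: "(\<lambda>\<omega>. Im (D i \<omega>)) \<in> borel_measurable (sigma (space M) (F i))"
    proof (rule measurableI)
      fix A :: "real set" assume "A \<in> sets borel"
      moreover have "(\<lambda>\<omega>. Im (D i \<omega>)) -` A \<inter> space M = rect i UNIV A" by (auto simp: rect_def)
      ultimately have "(\<lambda>\<omega>. Im (D i \<omega>)) -` A \<inter> space M \<in> F i"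
        unfolding F_def using sets.top[of borel] by (metis (mono_tags, lifting) mem_Collect_eq space_borel)
      then show "(\<lambda>\<omega>. Im (D i \<omega>)) -` A \<inter> space (sigma (space M) (F i)) \<in> sets (sigma (space M) (F i))"
        using Fs by (auto simp: space_measure_of sets_measure_of)
    qed simp
    have D: "D i \<in> borel_measurable (sigma (space M) (F i))"
      by (subst borel_measurable_complex_iff) simp
    show "{D i -` A \<inter> space M |A. A \<in> sets borel} \<subseteq> sigma_sets (space M) (F i)"
      using measurable_sets[OF D] Fs by (auto simp: space_measure_of sets_measure_of)
  qed
  then show ?thesis unfolding indep_vars_def2 D_def[symmetric] by simp
qed

text \<open>Brownian motion starts at \<open>z\<close> only almost surely. The process \<open>V\<close>, shifted so as to start at \<open>z\<close>
  everywhere, has the same increments and almost surely the same paths.\<close>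

definition V :: "real \<Rightarrow> 'a \<Rightarrow> complex" where
  "V t \<omega> = z + (W t \<omega> - W 0 \<omega>)"

lemma V_0 [simp]: "V 0 \<omega> = z"
  by (simp add: V_def)

lemma AE_V_eq_W: "AE \<omega> in M. \<forall>t. V t \<omega> = W t \<omega>"
  using AE_start by eventually_elim (simp add: V_def)

lemma measurable_V [measurable]: "0 \<le> t \<Longrightarrow> V t \<in> borel_measurable M"
  unfolding V_def by (intro borel_measurable_add borel_measurable_diff borel_measurable_const measurable_W) auto

lemma continuous_V: "\<omega> \<in> space M \<Longrightarrow> continuous_on {0..} (\<lambda>t. V t \<omega>)"
  unfolding V_def by (intro continuous_intros continuous_path)

lemma nn_integral_V:
  assumes t: "0 < t" and [measurable]: "f \<in> borel_measurable borel"
  shows "(\<integral>\<^sup>+\<omega>. f (V t \<omega>) \<partial>M) = (\<integral>\<^sup>+w. f (z + w) \<partial>gauss t)"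
proof -
  have [measurable]: "W t \<in> borel_measurable M" "W 0 \<in> borel_measurable M"
    using t by (auto intro: measurable_W)
  have "(\<integral>\<^sup>+w. f (z + w) \<partial>gauss t) = (\<integral>\<^sup>+w. f (z + w) \<partial>distr M borel (\<lambda>\<omega>. W t \<omega> - W 0 \<omega>))"
    using increment_law[of 0 t] t by simp
  also have "\<dots> = (\<integral>\<^sup>+\<omega>. f (V t \<omega>) \<partial>M)"
    by (subst nn_integral_distr) (auto simp: V_def)
  finally show ?thesis ..
qed

definition path :: "real \<Rightarrow> nat \<Rightarrow> 'a \<Rightarrow> nat \<Rightarrow> complex" where
  "path \<delta> k \<omega> = (\<lambda>j\<in>{..k}. V (real j * \<delta>) \<omega>)"

lemma path_apply [simp]: "j \<le> k \<Longrightarrow> path \<delta> k \<omega> j = V (real j * \<delta>) \<omega>"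
  by (simp add: path_def)

lemma measurable_path:
  assumes "0 \<le> \<delta>"
  shows "path \<delta> k \<in> measurable M (Pi\<^sub>M {..k} (\<lambda>_. borel))"
  unfolding path_def using assms by (intro measurable_restrict measurable_V) auto

text \<open>The Markov property along a grid: the past is a function of the increments before step \<open>k\<close>, which are
  independent of the next one.\<close>

lemma distr_past_increment:
  assumes \<delta>: "0 < \<delta>"
  shows "distr M (Pi\<^sub>M {..k} (\<lambda>_. borel) \<Otimes>\<^sub>M borel) (\<lambda>\<omega>. (path \<delta> k \<omega>, V (real (Suc k) * \<delta>) \<omega> - V (real k * \<delta>) \<omega>)) =
     distr M (Pi\<^sub>M {..k} (\<lambda>_. borel)) (path \<delta> k) \<Otimes>\<^sub>M gauss \<delta>"
proof -
  define D where "D i \<omega> = W (real (Suc i) * \<delta>) \<omega> - W (real i * \<delta>) \<omega>" for i \<omega>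
  let ?P = "Pi\<^sub>M {..k} (\<lambda>_. borel) :: (nat \<Rightarrow> complex) measure"
  let ?Q = "Pi\<^sub>M {k} (\<lambda>_. borel) :: (nat \<Rightarrow> complex) measure"
  let ?d = "\<lambda>\<omega>. \<lambda>i\<in>{k}. D i \<omega>"
  have ind: "indep_vars (\<lambda>_. borel) D {..<Suc k}"
    using increments_indep[of "\<lambda>i. real i * \<delta>" "Suc k"] \<delta> by (simp add: D_def[abs_def] mult_right_mono)
  have [measurable]: "D i \<in> borel_measurable M" for i
    unfolding D_def using \<delta> by (intro borel_measurable_diff measurable_W) auto
  have [measurable]: "path \<delta> k \<in> measurable M ?P" using \<delta> by (intro measurable_path) auto
  have V: "V (real j * \<delta>) \<omega> = z + (\<Sum>i<j. D i \<omega>)" for j \<omega>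
    using sum_lessThan_telescope[of "\<lambda>i. W (real i * \<delta>) \<omega>" j] by (simp add: V_def D_def)
  have "indep_var ?P ((\<lambda>x. \<lambda>j\<in>{..k}. z + (\<Sum>i<j. x i)) \<circ> (\<lambda>\<omega>. \<lambda>i\<in>{..<k}. D i \<omega>)) ?Q ((\<lambda>x. x) \<circ> ?d)"
  proof (rule indep_var_compose[OF indep_var_restrict[OF ind]])
    show "(\<lambda>x. \<lambda>j\<in>{..k}. z + (\<Sum>i<j. x i)) \<in> measurable (Pi\<^sub>M {..<k} (\<lambda>_. borel)) ?P"
    proof (rule measurable_restrict)
      fix j assume j: "j \<in> {..k}"
      show "(\<lambda>x. z + (\<Sum>i<j. x i)) \<in> borel_measurable (Pi\<^sub>M {..<k} (\<lambda>_. borel))"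
        using j by (intro borel_measurable_add borel_measurable_const borel_measurable_sum
           measurable_component_singleton) auto
    qed
  qed auto
  also have "(\<lambda>x. \<lambda>j\<in>{..k}. z + (\<Sum>i<j. x i)) \<circ> (\<lambda>\<omega>. \<lambda>i\<in>{..<k}. D i \<omega>) = path \<delta> k"
    by (auto simp: fun_eq_iff path_def V restrict_def intro!: sum.cong)
  finally have ind': "distr M ?P (path \<delta> k) \<Otimes>\<^sub>M distr M ?Q ?d =
      distr M (?P \<Otimes>\<^sub>M ?Q) (\<lambda>\<omega>. (path \<delta> k \<omega>, ?d \<omega>))"
    unfolding indep_var_distribution_eq by (simp add: comp_def)
  have "distr M borel (D k) = gauss \<delta>"
    using increment_law[of "real k * \<delta>" "real (Suc k) * \<delta>"] \<delta> by (simp add: D_def[abs_def] algebra_simps)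
  then have law: "gauss \<delta> = distr (distr M ?Q ?d) borel (\<lambda>y. y k)"
    by (subst distr_distr) (auto simp: comp_def)
  interpret G: prob_space "gauss \<delta>" by (rule prob_space_gauss[OF \<delta>])
  have "distr M ?P (path \<delta> k) \<Otimes>\<^sub>M gauss \<delta> =
      distr (distr M ?P (path \<delta> k)) ?P (\<lambda>x. x) \<Otimes>\<^sub>M distr (distr M ?Q ?d) borel (\<lambda>y. y k)"
    by (simp add: law[symmetric] distr_id2)
  also have "\<dots> = distr (distr M ?P (path \<delta> k) \<Otimes>\<^sub>M distr M ?Q ?d) (?P \<Otimes>\<^sub>M borel) (\<lambda>(x, y). (x, y k))"
    using G.sigma_finite_measure_axioms unfolding law by (intro pair_measure_distr) auto
  also have "\<dots> = distr M (?P \<Otimes>\<^sub>M borel) (\<lambda>\<omega>. (path \<delta> k \<omega>, D k \<omega>))"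
    unfolding ind' by (subst distr_distr) (auto simp: comp_def)
  finally show ?thesis by (simp add: V_def D_def)
qed

lemma nn_integral_next_step:
  assumes \<delta>: "0 < \<delta>" and h: "h \<in> borel_measurable (Pi\<^sub>M {..k} (\<lambda>_. borel) \<Otimes>\<^sub>M borel)"
  shows "(\<integral>\<^sup>+\<omega>. h (path \<delta> k \<omega>, V (real (Suc k) * \<delta>) \<omega> - V (real k * \<delta>) \<omega>) \<partial>M) =
     (\<integral>\<^sup>+\<omega>. (\<integral>\<^sup>+w. h (path \<delta> k \<omega>, w) \<partial>gauss \<delta>) \<partial>M)"
proof -
  interpret G: prob_space "gauss \<delta>" by (rule prob_space_gauss[OF \<delta>])
  have [measurable]: "path \<delta> k \<in> measurable M (Pi\<^sub>M {..k} (\<lambda>_. borel))" using \<delta> by (intro measurable_path) auto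
  have [measurable]: "V (real (Suc k) * \<delta>) \<in> borel_measurable M" "V (real k * \<delta>) \<in> borel_measurable M"
    using \<delta> by auto
  note [measurable] = h
  have pm: "(\<lambda>\<omega>. (path \<delta> k \<omega>, V (real (Suc k) * \<delta>) \<omega> - V (real k * \<delta>) \<omega>)) \<in>
      measurable M (Pi\<^sub>M {..k} (\<lambda>_. borel) \<Otimes>\<^sub>M borel)"
    by measurable
  have h': "h \<in> borel_measurable (Pi\<^sub>M {..k} (\<lambda>_. borel) \<Otimes>\<^sub>M gauss \<delta>)" by measurable
  have "(\<integral>\<^sup>+\<omega>. h (path \<delta> k \<omega>, V (real (Suc k) * \<delta>) \<omega> - V (real k * \<delta>) \<omega>) \<partial>M) =
    integral\<^sup>N (distr M (Pi\<^sub>M {..k} (\<lambda>_. borel)) (path \<delta> k) \<Otimes>\<^sub>M gauss \<delta>) h"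
    unfolding distr_past_increment[OF \<delta>, symmetric] by (rule nn_integral_distr[OF pm, symmetric]) (simp add: h)
  also have "\<dots> = (\<integral>\<^sup>+x. (\<integral>\<^sup>+w. h (x, w) \<partial>gauss \<delta>) \<partial>distr M (Pi\<^sub>M {..k} (\<lambda>_. borel)) (path \<delta> k))"
    using h by (intro G.nn_integral_fst[symmetric]) simp
  also have "\<dots> = (\<integral>\<^sup>+\<omega>. (\<integral>\<^sup>+w. h (path \<delta> k \<omega>, w) \<partial>gauss \<delta>) \<partial>M)"
    by (subst nn_integral_distr) (auto intro!: G.borel_measurable_nn_integral_fst h')
  finally show ?thesis .
qed

lemma integral_next_step:
  fixes h :: "(nat \<Rightarrow> complex) \<times> complex \<Rightarrow> complex"
  assumes \<delta>: "0 < \<delta>" and h: "h \<in> borel_measurable (Pi\<^sub>M {..k} (\<lambda>_. borel) \<Otimes>\<^sub>M borel)"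
    and int: "integrable M (\<lambda>\<omega>. h (path \<delta> k \<omega>, V (real (Suc k) * \<delta>) \<omega> - V (real k * \<delta>) \<omega>))"
  shows "(\<integral>\<omega>. h (path \<delta> k \<omega>, V (real (Suc k) * \<delta>) \<omega> - V (real k * \<delta>) \<omega>) \<partial>M) =
     (\<integral>\<omega>. (\<integral>w. h (path \<delta> k \<omega>, w) \<partial>gauss \<delta>) \<partial>M)"
    and "integrable M (\<lambda>\<omega>. \<integral>w. h (path \<delta> k \<omega>, w) \<partial>gauss \<delta>)"
proof -
  interpret G: prob_space "gauss \<delta>" by (rule prob_space_gauss[OF \<delta>])
  have [measurable]: "path \<delta> k \<in> measurable M (Pi\<^sub>M {..k} (\<lambda>_. borel))" using \<delta> by (intro measurable_path) auto
  have [measurable]: "V (real (Suc k) * \<delta>) \<in> borel_measurable M" "V (real k * \<delta>) \<in> borel_measurable M"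
    using \<delta> by auto
  note [measurable] = h
  have pm: "(\<lambda>\<omega>. (path \<delta> k \<omega>, V (real (Suc k) * \<delta>) \<omega> - V (real k * \<delta>) \<omega>)) \<in>
      measurable M (Pi\<^sub>M {..k} (\<lambda>_. borel) \<Otimes>\<^sub>M borel)"
    by measurable
  interpret P: prob_space "distr M (Pi\<^sub>M {..k} (\<lambda>_. borel)) (path \<delta> k)" by (rule prob_space_distr) measurable
  interpret PP: pair_sigma_finite "distr M (Pi\<^sub>M {..k} (\<lambda>_. borel)) (path \<delta> k)" "gauss \<delta>" ..
  have h': "h \<in> borel_measurable (Pi\<^sub>M {..k} (\<lambda>_. borel) \<Otimes>\<^sub>M gauss \<delta>)" by measurable
  have m: "(\<lambda>x. \<integral>w. h (x, w) \<partial>gauss \<delta>) \<in> borel_measurable (Pi\<^sub>M {..k} (\<lambda>_. borel))"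
    using h' by (intro G.borel_measurable_lebesgue_integral) simp
  have inth: "integrable (distr M (Pi\<^sub>M {..k} (\<lambda>_. borel)) (path \<delta> k) \<Otimes>\<^sub>M gauss \<delta>) h"
    unfolding distr_past_increment[OF \<delta>, symmetric] using int by (simp only: integrable_distr_eq[OF pm h])
  have "(\<integral>\<omega>. h (path \<delta> k \<omega>, V (real (Suc k) * \<delta>) \<omega> - V (real k * \<delta>) \<omega>) \<partial>M) =
    integral\<^sup>L (distr M (Pi\<^sub>M {..k} (\<lambda>_. borel)) (path \<delta> k) \<Otimes>\<^sub>M gauss \<delta>) h"
    unfolding distr_past_increment[OF \<delta>, symmetric] by (rule integral_distr[OF pm h, symmetric])
  also have "\<dots> = (\<integral>x. (\<integral>w. h (x, w) \<partial>gauss \<delta>) \<partial>distr M (Pi\<^sub>M {..k} (\<lambda>_. borel)) (path \<delta> k))"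
    by (rule PP.integral_fst'[OF inth, symmetric])
  also have "\<dots> = (\<integral>\<omega>. (\<integral>w. h (path \<delta> k \<omega>, w) \<partial>gauss \<delta>) \<partial>M)"
    by (rule integral_distr[OF _ m]) measurable
  finally show "(\<integral>\<omega>. h (path \<delta> k \<omega>, V (real (Suc k) * \<delta>) \<omega> - V (real k * \<delta>) \<omega>) \<partial>M) =
     (\<integral>\<omega>. (\<integral>w. h (path \<delta> k \<omega>, w) \<partial>gauss \<delta>) \<partial>M)" .
  show "integrable M (\<lambda>\<omega>. \<integral>w. h (path \<delta> k \<omega>, w) \<partial>gauss \<delta>)"
    using PP.integrable_fst'[OF inth] by (subst (asm) integrable_distr_eq[OF _ m]) measurable
qed

end

section \<open>Complex Brownian motion avoids the origin\<close>

text \<open>The potential of the Gaussian kernels of variance at least \<open>\<epsilon>\<close>, killed at rate one.\<close>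

definition potential :: "real \<Rightarrow> complex \<Rightarrow> ennreal" where
  "potential \<epsilon> z = (\<integral>\<^sup>+S. indicator {\<epsilon>..} S * ennreal (exp (- S) / S * exp (- (cmod z)\<^sup>2 / (2 * S))) \<partial>lborel)"

lemma borel_measurable_potential [measurable]: "potential \<epsilon> \<in> borel_measurable borel"
  unfolding potential_def by measurable

text \<open>One Gaussian step of variance \<open>d\<close> shifts the kernels of variance \<open>S\<close> to variance \<open>S + d\<close>. The discount
  \<open>exp (- S)\<close> changes by the factor \<open>exp d\<close>, and the kernels with variance below \<open>\<epsilon> + d\<close> are lost. Thus
  the discounted potential is a supermartingale along every grid.\<close>

lemma potential_next_step:
  assumes \<epsilon>: "0 < \<epsilon>" and d: "0 < d"
  shows "(\<integral>\<^sup>+w. potential \<epsilon> (z + w) \<partial>gauss d) \<le> ennreal (exp d) * potential \<epsilon> z"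
proof -
  interpret G: prob_space "gauss d" by (rule prob_space_gauss[OF d])
  interpret P: pair_sigma_finite lborel "gauss d" ..
  define \<phi> where "\<phi> S = indicator {\<epsilon>..} S * ennreal (exp (- S) / S * exp (- (cmod z)\<^sup>2 / (2 * S)))" for S
  have [measurable]: "\<phi> \<in> borel_measurable borel" unfolding \<phi>_def by measurable
  have "(\<integral>\<^sup>+w. potential \<epsilon> (z + w) \<partial>gauss d) =
    (\<integral>\<^sup>+S. (\<integral>\<^sup>+w. indicator {\<epsilon>..} S * ennreal (exp (- S) / S * exp (- (cmod (z + w))\<^sup>2 / (2 * S))) \<partial>gauss d) \<partial>lborel)"
    unfolding potential_def by (subst P.Fubini'[symmetric]) auto
  also have "\<dots> \<le> (\<integral>\<^sup>+S. ennreal (exp d) * \<phi> (d + S) \<partial>lborel)"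
  proof (rule nn_integral_mono)
    fix S :: real
    show "(\<integral>\<^sup>+w. indicator {\<epsilon>..} S * ennreal (exp (- S) / S * exp (- (cmod (z + w))\<^sup>2 / (2 * S))) \<partial>gauss d)
       \<le> ennreal (exp d) * \<phi> (d + S)"
    proof (cases "\<epsilon> \<le> S")
      case True
      with \<epsilon> have S: "0 < S" by simp
      have "(\<integral>\<^sup>+w. indicator {\<epsilon>..} S * ennreal (exp (- S) / S * exp (- (cmod (z + w))\<^sup>2 / (2 * S))) \<partial>gauss d) =
        (\<integral>\<^sup>+w. ennreal (exp (- S) / S) * ennreal (exp (- (cmod (z + w))\<^sup>2 / (2 * S))) \<partial>gauss d)"
        using True S by (simp add: ennreal_mult'[symmetric])
      also have "\<dots> = ennreal (exp (- S) / S) * ennreal (S / (S + d) * exp (- (cmod z)\<^sup>2 / (2 * (S + d))))"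
        by (subst nn_integral_cmult, measurable) (simp only: nn_integral_gauss_exp[OF d S])
      also have "\<dots> = ennreal ((exp d * exp (- (d + S))) / (d + S) * exp (- (cmod z)\<^sup>2 / (2 * (d + S))))"
        using S d unfolding exp_add[symmetric] by (simp add: ennreal_mult'[symmetric] add.commute)
      also have "\<dots> = ennreal (exp d) * \<phi> (d + S)"
        using True S d by (simp add: \<phi>_def ennreal_mult'[symmetric] mult.assoc)
      finally show ?thesis by simp
    qed simp
  qed
  also have "\<dots> = ennreal (exp d) * potential \<epsilon> z"
  proof -
    have "potential \<epsilon> z = (\<integral>\<^sup>+S. \<phi> S \<partial>lborel)" by (simp only: potential_def \<phi>_def)
    then show ?thesis using nn_integral_lborel_plus[of \<phi> d] by (simp add: nn_integral_cmult)
  qed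
  finally show ?thesis .
qed

lemma potential_le:
  assumes \<epsilon>: "0 < \<epsilon>" and z: "z \<noteq> 0"
  shows "potential \<epsilon> z \<le> ennreal (2 / (cmod z)\<^sup>2)"
proof -
  have "potential \<epsilon> z \<le> (\<integral>\<^sup>+S. ennreal (2 / (cmod z)\<^sup>2) * (ennreal (S ^ 0 * exp (- S)) * indicator {0..} S) \<partial>lborel)"
    unfolding potential_def
  proof (rule nn_integral_mono)
    fix S
    show "indicator {\<epsilon>..} S * ennreal (exp (- S) / S * exp (- (cmod z)\<^sup>2 / (2 * S))) \<le>
       ennreal (2 / (cmod z)\<^sup>2) * (ennreal (S ^ 0 * exp (- S)) * indicator {0..} S)"
    proof (cases "\<epsilon> \<le> S")
      case True
      with \<epsilon> have S: "0 < S" by simp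
      define y where "y = (cmod z)\<^sup>2 / (2 * S)"
      have y: "0 < y" using z S by (simp add: y_def)
      have "y \<le> exp y" using exp_ge_add_one_self[of y] by linarith
      then have "exp (- y) \<le> 1 / y" using y by (simp add: exp_minus field_simps)
      then have "exp (- (cmod z)\<^sup>2 / (2 * S)) \<le> 2 * S / (cmod z)\<^sup>2" by (simp add: y_def)
      then have "exp (- S) / S * exp (- (cmod z)\<^sup>2 / (2 * S)) \<le> exp (- S) / S * (2 * S / (cmod z)\<^sup>2)"
        using S by (intro mult_left_mono) auto
      also have "\<dots> = 2 / (cmod z)\<^sup>2 * exp (- S)" using S by simp
      finally show ?thesis using True S by (simp add: ennreal_mult'[symmetric] ennreal_leI)
    qed simp
  qed
  also have "\<dots> = ennreal (2 / (cmod z)\<^sup>2)"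
    by (subst nn_integral_cmult) (simp_all only: nn_intergal_power_times_exp_Ici, auto)
  finally show ?thesis .
qed

lemma potential_ge:
  assumes \<epsilon>: "0 < \<epsilon>" "\<epsilon> < 1" and z: "(cmod z)\<^sup>2 \<le> \<epsilon>"
  shows "ennreal (exp (- 2) * ln (1 / \<epsilon>)) \<le> potential \<epsilon> z"
proof -
  have "((\<lambda>S. exp (- 2) * (1 / S)) has_integral (exp (- 2) * (ln 1 - ln \<epsilon>))) {\<epsilon>..1}"
    using \<epsilon> by (intro has_integral_mult_right fundamental_theorem_of_calculus)
      (auto intro!: derivative_eq_intros simp: has_real_derivative_iff_has_vector_derivative[symmetric] divide_inverse)
  then have "ennreal (exp (- 2) * (ln 1 - ln \<epsilon>)) = (\<integral>\<^sup>+S. ennreal (exp (- 2) * (1 / S)) * indicator {\<epsilon>..1} S \<partial>lborel)"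
    using \<epsilon> by (subst nn_integral_has_integral_lebesgue') auto
  also have "\<dots> \<le> potential \<epsilon> z"
    unfolding potential_def
  proof (rule nn_integral_mono)
    fix S
    show "ennreal (exp (- 2) * (1 / S)) * indicator {\<epsilon>..1} S \<le>
       indicator {\<epsilon>..} S * ennreal (exp (- S) / S * exp (- (cmod z)\<^sup>2 / (2 * S)))"
    proof (cases "\<epsilon> \<le> S \<and> S \<le> 1")
      case True
      with \<epsilon> have S: "0 < S" by simp
      have "(cmod z)\<^sup>2 / (2 * S) \<le> 1" using True z S by (simp add: field_simps)
      then have "exp (- 2) \<le> exp (- S + - (cmod z)\<^sup>2 / (2 * S))" using True by simp
      then have "exp (- 2) * (1 / S) \<le> exp (- S + - (cmod z)\<^sup>2 / (2 * S)) * (1 / S)"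
        using S by (intro mult_right_mono) auto
      also have "\<dots> = exp (- S) / S * exp (- (cmod z)\<^sup>2 / (2 * S))" by (simp only: exp_add) simp
      finally show ?thesis using True by (simp add: ennreal_leI)
    qed (auto simp: indicator_def)
  qed
  finally show ?thesis using \<epsilon> by (simp add: ln_div)
qed

context complex_brownian_motion
begin

text \<open>The maximal inequality for the discounted nonnegative supermartingale
  \<open>potential \<epsilon> (V (j * \<delta>))\<close>: stop at the first \<open>j\<close> where it exceeds \<open>l\<close>.\<close>

lemma potential_maximal_aux:
  fixes l :: ennreal
  assumes \<epsilon>: "0 < \<epsilon>" and \<delta>: "0 < \<delta>"
  defines "hit \<equiv> \<lambda>k. {\<omega>\<in>space M. \<exists>j\<le>k. l \<le> potential \<epsilon> (V (real j * \<delta>) \<omega>)}"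
  shows "(\<integral>\<^sup>+\<omega>. indicator (space M - hit k) \<omega> * potential \<epsilon> (V (real k * \<delta>) \<omega>) \<partial>M) + l * emeasure M (hit k)
     \<le> ennreal (exp (real k * \<delta>)) * potential \<epsilon> z"
proof (induction k)
  case 0
  show ?case
  proof (cases "l \<le> potential \<epsilon> z")
    case True
    then have "hit 0 = space M" by (auto simp: hit_def)
    then show ?thesis using True by (simp add: emeasure_space_1)
  next
    case False
    then have "hit 0 = {}" by (auto simp: hit_def)
    then show ?thesis by (simp add: emeasure_space_1 nn_integral_multc)
  qed
next
  case (Suc k)
  let ?g = "\<lambda>k \<omega>. potential \<epsilon> (V (real k * \<delta>) \<omega>)"
  let ?n = "\<lambda>k \<omega>. indicator (space M - hit k) \<omega> :: ennreal"
  have [measurable]: "V (real k * \<delta>) \<in> borel_measurable M" for k using \<delta> by auto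
  have [measurable]: "hit k \<in> sets M" for k unfolding hit_def by measurable
  have sub: "hit k \<subseteq> hit (Suc k)" by (auto simp: hit_def le_Suc_eq)
  define h :: "(nat \<Rightarrow> complex) \<times> complex \<Rightarrow> ennreal"
    where "h = (\<lambda>(y, w). (if \<exists>j\<in>{..k}. l \<le> potential \<epsilon> (y j) then 0 else 1) * potential \<epsilon> (y k + w))"
  have [measurable]: "h \<in> borel_measurable (Pi\<^sub>M {..k} (\<lambda>_. borel) \<Otimes>\<^sub>M borel)"
    unfolding h_def by measurable
  have n: "(\<exists>j\<in>{..k}. l \<le> potential \<epsilon> (V (real j * \<delta>) \<omega>)) \<longleftrightarrow> \<omega> \<in> hit k" if "\<omega> \<in> space M" for \<omega>
    using that by (auto simp: hit_def)
  have "(\<integral>\<^sup>+\<omega>. ?n k \<omega> * ?g (Suc k) \<omega> \<partial>M) = (\<integral>\<^sup>+\<omega>. h (path \<delta> k \<omega>, V (real (Suc k) * \<delta>) \<omega> - V (real k * \<delta>) \<omega>) \<partial>M)"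
    by (intro nn_integral_cong) (simp add: h_def n indicator_def del: of_nat_Suc bex_simps)
  also have "\<dots> = (\<integral>\<^sup>+\<omega>. (\<integral>\<^sup>+w. h (path \<delta> k \<omega>, w) \<partial>gauss \<delta>) \<partial>M)"
    by (rule nn_integral_next_step[OF \<delta>]) measurable
  also have "\<dots> \<le> (\<integral>\<^sup>+\<omega>. ennreal (exp \<delta>) * (?n k \<omega> * ?g k \<omega>) \<partial>M)"
  proof (rule nn_integral_mono)
    fix \<omega> assume \<omega>: "\<omega> \<in> space M"
    have "(\<integral>\<^sup>+w. h (path \<delta> k \<omega>, w) \<partial>gauss \<delta>) = ?n k \<omega> * (\<integral>\<^sup>+w. potential \<epsilon> (V (real k * \<delta>) \<omega> + w) \<partial>gauss \<delta>)"
      unfolding h_def using \<omega> by (simp add: n[OF \<omega>] nn_integral_cmult indicator_def)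
    also have "\<dots> \<le> ?n k \<omega> * (ennreal (exp \<delta>) * ?g k \<omega>)"
      by (intro mult_left_mono potential_next_step \<epsilon> \<delta>) auto
    finally show "(\<integral>\<^sup>+w. h (path \<delta> k \<omega>, w) \<partial>gauss \<delta>) \<le> ennreal (exp \<delta>) * (?n k \<omega> * ?g k \<omega>)"
      by (simp add: mult_ac)
  qed
  also have "\<dots> = ennreal (exp \<delta>) * (\<integral>\<^sup>+\<omega>. ?n k \<omega> * ?g k \<omega> \<partial>M)"
    by (intro nn_integral_cmult) auto
  finally have step: "(\<integral>\<^sup>+\<omega>. ?n k \<omega> * ?g (Suc k) \<omega> \<partial>M) \<le> ennreal (exp \<delta>) * (\<integral>\<^sup>+\<omega>. ?n k \<omega> * ?g k \<omega> \<partial>M)" .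
  have "(\<integral>\<^sup>+\<omega>. ?n (Suc k) \<omega> * ?g (Suc k) \<omega> \<partial>M) + l * emeasure M (hit (Suc k) - hit k) =
    (\<integral>\<^sup>+\<omega>. ?n (Suc k) \<omega> * ?g (Suc k) \<omega> + l * indicator (hit (Suc k) - hit k) \<omega> \<partial>M)"
    by (subst nn_integral_add) (auto simp: nn_integral_cmult_indicator simp del: of_nat_Suc)
  also have "\<dots> \<le> (\<integral>\<^sup>+\<omega>. ?n k \<omega> * ?g (Suc k) \<omega> \<partial>M)"
  proof (rule nn_integral_mono)
    fix \<omega> assume "\<omega> \<in> space M"
    then show "?n (Suc k) \<omega> * ?g (Suc k) \<omega> + l * indicator (hit (Suc k) - hit k) \<omega> \<le> ?n k \<omega> * ?g (Suc k) \<omega>"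
      using sub by (auto simp: indicator_def) (auto simp: hit_def le_Suc_eq)
  qed
  also note step
  finally have 1: "(\<integral>\<^sup>+\<omega>. ?n (Suc k) \<omega> * ?g (Suc k) \<omega> \<partial>M) + l * emeasure M (hit (Suc k) - hit k)
     \<le> ennreal (exp \<delta>) * (\<integral>\<^sup>+\<omega>. ?n k \<omega> * ?g k \<omega> \<partial>M)" .
  have "emeasure M (hit (Suc k) - hit k) + emeasure M (hit k) = emeasure M ((hit (Suc k) - hit k) \<union> hit k)"
    by (rule plus_emeasure) auto
  also have "(hit (Suc k) - hit k) \<union> hit k = hit (Suc k)" using sub by blast
  finally have split: "l * emeasure M (hit (Suc k)) = l * emeasure M (hit (Suc k) - hit k) + l * emeasure M (hit k)"
    by (metis distrib_left)
  have "(\<integral>\<^sup>+\<omega>. ?n (Suc k) \<omega> * ?g (Suc k) \<omega> \<partial>M) + l * emeasure M (hit (Suc k)) \<le>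
     ennreal (exp \<delta>) * (\<integral>\<^sup>+\<omega>. ?n k \<omega> * ?g k \<omega> \<partial>M) + l * emeasure M (hit k)"
    using add_right_mono[OF 1, of "l * emeasure M (hit k)"] unfolding split by (simp only: add.assoc)
  also have "l * emeasure M (hit k) \<le> ennreal (exp \<delta>) * (l * emeasure M (hit k))"
  proof -
    have "1 \<le> ennreal (exp \<delta>)" using \<delta> by (simp add: ennreal_ge_1)
    from mult_right_mono[OF this, of "l * emeasure M (hit k)"] show ?thesis unfolding mult_1 by simp
  qed
  finally have "(\<integral>\<^sup>+\<omega>. ?n (Suc k) \<omega> * ?g (Suc k) \<omega> \<partial>M) + l * emeasure M (hit (Suc k)) \<le>
     ennreal (exp \<delta>) * ((\<integral>\<^sup>+\<omega>. ?n k \<omega> * ?g k \<omega> \<partial>M) + l * emeasure M (hit k))"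
    unfolding distrib_left by (simp only: add_left_mono)
  also have "\<dots> \<le> ennreal (exp \<delta>) * (ennreal (exp (real k * \<delta>)) * potential \<epsilon> z)"
    by (intro mult_left_mono Suc.IH) auto
  also have "\<dots> = ennreal (exp (real (Suc k) * \<delta>)) * potential \<epsilon> z"
  proof -
    have "exp (real (Suc k) * \<delta>) = exp \<delta> * exp (real k * \<delta>)"
      unfolding exp_add[symmetric] by (simp add: algebra_simps)
    then show ?thesis by (simp add: ennreal_mult' mult.assoc del: of_nat_Suc)
  qed
  finally show ?case .
qed

text \<open>The bound depends on the number of steps only through the elapsed time \<open>k * \<delta>\<close>, so that it survives
  the refinement of the grid.\<close>

lemma prob_grid_near_0:
  assumes \<epsilon>: "0 < \<epsilon>" "\<epsilon> < 1" and \<delta>: "0 < \<delta>" and z: "z \<noteq> 0"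
  shows "prob {\<omega>\<in>space M. \<exists>j\<le>k. (cmod (V (real j * \<delta>) \<omega>))\<^sup>2 \<le> \<epsilon>} \<le>
     exp (real k * \<delta> + 2) * (2 / (cmod z)\<^sup>2) / ln (1 / \<epsilon>)"
proof -
  let ?A = "{\<omega>\<in>space M. \<exists>j\<le>k. (cmod (V (real j * \<delta>) \<omega>))\<^sup>2 \<le> \<epsilon>}"
  define l where "l = exp (- 2) * ln (1 / \<epsilon>)"
  let ?H = "{\<omega>\<in>space M. \<exists>j\<le>k. ennreal l \<le> potential \<epsilon> (V (real j * \<delta>) \<omega>)}"
  have l: "0 < l" using \<epsilon> by (simp add: l_def)
  have [measurable]: "V (real k * \<delta>) \<in> borel_measurable M" for k using \<delta> by auto
  have "?A \<subseteq> ?H" unfolding l_def using potential_ge[OF \<epsilon>] by blast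
  then have "ennreal l * emeasure M ?A \<le> ennreal l * emeasure M ?H"
    by (intro mult_left_mono emeasure_mono) auto
  also have "\<dots> \<le> ennreal (exp (real k * \<delta>)) * potential \<epsilon> z"
    using potential_maximal_aux[OF \<epsilon>(1) \<delta>, where l="ennreal l" and k=k] by (rule order_trans[rotated]) simp
  also have "\<dots> \<le> ennreal (exp (real k * \<delta>)) * ennreal (2 / (cmod z)\<^sup>2)"
    by (intro mult_left_mono potential_le \<epsilon> z) auto
  finally have "l * prob ?A \<le> exp (real k * \<delta>) * (2 / (cmod z)\<^sup>2)"
    using l by (simp add: emeasure_eq_measure ennreal_mult'[symmetric] ennreal_le_iff)
  then have "prob ?A \<le> exp (real k * \<delta>) * (2 / (cmod z)\<^sup>2) / l" using l
    by (subst pos_le_divide_eq) (simp_all only: mult.commute)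
  also have "\<dots> = exp (real k * \<delta> + 2) * (2 / (cmod z)\<^sup>2) / ln (1 / \<epsilon>)"
    by (simp add: l_def exp_add exp_minus field_simps)
  finally show ?thesis .
qed

end

lemma nat_floor_bounds:
  fixes x :: real
  assumes "0 \<le> x"
  shows "real (nat \<lfloor>x\<rfloor>) \<le> x" "x < real (nat \<lfloor>x\<rfloor>) + 1"
  using assms by simp_all

context complex_brownian_motion
begin

text \<open>A continuous path with a zero in \<open>{0..u}\<close> comes within every distance of the origin on some dyadic
  grid of \<open>{0..u}\<close>. The events of the dyadic grids increase, so the maximal inequality bounds their union
  by a constant over \<open>ln (1 / \<epsilon>)\<close>, and \<open>\<epsilon>\<close> is arbitrary.\<close>

lemma AE_V_nonzero:
  assumes z: "z \<noteq> 0"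
  shows "AE \<omega> in M. \<forall>t\<ge>0. V t \<omega> \<noteq> 0"
proof -
  have "AE \<omega> in M. \<forall>t\<in>{0..u}. V t \<omega> \<noteq> 0" if u: "0 < u" for u :: real
  proof -
    define A where "A \<epsilon> m = {\<omega>\<in>space M. \<exists>j\<le>2 ^ m. (cmod (V (real j * (u / 2 ^ m)) \<omega>))\<^sup>2 \<le> \<epsilon>}" for \<epsilon> and m :: nat
    define C where "C = exp (u + 2) * (2 / (cmod z)\<^sup>2)"
    \<comment> \<open>chosen so that \<open>ln (1 / \<epsilon> i)\<close> is the integer \<open>Suc i\<close>\<close>
    define \<epsilon> where "\<epsilon> i = exp (- real (Suc i))" for i
    have \<epsilon>: "0 < \<epsilon> i" "\<epsilon> i < 1" "ln (1 / \<epsilon> i) = real (Suc i)" for i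
      by (simp_all add: \<epsilon>_def exp_minus ln_div)
    have [measurable]: "V (real j * (u / 2 ^ m)) \<in> borel_measurable M" for j m using u by auto
    have A [measurable]: "A e m \<in> sets M" for e m unfolding A_def by measurable
    have inc: "incseq (A e)" for e
    proof (rule incseq_SucI)
      show "A e m \<subseteq> A e (Suc m)" for m
      proof
        fix \<omega> assume "\<omega> \<in> A e m"
        then obtain j where j: "\<omega> \<in> space M" "j \<le> 2 ^ m" "(cmod (V (real j * (u / 2 ^ m)) \<omega>))\<^sup>2 \<le> e"
          by (auto simp: A_def)
        have "real (2 * j) * (u / 2 ^ Suc m) = real j * (u / 2 ^ m)" by simp
        then show "\<omega> \<in> A e (Suc m)" unfolding A_def using j by (auto intro!: exI[of _ "2 * j"])
      qed
    qed
    have Am: "prob (A (\<epsilon> i) m) \<le> C / real (Suc i)" for i m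
      using prob_grid_near_0[OF \<epsilon>(1)[of i] \<epsilon>(2)[of i], where \<delta>="u / 2 ^ m" and k="2 ^ m"] u z
      by (simp add: A_def C_def \<epsilon>(3))
    have B: "prob (\<Union>m. A (\<epsilon> i) m) \<le> C / real (Suc i)" for i
    proof (rule LIMSEQ_le_const2)
      show "(\<lambda>m. prob (A (\<epsilon> i) m)) \<longlonglongrightarrow> prob (\<Union>m. A (\<epsilon> i) m)"
        by (rule finite_Lim_measure_incseq[OF _ inc]) auto
      show "\<exists>N. \<forall>m\<ge>N. prob (A (\<epsilon> i) m) \<le> C / real (Suc i)" using Am by (intro exI[of _ 0] allI impI)
    qed
    have "prob (\<Inter>i. \<Union>m. A (\<epsilon> i) m) \<le> C / real (Suc i)" for i
      by (rule order_trans[OF finite_measure_mono B[of i]]) auto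
    moreover have "(\<lambda>i. C / real (Suc i)) \<longlonglongrightarrow> 0" by (rule lim_const_over_n[THEN LIMSEQ_Suc])
    ultimately have "prob (\<Inter>i. \<Union>m. A (\<epsilon> i) m) \<le> 0" by (intro LIMSEQ_le_const) auto
    then have null: "(\<Inter>i. \<Union>m. A (\<epsilon> i) m) \<in> null_sets M"
      by (intro null_setsI) (auto simp: emeasure_eq_measure measure_le_0_iff)
    show ?thesis
    proof (rule AE_I'[OF null], rule subsetI, rule INT_I)
      fix \<omega> i assume "\<omega> \<in> {\<omega> \<in> space M. \<not> (\<forall>t\<in>{0..u}. V t \<omega> \<noteq> 0)}"
      then obtain t where t: "\<omega> \<in> space M" "0 \<le> t" "t \<le> u" "V t \<omega> = 0" by auto
      have "0 < sqrt (\<epsilon> i)" using \<epsilon> by simp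
      then obtain d where d: "0 < d" "\<And>s. 0 \<le> s \<Longrightarrow> dist s t < d \<Longrightarrow> dist (V s \<omega>) (V t \<omega>) < sqrt (\<epsilon> i)"
        using continuous_V[OF t(1)] t(2) unfolding continuous_on_iff by (metis atLeast_iff)
      obtain m where m: "u / d < 2 ^ m" using real_arch_pow[of 2 "u / d"] by auto
      define j where "j = nat \<lfloor>t * 2 ^ m / u\<rfloor>"
      have "0 \<le> t * 2 ^ m / u" using t u by simp
      note j1 = nat_floor_bounds[OF this, folded j_def]
      have "t * 2 ^ m / u \<le> 2 ^ m" using t u by (simp add: field_simps)
      with j1(1) have "real j \<le> 2 ^ m" by (rule order_trans)
      then have j2: "j \<le> 2 ^ m" by simp
      define s where "s = real j * (u / 2 ^ m)"
      have "s \<le> t" using j1(1) u by (simp add: s_def field_simps)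
      moreover have "t < s + u / 2 ^ m" using j1(2) u by (simp add: s_def field_simps)
      moreover have "u / 2 ^ m < d" using m d by (simp add: field_simps)
      ultimately have "dist s t < d" by (simp add: dist_real_def)
      moreover have "0 \<le> s" using u by (simp add: s_def)
      ultimately have "cmod (V s \<omega>) < sqrt (\<epsilon> i)" using d(2)[of s] t by simp
      then have "(cmod (V s \<omega>))\<^sup>2 \<le> (sqrt (\<epsilon> i))\<^sup>2" by (intro power_mono) auto
      then have "(cmod (V s \<omega>))\<^sup>2 \<le> \<epsilon> i" using \<epsilon>(1)[of i] by simp
      then show "\<omega> \<in> (\<Union>m. A (\<epsilon> i) m)" unfolding A_def using t j2 by (auto simp: s_def)
    qed
  qed
  from this[of "real (Suc n)" for n] have "AE \<omega> in M. \<forall>n. \<forall>t\<in>{0..real (Suc n)}. V t \<omega> \<noteq> 0"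
    by (subst AE_all_countable) auto
  then show ?thesis
  proof eventually_elim
    case (elim \<omega>)
    show ?case
    proof (intro allI impI)
      fix t :: real assume "0 \<le> t"
      moreover obtain n where "t \<le> real n" using real_arch_simple by blast
      ultimately show "V t \<omega> \<noteq> 0" using elim[rule_format, of t n] by auto
    qed
  qed
qed

end

section \<open>The winding number along fine grids\<close>

lemma Ln_ratio_continuous_argument:
  assumes \<theta>: "continuous_argument w \<theta>" and nz: "w s \<noteq> 0" "w t \<noteq> 0" and st: "0 \<le> s" "0 \<le> t"
    and small: "\<bar>\<theta> t - \<theta> s\<bar> < pi"
  shows "Ln (w t / w s) = of_real (ln (cmod (w t)) - ln (cmod (w s))) + \<i> * of_real (\<theta> t - \<theta> s)"
proof (rule Ln_unique)
  have e: "w r = exp (of_real (ln (cmod (w r))) + \<i> * of_real (\<theta> r))" if "0 \<le> r" "w r \<noteq> 0" for r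
    using \<theta> that by (simp add: continuous_argument_def exp_add exp_of_real)
  have "exp (of_real (ln (cmod (w t)) - ln (cmod (w s))) + \<i> * of_real (\<theta> t - \<theta> s)) =
    exp ((of_real (ln (cmod (w t))) + \<i> * of_real (\<theta> t)) - (of_real (ln (cmod (w s))) + \<i> * of_real (\<theta> s)))"
    by (simp add: algebra_simps)
  also have "\<dots> = w t / w s"
    by (simp only: exp_diff e[OF st(1) nz(1), symmetric] e[OF st(2) nz(2), symmetric])
  finally show "exp (of_real (ln (cmod (w t)) - ln (cmod (w s))) + \<i> * of_real (\<theta> t - \<theta> s)) = w t / w s" .
qed (use small in auto)

text \<open>On a fine grid the argument of a path moves by less than \<open>\<pi>\<close> in each step, so that the
  principal logarithms of the quotients add up to the logarithm lifted along the path.\<close>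

lemma eventually_sum_Ln_ratio:
  assumes \<theta>: "continuous_argument w \<theta>" and nz: "\<forall>t\<ge>0. w t \<noteq> 0" and u: "0 < u"
  shows "eventually (\<lambda>n. (\<Sum>j<n. Ln (w (real (Suc j) * (u / real n)) / w (real j * (u / real n)))) =
    of_real (ln (cmod (w u)) - ln (cmod (w 0))) + \<i> * of_real (\<theta> u)) sequentially"
proof -
  let ?q = "\<lambda>n j. Ln (w (real (Suc j) * (u / real n)) / w (real j * (u / real n)))"
    and ?g = "\<lambda>n j. of_real (ln (cmod (w (real j * (u / real n))))) + \<i> * of_real (\<theta> (real j * (u / real n)))"
  have "continuous_on {0..u} \<theta>"
    using \<theta> by (auto simp: continuous_argument_def elim: continuous_on_subset)
  then have "uniformly_continuous_on {0..u} \<theta>" by (intro compact_uniformly_continuous) auto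
  then obtain d where d: "0 < d" "\<And>s t. s \<in> {0..u} \<Longrightarrow> t \<in> {0..u} \<Longrightarrow> dist s t < d \<Longrightarrow> dist (\<theta> s) (\<theta> t) < pi"
    unfolding uniformly_continuous_on_def using pi_gt_zero by metis
  obtain N :: nat where N: "u / d < real N" using reals_Archimedean2 by blast
  show ?thesis
    unfolding eventually_sequentially
  proof (intro exI[of _ "Suc N"] allI impI)
    fix n assume n: "Suc N \<le> n"
    then have n0: "0 < real n" by simp
    have "u / d < real n" using N n by linarith
    then have step: "u / real n < d" using n0 d by (simp add: field_simps)
    have grid: "real j * (u / real n) \<in> {0..u}" if "j \<le> n" for j
      using that u n0 by (simp add: field_simps)
    have "?q n j =
       ?g n (Suc j) -
       ?g n j" if j: "j < n" for j
    proof -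
      have g: "real (Suc j) * (u / real n) \<in> {0..u}" "real j * (u / real n) \<in> {0..u}"
        using grid[of j] grid[of "Suc j"] j by simp_all
      have "real (Suc j) * (u / real n) - real j * (u / real n) = u / real n"
        by (simp add: algebra_simps add_divide_distrib)
      then have "dist (real (Suc j) * (u / real n)) (real j * (u / real n)) < d"
        using step u n0 by (simp only: dist_real_def) (simp add: abs_of_pos)
      from d(2)[OF g this] have "\<bar>\<theta> (real (Suc j) * (u / real n)) - \<theta> (real j * (u / real n))\<bar> < pi"
        by (simp add: dist_real_def)
      from Ln_ratio_continuous_argument[OF \<theta> _ _ _ _ this] nz g show ?thesis
        by (simp add: algebra_simps)
    qed
    then have "(\<Sum>j<n. ?q n j) =
      (\<Sum>j<n. ?g n (Suc j) -
       ?g n j)"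
      by (intro sum.cong) auto
    also have "\<dots> = of_real (ln (cmod (w u)) - ln (cmod (w 0))) + \<i> * of_real (\<theta> u)"
      using sum_lessThan_telescope[of "?g n" n]
        n0 \<theta> by (simp add: continuous_argument_def)
    finally show "(\<Sum>j<n. ?q n j) =
      of_real (ln (cmod (w u)) - ln (cmod (w 0))) + \<i> * of_real (\<theta> u)" .
  qed
qed

text \<open>The same statement after exponentiation. The principal powers of the quotients multiply to the
  lifted power, which carries the full winding number and not only its residue modulo \<open>2 * \<pi>\<close>.\<close>

lemma eventually_prod_powr_ratio:
  assumes \<theta>: "continuous_argument w \<theta>" and nz: "\<forall>t\<ge>0. w t \<noteq> 0" and u: "0 < u" and w0: "w 0 = 1"
  shows "eventually (\<lambda>n. (\<Prod>j<n. (w (real (Suc j) * (u / real n)) / w (real j * (u / real n))) powr of_real \<nu>) =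
    of_real (cmod (w u) powr \<nu>) * exp (\<i> * of_real (\<nu> * \<theta> u))) sequentially"
  using eventually_sum_Ln_ratio[OF \<theta> nz u]
proof eventually_elim
  case (elim n)
  have "w (real j * (u / real n)) \<noteq> 0" for j using nz u by simp
  then have "(\<Prod>j<n. (w (real (Suc j) * (u / real n)) / w (real j * (u / real n))) powr of_real \<nu>) =
     exp (of_real \<nu> * (\<Sum>j<n. Ln (w (real (Suc j) * (u / real n)) / w (real j * (u / real n)))))"
    by (simp add: powr_def exp_sum sum_distrib_left del: of_nat_Suc)
  also have "\<dots> = of_real (exp (\<nu> * ln (cmod (w u)))) * exp (\<i> * of_real (\<nu> * \<theta> u))"
    unfolding elim using w0 by (simp add: exp_of_real[symmetric] exp_add[symmetric] algebra_simps)
  also have "exp (\<nu> * ln (cmod (w u))) = cmod (w u) powr \<nu>" using nz u by (simp add: powr_def)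
  finally show ?case .
qed

lemma continuous_argument_winding_positive:
  assumes c: "continuous_on {0..} w" and w0: "w 0 = of_real (cmod (w 0))" and nz: "\<forall>t\<ge>0. w t \<noteq> 0"
  shows "continuous_argument w (winding w)"
proof -
  define r where "r = cmod (w 0)"
  have r: "0 < r" "w 0 = of_real r" using w0 nz by (simp_all add: r_def)
  have "continuous_argument (\<lambda>t. w t / of_real r) (winding (\<lambda>t. w t / of_real r))"
    using c r nz by (intro continuous_argument_winding continuous_intros) auto
  then have *: "continuous_argument w (winding (\<lambda>t. w t / of_real r))"
    using r by (simp add: continuous_argument_def norm_divide)
  define \<theta> where "\<theta> = winding (\<lambda>t. w t / of_real r)"
  have eq: "winding w t = \<theta> t" if "0 \<le> t" for t
    unfolding \<theta>_def by (rule winding_eq[OF * nz that])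
  have \<theta>: "continuous_argument w \<theta>" using * by (simp add: \<theta>_def)
  have c\<theta>: "continuous_on {0..} \<theta>" and \<theta>0: "\<theta> 0 = 0"
    and p: "\<And>t. 0 \<le> t \<Longrightarrow> w t = of_real (cmod (w t)) * exp (\<i> * of_real (\<theta> t))"
    using \<theta> unfolding continuous_argument_def by blast+
  show ?thesis
    unfolding continuous_argument_def
  proof (intro conjI allI impI)
    show "continuous_on {0..} (winding w)"
      using c\<theta> by (rule continuous_on_eq) (simp add: eq)
    show "winding w 0 = 0" using \<theta>0 eq[of 0] by simp
    show "w t = of_real (cmod (w t)) * exp (\<i> * of_real (winding w t))" if "0 \<le> t" for t
      unfolding eq[OF that] using that by (rule p)
  qed
qed

text \<open>The continuous argument starts at \<open>0\<close>, so a path that does not start on the positive half-line has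
  none; the definite description then takes a fixed default value, which suffices for measurability.\<close>

lemma winding_not_positive:
  assumes "w 0 \<noteq> of_real (cmod (w 0))" and nz: "\<forall>t\<ge>0. w t \<noteq> 0"
  shows "winding w u = (THE a. False)"
proof -
  have "\<not> continuous_argument w \<theta>" for \<theta>
    using assms(1) by (auto simp: continuous_argument_def)
  then show ?thesis using nz by (simp add: winding_def)
qed

context complex_brownian_motion
begin

text \<open>By compactness a path without zeros is bounded away from the origin on bounded time intervals, and
  by continuity this can be tested at rational times.\<close>

lemma measurable_never_0: "{\<omega>\<in>space M. \<forall>t\<ge>0. W t \<omega> \<noteq> 0} \<in> sets M"
proof -
  have [measurable]: "W (real a / real (Suc b)) \<in> borel_measurable M" for a b by (intro measurable_W) auto
  have "{\<omega>\<in>space M. \<forall>t\<ge>0. W t \<omega> \<noteq> 0} = {\<omega>\<in>space M. \<forall>k::nat. \<exists>m::nat. \<forall>a b. real a / real (Suc b) \<le> real k \<longrightarrow>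
      1 / real (Suc m) \<le> cmod (W (real a / real (Suc b)) \<omega>)}" (is "?L = ?R")
  proof (intro set_eqI iffI)
    fix \<omega> assume "\<omega> \<in> ?L"
    then have \<omega>: "\<omega> \<in> space M" and nz: "\<forall>t\<ge>0. W t \<omega> \<noteq> 0" by auto
    have "\<exists>m::nat. \<forall>a b. real a / real (Suc b) \<le> real k \<longrightarrow> 1 / real (Suc m) \<le> cmod (W (real a / real (Suc b)) \<omega>)" for k :: nat
    proof -
      have "continuous_on {0..real k} (\<lambda>t. cmod (W t \<omega>))"
        by (intro continuous_on_norm continuous_on_subset[OF continuous_path[OF \<omega>]]) auto
      then obtain s where s: "s \<in> {0..real k}" "\<forall>t\<in>{0..real k}. cmod (W s \<omega>) \<le> cmod (W t \<omega>)"
        using continuous_attains_inf[of "{0..real k}" "\<lambda>t. cmod (W t \<omega>)"] by auto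
      have "0 < cmod (W s \<omega>)" using nz s(1) by auto
      then obtain m where m: "1 / real (Suc m) < cmod (W s \<omega>)" by (rule nat_approx_posE)
      show ?thesis
      proof (intro exI[of _ m] allI impI)
        fix a b assume "real a / real (Suc b) \<le> real k"
        then have "real a / real (Suc b) \<in> {0..real k}" by simp
        then show "1 / real (Suc m) \<le> cmod (W (real a / real (Suc b)) \<omega>)" using m s(2)
          by (meson less_imp_le order_trans)
      qed
    qed
    with \<omega> show "\<omega> \<in> ?R" by blast
  next
    fix \<omega> assume "\<omega> \<in> ?R"
    then have \<omega>: "\<omega> \<in> space M" and R: "\<And>k::nat. \<exists>m::nat. \<forall>a b. real a / real (Suc b) \<le> real k \<longrightarrow> 1 / real (Suc m) \<le> cmod (W (real a / real (Suc b)) \<omega>)"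
      by auto
    have "W t \<omega> \<noteq> 0" if t: "0 \<le> t" for t
    proof
      assume 0: "W t \<omega> = 0"
      obtain k :: nat where k: "t \<le> real k" using real_arch_simple by blast
      obtain m where m: "\<And>a b. real a / real (Suc b) \<le> real k \<Longrightarrow> 1 / real (Suc m) \<le> cmod (W (real a / real (Suc b)) \<omega>)"
        using R[of k] by blast
      have "t \<in> {0..}" "0 < 1 / real (Suc m)" using t by auto
      with continuous_path[OF \<omega>] obtain d where "0 < d"
        and d': "\<forall>s\<in>{0..}. dist s t < d \<longrightarrow> dist (W s \<omega>) (W t \<omega>) < 1 / real (Suc m)"
        unfolding continuous_on_iff by blast
      have d: "dist (W s \<omega>) (W t \<omega>) < 1 / real (Suc m)" if "0 \<le> s" "dist s t < d" for s
        using d' that by blast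
      obtain b where b: "1 / real (Suc b) < d" using \<open>0 < d\<close> by (rule nat_approx_posE)
      define a where "a = nat \<lfloor>t * real (Suc b)\<rfloor>"
      have "0 \<le> t * real (Suc b)" using t by simp
      note a = nat_floor_bounds[OF this, folded a_def]
      have p: "0 < real (Suc b)" by simp
      have 1: "real a / real (Suc b) \<le> t" using a(1) p by (simp only: pos_divide_le_eq)
      have "t < (real a + 1) / real (Suc b)" using a(2) p by (simp only: pos_less_divide_eq)
      then have "t - real a / real (Suc b) < 1 / real (Suc b)" by (simp add: add_divide_distrib)
      with 1 b have "dist (real a / real (Suc b)) t < d" by (simp add: dist_real_def)
      then have "cmod (W (real a / real (Suc b)) \<omega>) < 1 / real (Suc m)" using d[of "real a / real (Suc b)"] 0 by simp
      moreover have "1 / real (Suc m) \<le> cmod (W (real a / real (Suc b)) \<omega>)" using 1 k by (intro m) linarith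
      ultimately show False by simp
    qed
    with \<omega> show "\<omega> \<in> ?L" by auto
  qed
  also have "\<dots> \<in> sets M" by measurable
  finally show ?thesis .
qed

text \<open>On paths without zeros that start on the positive half-line, the winding number is the limit of
  sums of principal arguments along grids; on the other paths it takes the default values of its
  definition.\<close>

lemma measurable_winding:
  assumes u: "0 < u"
  shows "(\<lambda>\<omega>. winding (\<lambda>t. W t \<omega>) u) \<in> borel_measurable M"
proof -
  note [measurable] = measurable_never_0
  have [measurable]: "W 0 \<in> borel_measurable M" "W (real j * (u / real n)) \<in> borel_measurable M" for j n
    using u by (auto intro!: measurable_W)
  define f where "f n \<omega> = Im (\<Sum>j<n. Ln (W (real (Suc j) * (u / real n)) \<omega> / W (real j * (u / real n)) \<omega>))" for n \<omega>
  have [measurable]: "f n \<in> borel_measurable M" for n unfolding f_def by measurable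
  have "(\<lambda>\<omega>. if \<omega> \<in> {\<omega>\<in>space M. \<forall>t\<ge>0. W t \<omega> \<noteq> 0} then
      if W 0 \<omega> = of_real (cmod (W 0 \<omega>)) then lim (\<lambda>n. f n \<omega>) else (THE a. False) else 0) \<in> borel_measurable M"
    by measurable
  then show ?thesis
  proof (rule measurable_cong[THEN iffD1, rotated])
    fix \<omega> assume \<omega>: "\<omega> \<in> space M"
    show "(if \<omega> \<in> {\<omega>\<in>space M. \<forall>t\<ge>0. W t \<omega> \<noteq> 0} then
      if W 0 \<omega> = of_real (cmod (W 0 \<omega>)) then lim (\<lambda>n. f n \<omega>) else (THE a. False) else 0) = winding (\<lambda>t. W t \<omega>) u"
    proof (cases "\<forall>t\<ge>0. W t \<omega> \<noteq> 0")
      case nz: True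
      show ?thesis
      proof (cases "W 0 \<omega> = of_real (cmod (W 0 \<omega>))")
        case True
        have *: "continuous_argument (\<lambda>t. W t \<omega>) (winding (\<lambda>t. W t \<omega>))"
          using True nz continuous_path[OF \<omega>] by (intro continuous_argument_winding_positive) auto
        have "eventually (\<lambda>n. f n \<omega> = winding (\<lambda>t. W t \<omega>) u) sequentially"
          using eventually_sum_Ln_ratio[OF * nz u] by eventually_elim (simp add: f_def del: of_nat_Suc)
        then have "(\<lambda>n. f n \<omega>) \<longlonglongrightarrow> winding (\<lambda>t. W t \<omega>) u" by (rule tendsto_eventually)
        then show ?thesis using True nz \<omega> by (simp add: limI)
      next
        case False
        then show ?thesis using winding_not_positive[of "\<lambda>t. W t \<omega>" u] nz \<omega> by simp
      qed
    next
      case False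
      then show ?thesis by (auto simp: winding_def)
    qed
  qed
qed

end

section \<open>The lifted power and Weber's integral\<close>

lemma powr_of_real_mult:
  assumes "0 < k"
  shows "(of_real k * x) powr of_real \<nu> = of_real (k powr \<nu>) * (x powr of_real \<nu> :: complex)"
proof (cases "x = 0")
  case False
  have "Ln (of_real k * x) = of_real (ln k) + Ln x"
    using Ln_times_of_real[OF assms False] assms by (simp add: Ln_of_real)
  moreover have "(of_real (k powr \<nu>) :: complex) = exp (of_real (\<nu> * ln k))"
    unfolding exp_of_real using assms by (simp add: powr_def)
  ultimately show ?thesis using False assms by (simp add: powr_def distrib_left exp_add)
qed simp

text \<open>The Gaussian weight is absorbed by completing the square. Since this moves the centre along its own
  ray, the principal power relative to \<open>z\<close> is, up to a positive factor, the one relative to the new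
  centre, and \<open>gauss_power_mean\<close> applies. The condition \<open>d \<le> S\<close> keeps the contraction factor above one
  half.\<close>

lemma gauss_weber_step:
  fixes \<nu> p :: real
  assumes \<nu>: "0 < \<nu>" and p: "\<nu> \<le> p"
  obtains D where "0 \<le> D"
    "\<And>z d S. z \<noteq> 0 \<Longrightarrow> 0 < d \<Longrightarrow> d \<le> S \<Longrightarrow>
       cmod ((\<integral>w. exp (- (cmod (z + w))\<^sup>2 / (2 * S)) *\<^sub>R ((z + w) / z) powr of_real \<nu> \<partial>gauss d) -
         of_real ((S / (S + d)) powr (1 + \<nu>) * exp (- (cmod z)\<^sup>2 / (2 * (S + d))))) \<le> D * d powr (p / 2) * cmod z powr (- p)"
proof -
  obtain C where C: "0 \<le> C"
    "\<And>z v. z \<noteq> 0 \<Longrightarrow> 0 < v \<Longrightarrow>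
       cmod ((\<integral>w. ((z + w) / z) powr of_real \<nu> \<partial>gauss v) - 1) \<le> C * v powr (p / 2) * cmod z powr (- p)"
    by (rule gauss_power_mean[OF \<nu> p]) (erule that, blast)
  have "cmod ((\<integral>w. exp (- (cmod (z + w))\<^sup>2 / (2 * S)) *\<^sub>R ((z + w) / z) powr of_real \<nu> \<partial>gauss d) -
         of_real ((S / (S + d)) powr (1 + \<nu>) * exp (- (cmod z)\<^sup>2 / (2 * (S + d))))) \<le> C * 2 powr (p / 2) * d powr (p / 2) * cmod z powr (- p)"
    if z: "z \<noteq> 0" and d: "0 < d" "d \<le> S" for z d S
  proof -
    have S: "0 < S" using d by simp
    define k where "k = S / (S + d)"
    have k: "0 < k" "k \<le> 1" "1 / 2 \<le> k" using S d by (simp_all add: k_def field_simps)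
    have kd: "S * d / (S + d) = k * d" by (simp add: k_def)
    define E where "E = exp (- (cmod z)\<^sup>2 / (2 * (S + d)))"
    have E: "0 \<le> E" "E \<le> 1" using S d by (simp_all add: E_def)
    define J where "J = (\<integral>w. ((of_real k * z + w) / (of_real k * z)) powr of_real \<nu> \<partial>gauss (k * d))"
    have f: "((of_real k * z + w) / z) powr of_real \<nu> =
        of_real (k powr \<nu>) * ((of_real k * z + w) / (of_real k * z)) powr of_real \<nu>" for w
    proof -
      have "(of_real k * z + w) / z = of_real k * ((of_real k * z + w) / (of_real k * z))" using k z by simp
      then show ?thesis by (simp only: powr_of_real_mult[OF k(1)])
    qed
    have "(\<integral>w. exp (- (cmod (z + w))\<^sup>2 / (2 * S)) *\<^sub>R ((z + w) / z) powr of_real \<nu> \<partial>gauss d) =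
      (k * E) *\<^sub>R (\<integral>w. ((of_real k * z + w) / z) powr of_real \<nu> \<partial>gauss (k * d))"
      using integral_gauss_tilt[of "\<lambda>y. (y / z) powr of_real \<nu>" d S z] d S
      unfolding k_def[symmetric] kd E_def by simp
    also have "\<dots> = of_real (k powr (1 + \<nu>) * E) * J"
      unfolding f J_def using k by (simp add: powr_add scaleR_conv_of_real)
    finally have eq: "(\<integral>w. exp (- (cmod (z + w))\<^sup>2 / (2 * S)) *\<^sub>R ((z + w) / z) powr of_real \<nu> \<partial>gauss d) -
        of_real (k powr (1 + \<nu>) * E) = of_real (k powr (1 + \<nu>) * E) * (J - 1)"
      by (simp add: algebra_simps)
    have "cmod (J - 1) \<le> C * (k * d) powr (p / 2) * cmod (of_real k * z) powr (- p)"
      unfolding J_def using z k d by (intro C) auto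
    also have "\<dots> = C * (k powr (p / 2) * k powr (- p)) * d powr (p / 2) * cmod z powr (- p)"
      using k by (simp add: norm_mult powr_mult)
    also have "k powr (p / 2) * k powr (- p) = k powr (- (p / 2))" using k by (simp add: powr_add[symmetric])
    finally have J: "cmod (J - 1) \<le> C * k powr (- (p / 2)) * d powr (p / 2) * cmod z powr (- p)" .
    have "k powr (- (p / 2)) \<le> (1 / 2) powr (- (p / 2))" using k \<nu> p by (intro powr_mono2') auto
    also have "\<dots> = 2 powr (p / 2)" by (simp add: powr_divide powr_minus field_simps)
    finally have k2: "k powr (- (p / 2)) \<le> 2 powr (p / 2)" .
    have "k powr (1 + \<nu>) * E \<le> 1 * 1" using k E \<nu> by (intro mult_mono powr_le1) auto
    then have "cmod (of_real (k powr (1 + \<nu>) * E) * (J - 1)) \<le> 1 * cmod (J - 1)"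
      unfolding norm_mult[of _ "J - 1"] norm_of_real using E by (intro mult_right_mono) auto
    also have "1 * cmod (J - 1) \<le> C * 2 powr (p / 2) * d powr (p / 2) * cmod z powr (- p)"
      using J mult_mono[OF order_refl k2, of "C * (d powr (p / 2) * cmod z powr (- p))"] C(1)
      by (simp add: mult_ac)
    finally show ?thesis unfolding k_def[symmetric] E_def[symmetric] eq .
  qed
  with that[of "C * 2 powr (p / 2)"] C show ?thesis by simp
qed

lemma powr_exp_bounded:
  fixes \<nu> s :: real
  assumes "0 < \<nu>" "0 < s"
  obtains C where "0 \<le> C" "\<And>x. 0 \<le> x \<Longrightarrow> x powr \<nu> * exp (- x\<^sup>2 / (2 * s)) \<le> C"
proof -
  obtain C where C: "0 \<le> C" "\<And>y. 0 \<le> y \<Longrightarrow> y powr (\<nu> / 2) \<le> C * exp y"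
    using powr_le_exp[of "\<nu> / 2"] assms by auto
  have "x powr \<nu> * exp (- x\<^sup>2 / (2 * s)) \<le> C * (2 * s) powr (\<nu> / 2)" if x: "0 \<le> x" for x
  proof -
    have "x powr \<nu> = (x\<^sup>2) powr (\<nu> / 2)"
      using x by (cases "x = 0") (auto simp: powr_powr simp flip: powr_numeral)
    also have "x\<^sup>2 = (2 * s) * (x\<^sup>2 / (2 * s))" using assms by simp
    also have "\<dots> powr (\<nu> / 2) = (2 * s) powr (\<nu> / 2) * (x\<^sup>2 / (2 * s)) powr (\<nu> / 2)"
      using assms by (subst powr_mult) auto
    also have "\<dots> \<le> (2 * s) powr (\<nu> / 2) * (C * exp (x\<^sup>2 / (2 * s)))"
      using assms by (intro mult_left_mono C) auto
    finally have "x powr \<nu> * exp (- (x\<^sup>2 / (2 * s))) \<le> (2 * s) powr (\<nu> / 2) * (C * exp (x\<^sup>2 / (2 * s))) * exp (- (x\<^sup>2 / (2 * s)))"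
      by (intro mult_right_mono) auto
    also have "\<dots> = C * (2 * s) powr (\<nu> / 2)" by (simp add: exp_minus)
    finally show ?thesis by simp
  qed
  with that[of "C * (2 * s) powr (\<nu> / 2)"] C show ?thesis by simp
qed

locale brownian_from_1 = complex_brownian_motion M "1::complex" W for M :: "'a measure" and W
begin

text \<open>The power \<open>V powr \<nu>\<close> lifted along the grid of mesh \<open>\<delta>\<close>.\<close>

definition powprod :: "real \<Rightarrow> real \<Rightarrow> nat \<Rightarrow> 'a \<Rightarrow> complex" where
  "powprod \<nu> \<delta> k \<omega> = (\<Prod>j<k. (V (real (Suc j) * \<delta>) \<omega> / V (real j * \<delta>) \<omega>) powr of_real \<nu>)"

lemma measurable_powprod: "0 \<le> \<delta> \<Longrightarrow> powprod \<nu> \<delta> k \<in> borel_measurable M"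
  unfolding powprod_def
  by (intro borel_measurable_prod borel_measurable_complex_powr borel_measurable_divide measurable_V) auto

text \<open>The absolute values telescope; if the path visits the origin at an earlier grid point, the product
  vanishes because of the division by zero, and the inequality may be strict.\<close>

lemma norm_powprod_le:
  assumes "0 < \<nu>"
  shows "cmod (powprod \<nu> \<delta> k \<omega>) \<le> cmod (V (real k * \<delta>) \<omega>) powr \<nu>"
proof (induction k)
  case 0
  then show ?case by (simp add: powprod_def)
next
  case (Suc k)
  let ?V = "\<lambda>k. cmod (V (real k * \<delta>) \<omega>)"
  have "cmod (powprod \<nu> \<delta> (Suc k) \<omega>) = cmod (powprod \<nu> \<delta> k \<omega>) * (?V (Suc k) / ?V k) powr \<nu>"
    by (simp add: powprod_def norm_mult norm_powr_real_powr' norm_divide del: of_nat_Suc)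
  also have "\<dots> \<le> ?V k powr \<nu> * (?V (Suc k) / ?V k) powr \<nu>"
    by (intro mult_right_mono Suc.IH) auto
  also have "\<dots> \<le> ?V (Suc k) powr \<nu>"
    by (cases "V (real k * \<delta>) \<omega> = 0") (simp_all add: powr_divide del: of_nat_Suc)
  finally show ?case .
qed

lemma V_negative_moment:
  fixes r :: real
  assumes r: "0 \<le> r" "r < 2"
  obtains C where "0 \<le> C" "\<And>t. 0 \<le> t \<Longrightarrow> (\<integral>\<^sup>+\<omega>. ennreal (cmod (V t \<omega>) powr (- r)) \<partial>M) \<le> ennreal C"
proof -
  obtain C where C: "0 \<le> C"
    "\<And>v. 0 < v \<Longrightarrow> (\<integral>\<^sup>+w. ennreal (cmod (1 + w) powr (- r)) \<partial>gauss v) \<le> ennreal C"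
    by (rule gauss_negative_moment[OF r]) blast
  have "(\<integral>\<^sup>+\<omega>. ennreal (cmod (V t \<omega>) powr (- r)) \<partial>M) \<le> ennreal (1 + C)" if t: "0 \<le> t" for t
  proof (cases "t = 0")
    case True
    then show ?thesis using C(1) by (simp add: emeasure_space_1)
  next
    case False
    then have "(\<integral>\<^sup>+\<omega>. ennreal (cmod (V t \<omega>) powr (- r)) \<partial>M) \<le> ennreal C"
      using t C(2)[of t] nn_integral_V[of t "\<lambda>y. ennreal (cmod y powr (- r))"] by simp
    also have "\<dots> \<le> ennreal (1 + C)" by (intro ennreal_leI) simp
    finally show ?thesis .
  qed
  with that[of "1 + C"] C show ?thesis by simp
qed

text \<open>The discrete version of Weber's integral after \<open>k\<close> steps of length \<open>\<delta>\<close>.\<close>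

definition weber :: "real \<Rightarrow> real \<Rightarrow> nat \<Rightarrow> real \<Rightarrow> complex" where
  "weber \<nu> \<delta> k S = (\<integral>\<omega>. exp (- (cmod (V (real k * \<delta>) \<omega>))\<^sup>2 / (2 * S)) *\<^sub>R powprod \<nu> \<delta> k \<omega> \<partial>M)"

lemma integrable_weber:
  assumes "0 < \<nu>" "0 < S" "0 \<le> \<delta>"
  shows "integrable M (\<lambda>\<omega>. exp (- (cmod (V (real k * \<delta>) \<omega>))\<^sup>2 / (2 * S)) *\<^sub>R powprod \<nu> \<delta> k \<omega>)"
proof -
  have [measurable]: "powprod \<nu> \<delta> k \<in> borel_measurable M" "V (real k * \<delta>) \<in> borel_measurable M"
    using assms by (auto intro: measurable_powprod)
  obtain C where C: "0 \<le> C" "\<And>x. 0 \<le> x \<Longrightarrow> x powr \<nu> * exp (- x\<^sup>2 / (2 * S)) \<le> C"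
    by (rule powr_exp_bounded[OF assms(1,2)]) blast
  show ?thesis
  proof (rule integrable_const_bound[of _ C], rule AE_I2)
    fix \<omega>
    let ?x = "cmod (V (real k * \<delta>) \<omega>)"
    have "exp (- ?x\<^sup>2 / (2 * S)) * cmod (powprod \<nu> \<delta> k \<omega>) \<le> exp (- ?x\<^sup>2 / (2 * S)) * ?x powr \<nu>"
      by (intro mult_left_mono norm_powprod_le assms) auto
    also have "\<dots> \<le> C" using C(2)[of ?x] by (simp add: mult.commute)
    finally show "norm (exp (- ?x\<^sup>2 / (2 * S)) *\<^sub>R powprod \<nu> \<delta> k \<omega>) \<le> C" by simp
  qed measurable
qed

text \<open>Condition on the past and apply \<open>gauss_weber_step\<close> to the last step. The error carries the factor
  \<open>cmod (V (k * \<delta>)) powr (\<nu> - p)\<close>, whose expectation is bounded because \<open>p - \<nu> < 2\<close>.\<close>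

lemma weber_step:
  fixes \<nu> p :: real
  assumes \<nu>: "0 < \<nu>" and p: "\<nu> \<le> p" "p < \<nu> + 2"
  obtains D where "0 \<le> D"
    "\<And>\<delta> S k. 0 < \<delta> \<Longrightarrow> \<delta> \<le> S \<Longrightarrow>
      cmod (weber \<nu> \<delta> (Suc k) S - of_real ((S / (S + \<delta>)) powr (1 + \<nu>)) * weber \<nu> \<delta> k (S + \<delta>)) \<le> D * \<delta> powr (p / 2)"
proof -
  obtain D where D: "0 \<le> D"
    "\<And>z d S. z \<noteq> 0 \<Longrightarrow> 0 < d \<Longrightarrow> d \<le> S \<Longrightarrow>
       cmod ((\<integral>w. exp (- (cmod (z + w))\<^sup>2 / (2 * S)) *\<^sub>R ((z + w) / z) powr of_real \<nu> \<partial>gauss d) -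
         of_real ((S / (S + d)) powr (1 + \<nu>) * exp (- (cmod z)\<^sup>2 / (2 * (S + d))))) \<le> D * d powr (p / 2) * cmod z powr (- p)"
    by (rule gauss_weber_step[OF \<nu> p(1)]) blast
  have r: "0 \<le> p - \<nu>" "p - \<nu> < 2" using p by auto
  obtain C where C: "0 \<le> C" "\<And>t. 0 \<le> t \<Longrightarrow> (\<integral>\<^sup>+\<omega>. ennreal (cmod (V t \<omega>) powr (- (p - \<nu>))) \<partial>M) \<le> ennreal C"
    by (rule V_negative_moment[OF r]) blast
  have "cmod (weber \<nu> \<delta> (Suc k) S - of_real ((S / (S + \<delta>)) powr (1 + \<nu>)) * weber \<nu> \<delta> k (S + \<delta>)) \<le> D * C * \<delta> powr (p / 2)"
    if \<delta>: "0 < \<delta>" "\<delta> \<le> S" for \<delta> S k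
  proof -
    let ?V = "V (real k * \<delta>)" and ?V' = "V (real (Suc k) * \<delta>)" and ?P = "powprod \<nu> \<delta> k"
    let ?w = "\<lambda>\<omega>. exp (- (cmod (?V \<omega>))\<^sup>2 / (2 * (S + \<delta>))) *\<^sub>R ?P \<omega>"
    have S: "0 < S" using \<delta> by simp
    have [measurable]: "?P \<in> borel_measurable M" "?V \<in> borel_measurable M"
      using \<delta> by (auto intro: measurable_powprod)
    define \<kappa> where "\<kappa> = (S / (S + \<delta>)) powr (1 + \<nu>)"
    define I where "I z = (\<integral>w. exp (- (cmod (z + w))\<^sup>2 / (2 * S)) *\<^sub>R ((z + w) / z) powr of_real \<nu> \<partial>gauss \<delta>)" for z
    define h :: "(nat \<Rightarrow> complex) \<times> complex \<Rightarrow> complex"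
      where "h = (\<lambda>(y, w). (\<Prod>j<k. (y (Suc j) / y j) powr of_real \<nu>) *
         (exp (- (cmod (y k + w))\<^sup>2 / (2 * S)) *\<^sub>R ((y k + w) / y k) powr of_real \<nu>))"
    have h: "h \<in> borel_measurable (Pi\<^sub>M {..k} (\<lambda>_. borel) \<Otimes>\<^sub>M borel)"
    proof -
      have [measurable]: "(\<lambda>x. fst x j) \<in> borel_measurable (Pi\<^sub>M {..k} (\<lambda>_. borel) \<Otimes>\<^sub>M borel)" if "j \<le> k" for j
        using that by (intro measurable_compose[OF measurable_fst] measurable_component_singleton) auto
      have [measurable]: "(\<lambda>x. \<Prod>j<k. (fst x (Suc j) / fst x j) powr of_real \<nu>) \<in> borel_measurable (Pi\<^sub>M {..k} (\<lambda>_. borel :: complex measure) \<Otimes>\<^sub>M borel)"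
        by (intro borel_measurable_prod borel_measurable_complex_powr borel_measurable_divide) auto
      have [measurable]: "(\<lambda>x. fst x k) \<in> borel_measurable (Pi\<^sub>M {..k} (\<lambda>_. borel) \<Otimes>\<^sub>M borel)" by measurable
      show ?thesis unfolding h_def case_prod_beta by measurable
    qed
    have hp: "h (path \<delta> k \<omega>, w) = ?P \<omega> *
        (exp (- (cmod (?V \<omega> + w))\<^sup>2 / (2 * S)) *\<^sub>R ((?V \<omega> + w) / ?V \<omega>) powr of_real \<nu>)" for \<omega> w
      by (simp add: h_def powprod_def del: of_nat_Suc cong: prod.cong_simp)
    have hV: "h (path \<delta> k \<omega>, ?V' \<omega> - ?V \<omega>) =
        exp (- (cmod (?V' \<omega>))\<^sup>2 / (2 * S)) *\<^sub>R powprod \<nu> \<delta> (Suc k) \<omega>" for \<omega>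
      unfolding hp by (simp add: powprod_def del: of_nat_Suc)
    have int: "integrable M (\<lambda>\<omega>. h (path \<delta> k \<omega>, ?V' \<omega> - ?V \<omega>))"
      unfolding hV using \<nu> S \<delta> by (intro integrable_weber) auto
    have hI: "(\<integral>w. h (path \<delta> k \<omega>, w) \<partial>gauss \<delta>) = ?P \<omega> * I (?V \<omega>)" for \<omega>
      unfolding hp I_def by (rule integral_mult_right_zero)
    have 1: "weber \<nu> \<delta> (Suc k) S = (\<integral>\<omega>. ?P \<omega> * I (?V \<omega>) \<partial>M)"
      and int1: "integrable M (\<lambda>\<omega>. ?P \<omega> * I (?V \<omega>))"
      using integral_next_step[OF \<delta>(1) h int] unfolding hV hI weber_def by simp_all
    have 2: "of_real \<kappa> * weber \<nu> \<delta> k (S + \<delta>) = (\<integral>\<omega>. of_real \<kappa> * (?w \<omega>) \<partial>M)"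
      unfolding weber_def by (rule integral_mult_right_zero[symmetric])
    have int2: "integrable M (\<lambda>\<omega>. of_real \<kappa> * (?w \<omega>))"
      using \<nu> S \<delta> by (intro integrable_mult_right integrable_weber) auto
    have "ennreal (cmod (weber \<nu> \<delta> (Suc k) S - of_real \<kappa> * weber \<nu> \<delta> k (S + \<delta>))) =
      ennreal (cmod (\<integral>\<omega>. ?P \<omega> * I (?V \<omega>) -
         of_real \<kappa> * (?w \<omega>) \<partial>M))"
      unfolding 1 2 using int1 int2 by (subst Bochner_Integration.integral_diff) auto
    also have "\<dots> \<le> (\<integral>\<^sup>+\<omega>. ennreal (cmod (?P \<omega> * I (?V \<omega>) -
         of_real \<kappa> * (?w \<omega>))) \<partial>M)"
      by (intro integral_norm_bound_ennreal Bochner_Integration.integrable_diff int1 int2)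
    also have "\<dots> \<le> (\<integral>\<^sup>+\<omega>. ennreal (D * \<delta> powr (p / 2)) * ennreal (cmod (?V \<omega>) powr (- (p - \<nu>))) \<partial>M)"
    proof (rule nn_integral_mono_AE)
      have "AE \<omega> in M. \<forall>t\<ge>0. V t \<omega> \<noteq> 0" by (rule AE_V_nonzero) simp
      then show "AE \<omega> in M. ennreal (cmod (?P \<omega> * I (?V \<omega>) -
         of_real \<kappa> * (?w \<omega>))) \<le>
        ennreal (D * \<delta> powr (p / 2)) * ennreal (cmod (?V \<omega>) powr (- (p - \<nu>)))"
      proof eventually_elim
        case (elim \<omega>)
        define x where "x = ?V \<omega>"
        have x: "x \<noteq> 0" using elim \<delta> by (simp add: x_def)
        have "cmod (?P \<omega> * I x - of_real \<kappa> * (exp (- (cmod x)\<^sup>2 / (2 * (S + \<delta>))) *\<^sub>R ?P \<omega>)) =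
          cmod (?P \<omega>) * cmod (I x - of_real (\<kappa> * exp (- (cmod x)\<^sup>2 / (2 * (S + \<delta>)))))"
          unfolding norm_mult[symmetric] by (simp add: scaleR_conv_of_real algebra_simps)
        also have "\<dots> \<le> cmod x powr \<nu> * (D * \<delta> powr (p / 2) * cmod x powr (- p))"
          unfolding I_def \<kappa>_def using norm_powprod_le[OF \<nu>, of \<delta> k \<omega>] D(1)
          by (intro mult_mono D(2) x \<delta>) (auto simp: x_def)
        also have "\<dots> = D * \<delta> powr (p / 2) * cmod x powr (- (p - \<nu>))"
          using x by (simp add: powr_diff powr_minus field_simps)
        finally show ?case using D(1) by (simp add: x_def ennreal_mult'[symmetric] ennreal_leI)
      qed
    qed
    also have "\<dots> = ennreal (D * \<delta> powr (p / 2)) * (\<integral>\<^sup>+\<omega>. ennreal (cmod (?V \<omega>) powr (- (p - \<nu>))) \<partial>M)"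
      by (rule nn_integral_cmult) measurable
    also have "\<dots> \<le> ennreal (D * \<delta> powr (p / 2)) * ennreal C"
      using \<delta> by (intro mult_left_mono C) auto
    also have "\<dots> = ennreal (D * C * \<delta> powr (p / 2))"
      using D C by (simp add: ennreal_mult'[symmetric] mult_ac)
    finally show ?thesis unfolding \<kappa>_def[symmetric] using D C by (simp add: ennreal_le_iff)
  qed
  with that[of "D * C"] D C show ?thesis by simp
qed

text \<open>The factors \<open>S / (S + \<delta>)\<close> of the single steps telescope, since every step raises the variance of the
  weight by \<open>\<delta>\<close>.\<close>

lemma weber_approx:
  fixes \<nu> p :: real
  assumes \<nu>: "0 < \<nu>" and p: "\<nu> \<le> p" "p < \<nu> + 2"
  obtains D where "0 \<le> D"
    "\<And>\<delta> S k. 0 < \<delta> \<Longrightarrow> \<delta> \<le> S \<Longrightarrow>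
      cmod (weber \<nu> \<delta> k S - of_real ((S / (S + real k * \<delta>)) powr (1 + \<nu>) * exp (- 1 / (2 * (S + real k * \<delta>)))))
        \<le> real k * (D * \<delta> powr (p / 2))"
proof -
  obtain D where D: "0 \<le> D"
    "\<And>\<delta> S k. 0 < \<delta> \<Longrightarrow> \<delta> \<le> S \<Longrightarrow>
      cmod (weber \<nu> \<delta> (Suc k) S - of_real ((S / (S + \<delta>)) powr (1 + \<nu>)) * weber \<nu> \<delta> k (S + \<delta>)) \<le> D * \<delta> powr (p / 2)"
    by (rule weber_step[OF \<nu> p]) blast
  have "cmod (weber \<nu> \<delta> k S - of_real ((S / (S + real k * \<delta>)) powr (1 + \<nu>) * exp (- 1 / (2 * (S + real k * \<delta>)))))
        \<le> real k * (D * \<delta> powr (p / 2))" if \<delta>: "0 < \<delta>" and "\<delta> \<le> S" for \<delta> S k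
    using \<open>\<delta> \<le> S\<close>
  proof (induction k arbitrary: S)
    case 0
    then show ?case using \<delta> by (simp add: weber_def powprod_def prob_space scaleR_conv_of_real)
  next
    case (Suc k)
    have S: "0 < S" using Suc.prems \<delta> by simp
    define \<kappa> where "\<kappa> = (S / (S + \<delta>)) powr (1 + \<nu>)"
    have \<kappa>: "0 \<le> \<kappa>" "\<kappa> \<le> 1" using S \<delta> \<nu> by (auto simp: \<kappa>_def intro!: powr_le1)
    define T where "T = S + real (Suc k) * \<delta>"
    have T: "S + \<delta> + real k * \<delta> = T" "0 < T"
      using S \<delta> by (simp_all add: T_def add_pos_nonneg distrib_right)
    define R where "R = ((S + \<delta>) / T) powr (1 + \<nu>) * exp (- 1 / (2 * T))"
    have IH: "cmod (weber \<nu> \<delta> k (S + \<delta>) - of_real R) \<le> real k * (D * \<delta> powr (p / 2))"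
      using Suc.IH[of "S + \<delta>"] S unfolding T(1) R_def by simp
    have "\<kappa> * ((S + \<delta>) / T) powr (1 + \<nu>) = (S / T) powr (1 + \<nu>)"
      unfolding \<kappa>_def using S \<delta> T by (subst powr_mult[symmetric]) auto
    then have \<kappa>R: "(S / T) powr (1 + \<nu>) * exp (- 1 / (2 * T)) = \<kappa> * R" by (simp add: R_def)
    have "weber \<nu> \<delta> (Suc k) S - of_real (\<kappa> * R) =
      (weber \<nu> \<delta> (Suc k) S - of_real \<kappa> * weber \<nu> \<delta> k (S + \<delta>)) + of_real \<kappa> * (weber \<nu> \<delta> k (S + \<delta>) - of_real R)"
      by (simp add: algebra_simps)
    also have "cmod \<dots> \<le> D * \<delta> powr (p / 2) + \<kappa> * cmod (weber \<nu> \<delta> k (S + \<delta>) - of_real R)"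
      using \<kappa> D(2)[OF \<delta> Suc.prems, of k, folded \<kappa>_def]
      by (intro norm_triangle_le add_mono) (auto simp: norm_mult)
    also have "\<dots> \<le> D * \<delta> powr (p / 2) + 1 * (real k * (D * \<delta> powr (p / 2)))"
      using \<kappa> IH by (intro add_left_mono mult_mono) auto
    finally show ?case unfolding T_def[symmetric] \<kappa>R by (simp add: algebra_simps)
  qed
  with that D show ?thesis by blast
qed

definition \<Theta> :: "real \<Rightarrow> 'a \<Rightarrow> real" where
  "\<Theta> u \<omega> = winding (\<lambda>t. W t \<omega>) u"

lemma measurable_\<Theta>: "0 < u \<Longrightarrow> \<Theta> u \<in> borel_measurable M"
  unfolding \<Theta>_def[abs_def] by (rule measurable_winding)

text \<open>Almost every path of \<open>W\<close> agrees with that of \<open>V\<close> and has no zeros, so that along it the product is eventually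
  equal to the lifted power.\<close>

lemma AE_powprod_tendsto:
  assumes u: "0 < u"
  shows "AE \<omega> in M. (\<lambda>n. powprod \<nu> (u / real n) n \<omega>) \<longlonglongrightarrow>
     of_real (cmod (V u \<omega>) powr \<nu>) * exp (\<i> * of_real (\<nu> * \<Theta> u \<omega>))"
proof -
  have "AE \<omega> in M. \<forall>t\<ge>0. V t \<omega> \<noteq> 0" by (rule AE_V_nonzero) simp
  then show ?thesis using AE_V_eq_W AE_space
  proof eventually_elim
    case (elim \<omega>)
    have *: "continuous_argument (\<lambda>t. V t \<omega>) (winding (\<lambda>t. V t \<omega>))"
      using elim(1) continuous_V[OF elim(3)] by (intro continuous_argument_winding) simp_all
    have "(\<lambda>t. V t \<omega>) = (\<lambda>t. W t \<omega>)" using elim(2) by auto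
    then have \<Theta>: "winding (\<lambda>t. V t \<omega>) u = \<Theta> u \<omega>" by (simp add: \<Theta>_def)
    from eventually_prod_powr_ratio[OF * elim(1) u V_0, of \<nu>]
    show ?case unfolding \<Theta> powprod_def[symmetric] by (rule tendsto_eventually)
  qed
qed

text \<open>Weber's first exponential integral, as an identity for the winding number.\<close>

theorem weber_identity:
  assumes \<nu>: "0 < \<nu>" and s: "0 < s" and u: "0 < u"
  shows "(\<integral>\<omega>. exp (- (cmod (V u \<omega>))\<^sup>2 / (2 * s)) *\<^sub>R (of_real (cmod (V u \<omega>) powr \<nu>) * exp (\<i> * of_real (\<nu> * \<Theta> u \<omega>))) \<partial>M) =
    of_real ((s / (s + u)) powr (1 + \<nu>) * exp (- 1 / (2 * (s + u))))"
proof -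
  let ?X = "\<lambda>\<omega>. exp (- (cmod (V u \<omega>))\<^sup>2 / (2 * s)) *\<^sub>R (of_real (cmod (V u \<omega>) powr \<nu>) * exp (\<i> * of_real (\<nu> * \<Theta> u \<omega>)))" and ?Y = "\<lambda>n \<omega>. exp (- (cmod (V u \<omega>))\<^sup>2 / (2 * s)) *\<^sub>R powprod \<nu> (u / real n) n \<omega>"
  \<comment> \<open>an exponent for which \<open>n\<close> steps of length \<open>u / n\<close> have a total error of order \<open>n powr (1 - p / 2)\<close>,
     with \<open>2 < p\<close>, and for which the negative moment of order \<open>p - \<nu> < 2\<close> is finite\<close>
  define p where "p = max (2 + \<nu> / 2) \<nu>"
  have p: "\<nu> \<le> p" "p < \<nu> + 2" "2 < p" using \<nu> by (auto simp: p_def)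
  obtain D where D: "0 \<le> D"
    "\<And>\<delta> S k. 0 < \<delta> \<Longrightarrow> \<delta> \<le> S \<Longrightarrow>
      cmod (weber \<nu> \<delta> k S - of_real ((S / (S + real k * \<delta>)) powr (1 + \<nu>) * exp (- 1 / (2 * (S + real k * \<delta>)))))
        \<le> real k * (D * \<delta> powr (p / 2))"
    by (rule weber_approx[OF \<nu> p(1,2)]) blast
  let ?L = "of_real ((s / (s + u)) powr (1 + \<nu>) * exp (- 1 / (2 * (s + u)))) :: complex"
  have "(\<lambda>n. weber \<nu> (u / real n) n s) \<longlonglongrightarrow> ?L"
  proof (rule Lim_transform)
    show "(\<lambda>_. ?L) \<longlonglongrightarrow> ?L" by simp
    show "(\<lambda>n. weber \<nu> (u / real n) n s - ?L) \<longlonglongrightarrow> 0"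
    proof (rule Lim_null_comparison)
      obtain N :: nat where N: "u / s < real N" using reals_Archimedean2 by blast
      show "eventually (\<lambda>n. norm (weber \<nu> (u / real n) n s - ?L) \<le> real n * (D * (u / real n) powr (p / 2))) sequentially"
        unfolding eventually_sequentially
      proof (intro exI[of _ "Suc N"] allI impI)
        fix n assume n: "Suc N \<le> n"
        then have "u / s < real n" "0 < real n" using N by auto
        then have "u / real n \<le> s" using s by (simp add: field_simps)
        from D(2)[OF _ this, of n] \<open>0 < real n\<close> u
        show "norm (weber \<nu> (u / real n) n s - ?L) \<le> real n * (D * (u / real n) powr (p / 2))"
          by simp
      qed
      show "(\<lambda>n. real n * (D * (u / real n) powr (p / 2))) \<longlonglongrightarrow> 0"
      proof (rule Lim_transform_eventually)
        have "(\<lambda>n. real n powr (1 - p / 2)) \<longlonglongrightarrow> 0"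
          using p(3) by (intro tendsto_neg_powr filterlim_real_sequentially) auto
        then show "(\<lambda>n. D * u powr (p / 2) * real n powr (1 - p / 2)) \<longlonglongrightarrow> 0"
          by (rule tendsto_mult_right_zero)
        show "eventually (\<lambda>n. D * u powr (p / 2) * real n powr (1 - p / 2) =
            real n * (D * (u / real n) powr (p / 2))) sequentially"
          using eventually_gt_at_top[of 0]
          by eventually_elim (use u in \<open>simp add: powr_diff powr_divide\<close>)
      qed
    qed
  qed
  moreover have "(\<lambda>n. weber \<nu> (u / real n) n s) \<longlonglongrightarrow>
    (\<integral>\<omega>. ?X \<omega> \<partial>M)"
  proof -
    have [measurable]: "V u \<in> borel_measurable M" "\<Theta> u \<in> borel_measurable M"
      using u by (auto intro: measurable_\<Theta>)
    have mp [measurable]: "powprod \<nu> (u / real n) n \<in> borel_measurable M" for n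
      using u by (intro measurable_powprod) auto
    obtain C where C: "0 \<le> C" "\<And>x. 0 \<le> x \<Longrightarrow> x powr \<nu> * exp (- x\<^sup>2 / (2 * s)) \<le> C"
      by (rule powr_exp_bounded[OF \<nu> s]) blast
    have "(\<lambda>n. \<integral>\<omega>. ?Y n \<omega> \<partial>M) \<longlonglongrightarrow>
     (\<integral>\<omega>. ?X \<omega> \<partial>M)"
    proof (rule integral_dominated_convergence[where w="\<lambda>_. C + 1"])
      show "AE \<omega> in M. (\<lambda>n. ?Y n \<omega>) \<longlonglongrightarrow>
         ?X \<omega>"
        using AE_powprod_tendsto[OF u, of \<nu>] by eventually_elim (rule tendsto_scaleR[OF tendsto_const])
      show "AE \<omega> in M. norm (?Y n \<omega>) \<le> C + 1" for n
      proof (rule AE_I2)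
        fix \<omega>
        let ?x = "cmod (V u \<omega>)"
        show "norm (exp (- ?x\<^sup>2 / (2 * s)) *\<^sub>R powprod \<nu> (u / real n) n \<omega>) \<le> C + 1"
        proof (cases "n = 0")
          case True
          then show ?thesis using C(1) s by (simp add: powprod_def add_increasing)
        next
          case False
          have "exp (- ?x\<^sup>2 / (2 * s)) * cmod (powprod \<nu> (u / real n) n \<omega>) \<le> exp (- ?x\<^sup>2 / (2 * s)) * ?x powr \<nu>"
            using norm_powprod_le[OF \<nu>, of "u / real n" n \<omega>] False by (intro mult_left_mono) auto
          also have "\<dots> \<le> C" using C(2)[of ?x] by (simp add: mult.commute)
          finally show ?thesis by simp
        qed
      qed
    qed (auto simp: integrable_const)
    then show ?thesis
    proof (rule Lim_transform_eventually)
      show "eventually (\<lambda>n. (\<integral>\<omega>. ?Y n \<omega> \<partial>M) = weber \<nu> (u / real n) n s) sequentially"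
        using eventually_gt_at_top[of 0] by eventually_elim (simp add: weber_def)
    qed
  qed
  ultimately show ?thesis using LIMSEQ_unique by blast
qed

end

section \<open>The characteristic function of the winding number\<close>

lemma nn_integral_Gamma_scaled:
  fixes a c :: real
  assumes a: "0 < a" and c: "0 < c"
  shows "(\<integral>\<^sup>+x. indicator {0<..} x * ennreal (x powr (a - 1) * exp (- (c * x))) \<partial>lborel) = ennreal (Gamma a * c powr (- a))"
proof -
  let ?f = "\<lambda>x. indicator {0<..} x * ennreal (x powr (a - 1) * exp (- (c * x)))"
  have "(\<integral>\<^sup>+x. ?f x \<partial>lborel) = ennreal (1 / c) * (\<integral>\<^sup>+t. ?f (1 / c * t) \<partial>lborel)"
    using nn_integral_real_affine[of ?f "1 / c" 0] c by simp
  also have "(\<integral>\<^sup>+t. ?f (1 / c * t) \<partial>lborel) =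
     (\<integral>\<^sup>+t. ennreal (c powr (1 - a)) * ennreal (indicator {0..} t * t powr (a - 1) / exp t) \<partial>lborel)"
  proof (rule nn_integral_cong)
    fix t :: real
    show "?f (1 / c * t) = ennreal (c powr (1 - a)) * ennreal (indicator {0..} t * t powr (a - 1) / exp t)"
    proof (cases "0 < t")
      case True
      have "(1 / c * t) powr (a - 1) = c powr (1 - a) * t powr (a - 1)"
        using c True by (simp add: powr_divide powr_diff field_simps)
      then show ?thesis using True c by (simp add: ennreal_mult'[symmetric] exp_minus field_simps)
    next
      case False
      then show ?thesis using c by (cases "t = 0") (auto simp: indicator_def zero_less_divide_iff)
    qed
  qed
  also have "\<dots> = ennreal (c powr (1 - a)) * ennreal (Gamma a)"
    by (simp add: nn_integral_cmult Gamma_conv_nn_integral_real[OF a, symmetric])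
  finally have "(\<integral>\<^sup>+x. ?f x \<partial>lborel) = ennreal (1 / c * (c powr (1 - a) * Gamma a))"
    using c a by (simp add: ennreal_mult'[symmetric])
  also have "1 / c * (c powr (1 - a) * Gamma a) = Gamma a * c powr (- a)"
    using c by (simp add: powr_diff powr_minus field_simps)
  finally show ?thesis .
qed

text \<open>The second Beta integral, obtained by writing \<open>(1 + u * x) powr (- b)\<close> as a Laplace transform.\<close>

lemma nn_integral_Beta_prime:
  fixes a b u :: real
  assumes a: "0 < a" and b: "a < b" and u: "0 < u"
  shows "(\<integral>\<^sup>+x. indicator {0<..} x * ennreal (x powr (a - 1) * (1 + u * x) powr (- b)) \<partial>lborel) =
     ennreal (Gamma a * Gamma (b - a) / Gamma b * u powr (- a))"
proof -
  let ?I = "\<lambda>x::real. indicator {0<..} x :: ennreal"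
  let ?g = "\<lambda>x t. ?I x * ?I t * ennreal (x powr (a - 1) * (t powr (b - 1) * exp (- ((1 + u * x) * t))))"
  let ?h = "\<lambda>x. ?I x * ennreal (x powr (a - 1) * (1 + u * x) powr (- b))"
  have b0: "0 < b" using a b by simp
  have G: "0 < Gamma a" "0 < Gamma b" "0 < Gamma (b - a)" using a b by simp_all
  have 1: "?h x = ennreal (1 / Gamma b) *
      (\<integral>\<^sup>+t. ?g x t \<partial>lborel)" for x
  proof (cases "0 < x")
    case True
    have "(\<integral>\<^sup>+t. ?g x t \<partial>lborel) =
      (\<integral>\<^sup>+t. ennreal (x powr (a - 1)) * (?I t * ennreal (t powr (b - 1) * exp (- ((1 + u * x) * t)))) \<partial>lborel)"
      using True by (intro nn_integral_cong) (simp add: ennreal_mult' mult_ac)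
    also have "\<dots> = ennreal (x powr (a - 1)) * ennreal (Gamma b * (1 + u * x) powr (- b))"
      using True u nn_integral_Gamma_scaled[OF b0, of "1 + u * x"]
      by (subst nn_integral_cmult) (simp_all add: add_pos_pos)
    finally show ?thesis
      using True G by (simp add: ennreal_mult'[symmetric])
  qed simp
  have "(\<integral>\<^sup>+x. ?h x \<partial>lborel) = ennreal (1 / Gamma b) *
      (\<integral>\<^sup>+x. (\<integral>\<^sup>+t. ?g x t \<partial>lborel) \<partial>lborel)"
    unfolding 1 by (rule nn_integral_cmult) measurable
  also have "(\<integral>\<^sup>+x. (\<integral>\<^sup>+t. ?g x t \<partial>lborel) \<partial>lborel) =
      (\<integral>\<^sup>+t. (\<integral>\<^sup>+x. ?g x t \<partial>lborel) \<partial>lborel)"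
    by (rule lborel_pair.Fubini') measurable
  also have "\<dots> = (\<integral>\<^sup>+t. ennreal (Gamma a * u powr (- a)) * (?I t * ennreal (t powr (b - a - 1) * exp (- (1 * t)))) \<partial>lborel)"
  proof (rule nn_integral_cong)
    fix t :: real
    show "(\<integral>\<^sup>+x. ?g x t \<partial>lborel) =
       ennreal (Gamma a * u powr (- a)) * (?I t * ennreal (t powr (b - a - 1) * exp (- (1 * t))))"
    proof (cases "0 < t")
      case True
      have "(\<integral>\<^sup>+x. ?g x t \<partial>lborel) =
         (\<integral>\<^sup>+x. ennreal (t powr (b - 1) * exp (- t)) * (?I x * ennreal (x powr (a - 1) * exp (- ((u * t) * x)))) \<partial>lborel)"
      proof (rule nn_integral_cong)
        fix x
        have "exp (- ((1 + u * x) * t)) = exp (- t) * exp (- ((u * t) * x))"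
          unfolding exp_add[symmetric] by (simp add: algebra_simps)
        then show "?g x t =
          ennreal (t powr (b - 1) * exp (- t)) * (?I x * ennreal (x powr (a - 1) * exp (- ((u * t) * x))))"
          using True by (cases "0 < x") (simp_all add: ennreal_mult'[symmetric] mult_ac)
      qed
      also have "\<dots> = ennreal (t powr (b - 1) * exp (- t)) * ennreal (Gamma a * (u * t) powr (- a))"
        using True u nn_integral_Gamma_scaled[OF a, of "u * t"] by (subst nn_integral_cmult) simp_all
      also have "\<dots> = ennreal (Gamma a * u powr (- a) * (t powr (b - a - 1) * exp (- (1 * t))))"
      proof -
        have "t powr (b - 1) * (u * t) powr (- a) = u powr (- a) * (t powr (b - 1) * t powr (- a))"
          using True u by (simp add: powr_mult mult_ac)
        also have "t powr (b - 1) * t powr (- a) = t powr (b - a - 1)"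
          unfolding powr_add[symmetric] by (simp add: algebra_simps)
        finally have eq: "t powr (b - 1) * (u * t) powr (- a) = u powr (- a) * t powr (b - a - 1)" .
        have "ennreal (t powr (b - 1) * exp (- t)) * ennreal (Gamma a * (u * t) powr (- a)) =
            ennreal (Gamma a * exp (- t) * (t powr (b - 1) * (u * t) powr (- a)))"
          using G by (simp add: ennreal_mult'[symmetric] mult_ac)
        then show ?thesis unfolding eq by (simp add: mult_ac)
      qed
      finally show ?thesis using True G u by (simp add: ennreal_mult'[symmetric])
    qed simp
  qed
  also have "\<dots> = ennreal (Gamma a * u powr (- a)) * ennreal (Gamma (b - a))"
    using a b by (subst nn_integral_cmult) (simp_all only: nn_integral_Gamma_scaled diff_gt_0_iff_gt zero_less_one, simp_all)
  finally show ?thesis using G by (simp add: ennreal_mult'[symmetric] mult_ac)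
qed

text \<open>The limit of \<open>u powr (\<nu> / 2)\<close> times the characteristic function of the winding number at \<open>\<nu>\<close>.\<close>

definition spitzer_const :: "real \<Rightarrow> real" where
  "spitzer_const \<nu> = Gamma (1 + \<nu> / 2) / (2 powr (\<nu> / 2) * Gamma (1 + \<nu>))"

context brownian_from_1
begin

text \<open>Write the constant function of the radius as a mixture of the weights of Weber's identity: for
  \<open>R > 0\<close> the integral of \<open>x powr (\<nu> / 2 - 1) * R powr \<nu> * exp (- R\<^sup>2 * x / 2)\<close> over \<open>x > 0\<close> does not
  depend on \<open>R\<close>. By Fubini's theorem the characteristic function becomes a second Beta integral, but for
  the factor \<open>e x\<close>, which lies between \<open>exp (- 1 / (2 * u))\<close> and \<open>1\<close>.\<close>

lemma winding_char_bounds_pos: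
  assumes \<nu>: "0 < \<nu>" and u: "0 < u"
  obtains c where "(\<integral>\<omega>. exp (\<i> * of_real (\<nu> * \<Theta> u \<omega>)) \<partial>M) = of_real c"
    "exp (- 1 / (2 * u)) * spitzer_const \<nu> * u powr (- \<nu> / 2) \<le> c"
    "c \<le> spitzer_const \<nu> * u powr (- \<nu> / 2)"
proof -
  let ?e = "\<lambda>\<omega>. exp (\<i> * of_real (\<nu> * \<Theta> u \<omega>))"
  have [measurable]: "V u \<in> borel_measurable M" "\<Theta> u \<in> borel_measurable M"
    using u by (auto intro: measurable_\<Theta>)
  interpret P: pair_sigma_finite M lborel ..
  define a where "a = \<nu> / 2"
  have a: "0 < a" "a < 1 + \<nu>" "1 + \<nu> - a = 1 + a" using \<nu> by (simp_all add: a_def)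
  have G: "0 < Gamma a" "0 < Gamma (1 + a)" "0 < Gamma (1 + \<nu>)" using a \<nu> by simp_all
  define m where "m x = indicat_real {0<..} x * x powr (a - 1)" for x :: real
  have m: "0 \<le> m x" for x by (simp add: m_def)
  have [measurable]: "m \<in> borel_measurable borel" unfolding m_def by measurable
  define r where "r \<omega> x = m x * (exp (- (cmod (V u \<omega>))\<^sup>2 * x / 2) * cmod (V u \<omega>) powr \<nu>)" for \<omega> x
  have r: "0 \<le> r \<omega> x" for \<omega> x using m by (simp add: r_def)
  have [measurable]: "(\<lambda>p. r (fst p) (snd p)) \<in> borel_measurable (M \<Otimes>\<^sub>M lborel)" "\<And>\<omega>. r \<omega> \<in> borel_measurable borel"
    unfolding r_def by measurable
  have radial: "(\<integral>\<^sup>+x. ennreal (r \<omega> x) \<partial>lborel) = ennreal (2 powr a * Gamma a)" if nz: "V u \<omega> \<noteq> 0" for \<omega>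
  proof -
    let ?R = "cmod (V u \<omega>)"
    have "(\<integral>\<^sup>+x. ennreal (r \<omega> x) \<partial>lborel) =
      (\<integral>\<^sup>+x. ennreal (?R powr \<nu>) * (indicator {0<..} x * ennreal (x powr (a - 1) * exp (- (?R\<^sup>2 / 2 * x)))) \<partial>lborel)"
      by (intro nn_integral_cong) (simp add: r_def m_def ennreal_mult'[symmetric] indicator_def mult_ac)
    also have "\<dots> = ennreal (?R powr \<nu>) * ennreal (Gamma a * (?R\<^sup>2 / 2) powr (- a))"
    proof -
      have pos: "0 < ?R\<^sup>2 / 2" using nz by simp
      show ?thesis
        unfolding nn_integral_Gamma_scaled[OF a(1) pos, symmetric] by (rule nn_integral_cmult) measurable
    qed
    also have "\<dots> = ennreal (?R powr \<nu> * (Gamma a * (?R\<^sup>2 / 2) powr (- a)))"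
      by (simp add: ennreal_mult')
    also have "(?R\<^sup>2 / 2) powr (- a) = ?R powr (- \<nu>) * 2 powr a"
    proof -
      have "(?R\<^sup>2) powr (- a) = ?R powr (- \<nu>)"
        using nz by (simp add: a_def powr_powr flip: powr_numeral)
      then show ?thesis by (simp add: powr_divide powr_minus field_simps)
    qed
    also have "?R powr \<nu> * (Gamma a * (?R powr (- \<nu>) * 2 powr a)) = 2 powr a * Gamma a"
      using nz by (simp add: powr_minus)
    finally show ?thesis .
  qed
  have nz: "AE \<omega> in M. V u \<omega> \<noteq> 0"
    using AE_V_nonzero u by (auto elim!: eventually_mono)
  define F where "F \<omega> x = r \<omega> x *\<^sub>R ?e \<omega>" for \<omega> x
  have nF: "norm (F \<omega> x) = r \<omega> x" for \<omega> x using r by (simp add: F_def)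
  have intF: "integrable (M \<Otimes>\<^sub>M lborel) (\<lambda>(\<omega>, x). F \<omega> x)"
  proof (rule integrableI_bounded)
    have "(\<integral>\<^sup>+p. ennreal (norm (case p of (\<omega>, x) \<Rightarrow> F \<omega> x)) \<partial>(M \<Otimes>\<^sub>M lborel)) = (\<integral>\<^sup>+p. ennreal (r (fst p) (snd p)) \<partial>(M \<Otimes>\<^sub>M lborel))"
      by (simp add: case_prod_beta nF)
    also have "\<dots> = (\<integral>\<^sup>+\<omega>. (\<integral>\<^sup>+x. ennreal (r \<omega> x) \<partial>lborel) \<partial>M)"
      by (subst lborel.nn_integral_fst[symmetric]) auto
    also have "\<dots> = (\<integral>\<^sup>+\<omega>. ennreal (2 powr a * Gamma a) \<partial>M)"
      using nz by (intro nn_integral_cong_AE) (auto elim!: eventually_mono simp: radial)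
    also have "\<dots> < \<infinity>" by (simp add: emeasure_space_1)
    finally show "(\<integral>\<^sup>+p. ennreal (norm (case p of (\<omega>, x) \<Rightarrow> F \<omega> x)) \<partial>(M \<Otimes>\<^sub>M lborel)) < \<infinity>" .
  qed (unfold F_def case_prod_beta, measurable)
  have first: "(\<integral>\<omega>. (\<integral>x. F \<omega> x \<partial>lborel) \<partial>M) = of_real (2 powr a * Gamma a) * (\<integral>\<omega>. ?e \<omega> \<partial>M)"
  proof -
    have "(\<integral>x. F \<omega> x \<partial>lborel) = of_real (2 powr a * Gamma a) * ?e \<omega>" if "V u \<omega> \<noteq> 0" for \<omega>
    proof -
      have "has_bochner_integral lborel (r \<omega>) (2 powr a * Gamma a)"
        using radial[OF that] G r by (intro has_bochner_integral_nn_integral) auto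
      then show ?thesis
        unfolding F_def by (auto dest!: has_bochner_integral_scaleR_left[where c="?e \<omega>"]
            has_bochner_integral_integral_eq simp: scaleR_conv_of_real)
    qed
    then have "(\<integral>\<omega>. (\<integral>x. F \<omega> x \<partial>lborel) \<partial>M) = (\<integral>\<omega>. of_real (2 powr a * Gamma a) * ?e \<omega> \<partial>M)"
      using nz by (intro integral_cong_AE) (auto elim!: eventually_mono simp: F_def)
    also have "\<dots> = of_real (2 powr a * Gamma a) * (\<integral>\<omega>. ?e \<omega> \<partial>M)"
      by (rule integral_mult_right_zero)
    finally show ?thesis .
  qed
  define k where "k x = m x * (1 + u * x) powr (- (1 + \<nu>))" for x
  define e where "e x = exp (- (x / (2 * (1 + u * x))))" for x
  have [measurable]: "k \<in> borel_measurable borel" "e \<in> borel_measurable borel"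
    unfolding k_def e_def by measurable
  have k: "0 \<le> k x" for x using m by (simp add: k_def)
  \<comment> \<open>Weber's identity with \<open>s = 1 / x\<close>\<close>
  have second: "(\<integral>\<omega>. F \<omega> x \<partial>M) = of_real (k x * e x)" for x
  proof (cases "0 < x")
    case True
    have e0: "1 / x / (1 / x + u) = inverse (1 + u * x)" using True by (simp add: field_simps)
    have e1: "(1 / x / (1 / x + u)) powr (1 + \<nu>) = (1 + u * x) powr (- (1 + \<nu>))"
      unfolding powr_minus e0 using True u by (simp add: inverse_powr)
    have e2: "- 1 / (2 * (1 / x + u)) = - (x / (2 * (1 + u * x)))" using True u by (simp add: field_simps)
    have e3: "- (cmod (V u \<omega>))\<^sup>2 / (2 * (1 / x)) = - (cmod (V u \<omega>))\<^sup>2 * x / 2" for \<omega> using True by simp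
    have "F \<omega> x = of_real (m x) * (exp (- (cmod (V u \<omega>))\<^sup>2 / (2 * (1 / x))) *\<^sub>R (of_real (cmod (V u \<omega>) powr \<nu>) * ?e \<omega>))" for \<omega>
      unfolding F_def r_def e3 by (simp add: scaleR_conv_of_real mult_ac)
    then have "(\<integral>\<omega>. F \<omega> x \<partial>M) = of_real (m x) * (\<integral>\<omega>. exp (- (cmod (V u \<omega>))\<^sup>2 / (2 * (1 / x))) *\<^sub>R (of_real (cmod (V u \<omega>) powr \<nu>) * ?e \<omega>) \<partial>M)"
      by (simp only: integral_mult_right_zero)
    also have "\<dots> = of_real (m x) * of_real ((1 + u * x) powr (- (1 + \<nu>)) * e x)"
      using True by (subst weber_identity[OF \<nu> _ u]) (simp_all only: e1 e2 e_def, simp_all)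
    finally show ?thesis by (simp add: k_def)
  qed (simp add: F_def r_def m_def k_def)
  have fub: "(\<integral>x. (\<integral>\<omega>. F \<omega> x \<partial>M) \<partial>lborel) = (\<integral>\<omega>. (\<integral>x. F \<omega> x \<partial>lborel) \<partial>M)"
    by (rule P.Fubini_integral[OF intF])
  define B where "B = Gamma a * Gamma (1 + a) / Gamma (1 + \<nu>) * u powr (- a)"
  have B: "0 \<le> B" using G by (simp add: B_def)
  have hk: "has_bochner_integral lborel k B"
  proof (rule has_bochner_integral_nn_integral)
    have "(\<integral>\<^sup>+x. ennreal (k x) \<partial>lborel) = (\<integral>\<^sup>+x. indicator {0<..} x * ennreal (x powr (a - 1) * (1 + u * x) powr (- (1 + \<nu>))) \<partial>lborel)"
      by (intro nn_integral_cong) (simp add: k_def m_def indicator_def)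
    also have "\<dots> = ennreal B" using nn_integral_Beta_prime[OF a(1,2) u] unfolding a(3) B_def .
    finally show "(\<integral>\<^sup>+x. ennreal (k x) \<partial>lborel) = ennreal B" .
  qed (use k B in auto)
  then have ik: "integrable lborel k" and Bk: "(\<integral>x. k x \<partial>lborel) = B"
    by (auto simp: has_bochner_integral_iff)
  have e_le: "k x * e x \<le> k x" for x
  proof (cases "0 < x")
    case True
    then have "e x \<le> 1" using u by (simp add: e_def)
    then show ?thesis using k[of x] by (simp add: mult_left_le)
  qed (simp add: k_def m_def)
  have e_ge: "exp (- 1 / (2 * u)) * k x \<le> k x * e x" for x
  proof (cases "0 < x")
    case True
    have "x / (2 * (1 + u * x)) \<le> 1 / (2 * u)" using True u by (simp add: field_simps add_pos_pos)
    then have "exp (- 1 / (2 * u)) \<le> e x" by (simp add: e_def)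
    then show ?thesis using k[of x] by (subst mult.commute) (intro mult_left_mono)
  qed (simp add: k_def m_def)
  have ike: "integrable lborel (\<lambda>x. k x * e x)"
    using e_le k by (intro Bochner_Integration.integrable_bound[OF ik]) (auto simp: e_def abs_mult)
  define J where "J = (\<integral>x. k x * e x \<partial>lborel)"
  have J_le: "J \<le> B" unfolding J_def Bk[symmetric] using e_le by (intro integral_mono ike ik)
  have "exp (- 1 / (2 * u)) * B = (\<integral>x. exp (- 1 / (2 * u)) * k x \<partial>lborel)"
    unfolding Bk[symmetric] by (rule integral_mult_right_zero[symmetric])
  also have "\<dots> \<le> J" unfolding J_def using e_ge by (intro integral_mono ike integrable_mult_right ik)
  finally have J_ge: "exp (- 1 / (2 * u)) * B \<le> J" .
  have "of_real (2 powr a * Gamma a) * (\<integral>\<omega>. ?e \<omega> \<partial>M) = of_real J"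
    unfolding first[symmetric] fub[symmetric] second J_def by (rule integral_complex_of_real)
  then have char: "(\<integral>\<omega>. ?e \<omega> \<partial>M) = of_real (J / (2 powr a * Gamma a))"
    using G by (simp add: field_simps)
  have BK: "B / (2 powr a * Gamma a) = spitzer_const \<nu> * u powr (- \<nu> / 2)"
    using G by (simp add: B_def spitzer_const_def a_def)
  have pos: "0 < 2 powr a * Gamma a" using G by simp
  have "J / (2 powr a * Gamma a) \<le> spitzer_const \<nu> * u powr (- \<nu> / 2)"
    unfolding BK[symmetric] using pos J_le by (intro divide_right_mono) auto
  moreover have "exp (- 1 / (2 * u)) * spitzer_const \<nu> * u powr (- \<nu> / 2) \<le> J / (2 powr a * Gamma a)"
    unfolding mult.assoc BK[symmetric] times_divide_eq_right using pos J_ge by (intro divide_right_mono) auto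
  ultimately show ?thesis using that char by blast
qed

end

section \<open>Fourier inversion for integrable characteristic functions\<close>

lemma fourier_kernel_le:
  fixes a b t :: real
  assumes "a \<le> b"
  shows "cmod ((iexp (-(t * a)) - iexp (-(t * b))) / (\<i> * t)) \<le> b - a"
  using Levy_Inversion_aux2[of "- b" "- a" t] assms by (cases "t = 0") auto

context real_distribution
begin

text \<open>Levy's inversion formula is a limit of truncated integrals; integrability of the characteristic
  function removes the truncation.\<close>

lemma inversion_no_atoms:
  fixes a b :: real
  assumes ab: "a \<le> b" and at: "prob {a} = 0" "prob {b} = 0" and int: "integrable lborel (char M)"
  shows "complex_of_real (prob {a<..b}) =
    1 / (2 * pi) * (CLBINT t. (iexp (-(t * a)) - iexp (-(t * b))) / (\<i> * t) * char M t)"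
proof -
  let ?f = "\<lambda>t::real. (iexp (-(t * a)) - iexp (-(t * b))) / (\<i> * t) * char M t"
  have [measurable]: "char M \<in> borel_measurable borel" using borel_measurable_integrable[OF int] by simp
  have lim: "(\<lambda>T::nat. 1 / (2 * pi) * (CLBINT t=-T..T. ?f t)) \<longlonglongrightarrow> complex_of_real (prob {a<..b})"
    using Levy_Inversion[OF ab at] .
  have "(\<lambda>n. CLBINT t. indicator {- real n<..<real n} t *\<^sub>R ?f t) \<longlonglongrightarrow> (CLBINT t. ?f t)"
  proof (rule integral_dominated_convergence[where w="\<lambda>t. (b - a) * norm (char M t)"])
    show "integrable lborel (\<lambda>t. (b - a) * norm (char M t))"
      by (intro integrable_mult_right integrable_norm int)
    show "AE t in lborel. (\<lambda>n. indicator {- real n<..<real n} t *\<^sub>R ?f t) \<longlonglongrightarrow> ?f t"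
    proof (rule AE_I2)
      fix t :: real
      obtain N :: nat where N: "\<bar>t\<bar> < real N" using reals_Archimedean2 by blast
      have "eventually (\<lambda>n. indicator {- real n<..<real n} t *\<^sub>R ?f t = ?f t) sequentially"
        using eventually_ge_at_top[of N]
      proof eventually_elim
        case (elim n)
        then have "t \<in> {- real n<..<real n}" using N by auto
        then show ?case by simp
      qed
      then show "(\<lambda>n. indicator {- real n<..<real n} t *\<^sub>R ?f t) \<longlonglongrightarrow> ?f t" by (rule tendsto_eventually)
    qed
    show "AE t in lborel. norm (indicator {- real n<..<real n} t *\<^sub>R ?f t) \<le> (b - a) * norm (char M t)" for n
    proof (rule AE_I2)
      fix t
      have "norm (?f t) \<le> (b - a) * norm (char M t)"
        unfolding norm_mult by (intro mult_right_mono fourier_kernel_le ab) auto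
      then show "norm (indicator {- real n<..<real n} t *\<^sub>R ?f t) \<le> (b - a) * norm (char M t)"
        using ab by (auto simp: indicator_def)
    qed
  qed auto
  then have "(\<lambda>T::nat. 1 / (2 * pi) * (CLBINT t. indicator {- real T<..<real T} t *\<^sub>R ?f t)) \<longlonglongrightarrow> 1 / (2 * pi) * (CLBINT t. ?f t)"
    by (intro tendsto_mult_left)
  moreover have "(CLBINT t=-T..T. ?f t) = (CLBINT t. indicator {- real T<..<real T} t *\<^sub>R ?f t)" for T :: nat
    by (simp add: interval_lebesgue_integral_def set_lebesgue_integral_def)
  ultimately show ?thesis using LIMSEQ_unique[OF lim] by simp
qed

lemma prob_interval_le_char:
  fixes a b :: real
  assumes ab: "a \<le> b" and at: "prob {a} = 0" "prob {b} = 0" and int: "integrable lborel (char M)"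
  shows "prob {a<..b} \<le> (b - a) * ((LBINT t. norm (char M t)) / (2 * pi))"
proof -
  let ?f = "\<lambda>t::real. (iexp (-(t * a)) - iexp (-(t * b))) / (\<i> * t) * char M t"
  have [measurable]: "char M \<in> borel_measurable borel" using borel_measurable_integrable[OF int] by simp
  have i: "integrable lborel (\<lambda>t. (b - a) * norm (char M t))"
    by (intro integrable_mult_right integrable_norm int)
  have n: "norm (?f t) \<le> (b - a) * norm (char M t)" for t
    unfolding norm_mult by (intro mult_right_mono fourier_kernel_le ab) auto
  have f: "integrable lborel ?f"
  proof (rule Bochner_Integration.integrable_bound[OF i])
    show "AE t in lborel. norm (?f t) \<le> norm ((b - a) * norm (char M t))"
      using n ab by (intro AE_I2) (simp add: abs_mult)
  qed measurable
  have "prob {a<..b} = cmod (complex_of_real (prob {a<..b}))" by simp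
  also have "\<dots> = 1 / (2 * pi) * cmod (CLBINT t. ?f t)"
    unfolding inversion_no_atoms[OF assms] by (simp add: norm_mult norm_divide)
  also have "\<dots> \<le> 1 / (2 * pi) * (LBINT t. (b - a) * norm (char M t))"
    by (intro mult_left_mono Bochner_Integration.integral_norm_bound_integral[OF f i] n) auto
  finally show ?thesis by simp
qed

text \<open>All but countably many points have mass zero, so \<open>x\<close> lies in arbitrarily short intervals between such
  points, whose mass is at most proportional to their length.\<close>

lemma integrable_char_no_atom:
  assumes int: "integrable lborel (char M)"
  shows "prob {x} = 0"
proof (rule ccontr)
  assume "prob {x} \<noteq> 0"
  then have pos: "0 < prob {x}" by (simp add: zero_less_measure_iff)
  define K where "K = (LBINT t. norm (char M t)) / (2 * pi)"
  have K: "0 \<le> K" unfolding K_def by (intro divide_nonneg_nonneg integral_nonneg) auto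
  define e where "e = prob {x} / (4 * (K + 1))"
  have e: "0 < e" using pos K by (simp add: e_def)
  obtain a where a: "a \<in> {x - e<..<x}" "prob {a} = 0"
    using open_minus_countable[OF countable_support, of "{x - e<..<x}"] e by auto
  obtain b where b: "b \<in> {x<..<x + e}" "prob {b} = 0"
    using open_minus_countable[OF countable_support, of "{x<..<x + e}"] e by auto
  have "prob {x} \<le> prob {a<..b}" using a b by (intro finite_measure_mono) auto
  also have "\<dots> \<le> (b - a) * K"
    unfolding K_def using a b by (intro prob_interval_le_char int) auto
  also have "\<dots> \<le> (2 * e) * (K + 1)" using a b K by (intro mult_mono) auto
  also have "\<dots> = prob {x} / 2" using K by (simp add: e_def field_simps)
  finally show False using pos by simp
qed

lemma inversion_integrable_char:
  fixes a b :: real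
  assumes ab: "a < b" and int: "integrable lborel (char M)"
  shows "complex_of_real (prob {a<..<b}) =
    1 / (2 * pi) * (CLBINT t. (iexp (-(t * a)) - iexp (-(t * b))) / (\<i> * t) * char M t)"
proof -
  have "{a<..b} = {a<..<b} \<union> {b}" using ab by auto
  then have "prob {a<..b} = prob {a<..<b} + prob {b}"
    by (simp only:) (rule finite_measure_Union, auto)
  then show ?thesis
    using inversion_no_atoms[of a b] ab int by (simp add: integrable_char_no_atom)
qed

end

lemma has_bochner_integral_exp_abs:
  "has_bochner_integral lborel (\<lambda>x. exp (- \<bar>x\<bar>)) (2::real)"
proof -
  have "has_bochner_integral lborel (\<lambda>x. indicator {0..} x *\<^sub>R exp (- \<bar>x\<bar>)) (1::real)"
  proof (rule has_bochner_integral_nn_integral)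
    have "(\<integral>\<^sup>+x. ennreal (indicator {0..} x *\<^sub>R exp (- \<bar>x\<bar>)) \<partial>lborel) = (\<integral>\<^sup>+x. ennreal (x ^ 0 * exp (- x)) * indicator {0..} x \<partial>lborel)"
      by (intro nn_integral_cong) (auto simp: indicator_def)
    also have "\<dots> = ennreal 1" by (subst nn_intergal_power_times_exp_Ici) simp
    finally show "(\<integral>\<^sup>+x. ennreal (indicator {0..} x *\<^sub>R exp (- \<bar>x\<bar>)) \<partial>lborel) = ennreal 1" .
  qed auto
  from has_bochner_integral_even_function[OF this] show ?thesis by simp
qed

section \<open>The local limit theorem\<close>

lemma isCont_spitzer_const: "isCont spitzer_const 0"
proof -
  have "(1::real) \<notin> \<int>\<^sub>\<le>\<^sub>0" by auto
  then show ?thesis unfolding spitzer_const_def by (intro continuous_intros) auto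
qed

lemma spitzer_const_0 [simp]: "spitzer_const 0 = 1"
  by (simp add: spitzer_const_def)

lemma spitzer_const_nonneg: "0 \<le> \<nu> \<Longrightarrow> 0 \<le> spitzer_const \<nu>"
  unfolding spitzer_const_def
  by (intro divide_nonneg_nonneg mult_nonneg_nonneg less_imp_le[OF Gamma_real_pos]) auto

context brownian_from_1
begin

definition \<Theta>_law :: "real \<Rightarrow> real measure" where
  "\<Theta>_law u = distr M borel (\<Theta> u)"

lemma real_distribution_\<Theta>_law: "0 < u \<Longrightarrow> real_distribution (\<Theta>_law u)"
  unfolding \<Theta>_law_def by (intro real_distribution_distr measurable_\<Theta>)

lemma char_\<Theta>_law: "0 < u \<Longrightarrow> char (\<Theta>_law u) t = (\<integral>\<omega>. exp (\<i> * of_real (t * \<Theta> u \<omega>)) \<partial>M)"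
  unfolding char_def \<Theta>_law_def by (rule integral_distr[OF measurable_\<Theta>]) auto

text \<open>Complex conjugation reduces negative frequencies to positive ones, where the value is real.\<close>

lemma char_\<Theta>_law_bounds:
  assumes u: "0 < u"
  obtains c where "char (\<Theta>_law u) t = of_real c"
    "exp (- 1 / (2 * u)) * spitzer_const \<bar>t\<bar> * u powr (- \<bar>t\<bar> / 2) \<le> c"
    "c \<le> spitzer_const \<bar>t\<bar> * u powr (- \<bar>t\<bar> / 2)"
proof -
  consider "0 < t" | "t = 0" | "0 < - t" by linarith
  then show ?thesis
  proof cases
    case 1
    then show ?thesis
      using winding_char_bounds_pos[OF 1 u] that by (metis abs_of_pos char_\<Theta>_law[OF u])
  next
    case 2
    then show ?thesis using that[of 1] u by (simp add: char_\<Theta>_law[OF u] prob_space)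
  next
    case 3
    obtain c where c: "(\<integral>\<omega>. exp (\<i> * of_real (- t * \<Theta> u \<omega>)) \<partial>M) = of_real c"
      "exp (- 1 / (2 * u)) * spitzer_const (- t) * u powr (- (- t) / 2) \<le> c"
      "c \<le> spitzer_const (- t) * u powr (- (- t) / 2)"
      by (rule winding_char_bounds_pos[OF 3 u]) blast
    have "char (\<Theta>_law u) t = (\<integral>\<omega>. cnj (exp (\<i> * of_real (- t * \<Theta> u \<omega>))) \<partial>M)"
      unfolding char_\<Theta>_law[OF u] by (simp add: exp_cnj)
    also have "\<dots> = cnj (\<integral>\<omega>. exp (\<i> * of_real (- t * \<Theta> u \<omega>)) \<partial>M)"
      by (rule Bochner_Integration.integral_cnj)
    also have "\<dots> = of_real c" unfolding c(1) by simp
    finally show ?thesis using that[of c] c(2,3) 3 by simp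
  qed
qed

text \<open>At time one the lower bound of a characteristic function cannot exceed one.\<close>

lemma spitzer_const_le: "spitzer_const \<bar>t\<bar> \<le> exp (1 / 2)"
proof -
  obtain c where c: "char (\<Theta>_law 1) t = of_real c" "exp (- 1 / 2) * spitzer_const \<bar>t\<bar> \<le> c"
    by (rule char_\<Theta>_law_bounds[of 1 t]) auto
  interpret L: real_distribution "\<Theta>_law 1" by (rule real_distribution_\<Theta>_law) simp
  have "c \<le> 1" using L.cmod_char_le_1[of t] c(1) by simp
  with c(2) have "exp (- 1 / 2) * spitzer_const \<bar>t\<bar> \<le> 1" by linarith
  then have "exp (1 / 2) * (exp (- 1 / 2) * spitzer_const \<bar>t\<bar>) \<le> exp (1 / 2) * 1"
    by (intro mult_left_mono) auto
  then show ?thesis by (simp add: mult.assoc[symmetric] exp_add[symmetric])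
qed

text \<open>With \<open>l u = ln u / 2\<close> the bounds of the characteristic function at \<open>s / l u\<close> both become
  \<open>exp (- \<bar>s\<bar>)\<close> times a factor that tends to \<open>1\<close>, and the Fourier kernel of the interval tends to its
  value \<open>b - a\<close> at frequency zero. Only frequencies of order \<open>1 / l u\<close> matter in the limit, which is why
  the limit depends on the interval through its length alone.\<close>

theorem winding_local_limit:
  assumes ab: "a < b"
  shows "((\<lambda>u. ln u / 2 * prob {\<omega>\<in>space M. a < \<Theta> u \<omega> \<and> \<Theta> u \<omega> < b}) \<longlongrightarrow> 1 / pi * (b - a)) at_top"
proof -
  let ?A = "\<lambda>u. {\<omega>\<in>space M. a < \<Theta> u \<omega> \<and> \<Theta> u \<omega> < b}"
  define l where "l u = ln u / 2" for u :: real
  define F where "F t = (iexp (-(t * a)) - iexp (-(t * b))) / (\<i> * t)" for t :: real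
  \<comment> \<open>cut off for \<open>u \<le> 1\<close> so that measurability in \<open>s\<close> holds for every \<open>u\<close>\<close>
  define \<phi> where "\<phi> u = (if 1 < u then char (\<Theta>_law u) else (\<lambda>_. 0))" for u
  let ?J = "\<lambda>u. CLBINT s. F (s / l u) * \<phi> u (s / l u)"
  have F_le: "cmod (F t) \<le> b - a" for t
    unfolding F_def using ab by (intro fourier_kernel_le) auto
  have [measurable]: "F \<in> borel_measurable borel" unfolding F_def by measurable
  have l: "0 < l u" if "1 < u" for u using that by (simp add: l_def)
  have upowr: "u powr (- \<bar>s / l u\<bar> / 2) = exp (- \<bar>s\<bar>)" if "1 < u" for u s
    using that l[OF that] by (simp add: powr_def l_def field_simps)
  have \<phi>_le: "cmod (\<phi> u (s / l u)) \<le> exp (1 / 2) * exp (- \<bar>s\<bar>)" if u: "1 < u" for u s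
  proof -
    have u0: "0 < u" using u by simp
    obtain c where c: "\<phi> u (s / l u) = of_real c"
      "exp (- 1 / (2 * u)) * spitzer_const \<bar>s / l u\<bar> * exp (- \<bar>s\<bar>) \<le> c"
      "c \<le> spitzer_const \<bar>s / l u\<bar> * exp (- \<bar>s\<bar>)"
      using char_\<Theta>_law_bounds[OF u0, of "s / l u"] u unfolding \<phi>_def upowr[OF u] by auto
    have "0 \<le> spitzer_const \<bar>s / l u\<bar>" by (rule spitzer_const_nonneg) simp
    then have "0 \<le> c" using c(2) by (intro order_trans[OF _ c(2)]) auto
    then have "cmod (\<phi> u (s / l u)) \<le> spitzer_const \<bar>s / l u\<bar> * exp (- \<bar>s\<bar>)" using c by simp
    also have "\<dots> \<le> exp (1 / 2) * exp (- \<bar>s\<bar>)" by (intro mult_right_mono spitzer_const_le) auto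
    finally show ?thesis .
  qed
  have [measurable]: "\<phi> u \<in> borel_measurable borel" for u
    unfolding \<phi>_def using real_distribution.char_measurable[OF real_distribution_\<Theta>_law[of u]] by auto
  have int_exp: "integrable lborel (\<lambda>x::real. exp (- \<bar>x\<bar>))" and exp2: "(LBINT x. exp (- \<bar>x::real\<bar>)) = 2"
    using has_bochner_integral_exp_abs by (auto simp: has_bochner_integral_iff)
  have prob_eq: "complex_of_real (l u * prob (?A u)) =
      1 / (2 * pi) * ?J u" if u: "1 < u" for u
  proof -
    have u0: "0 < u" and lu: "0 < l u" using u l by auto
    interpret L: real_distribution "\<Theta>_law u" by (rule real_distribution_\<Theta>_law[OF u0])
    have "integrable lborel (\<lambda>s. \<phi> u (s / l u))"
    proof (rule Bochner_Integration.integrable_bound)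
      show "integrable lborel (\<lambda>s. exp (1 / 2) * exp (- \<bar>s\<bar>) :: real)" by (intro integrable_mult_right int_exp)
      show "AE s in lborel. norm (\<phi> u (s / l u)) \<le> norm (exp (1 / 2) * exp (- \<bar>s\<bar>) :: real)"
        using \<phi>_le[OF u] by (intro AE_I2) (simp add: abs_mult)
    qed measurable
    then have int: "integrable lborel (char (\<Theta>_law u))"
      using lborel_integrable_real_affine_iff[of "1 / l u" "\<phi> u" 0] lu u by (simp add: \<phi>_def)
    have "prob (?A u) = measure (\<Theta>_law u) {a<..<b}"
      unfolding \<Theta>_law_def using measurable_\<Theta>[OF u0]
      by (subst measure_distr) (auto intro!: arg_cong[where f=prob])
    then have "complex_of_real (prob (?A u)) = 1 / (2 * pi) * (CLBINT t. F t * \<phi> u t)"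
      using L.inversion_integrable_char[OF ab int] u by (simp add: F_def \<phi>_def)
    also have "(CLBINT t. F t * \<phi> u t) = (1 / l u) *\<^sub>R ?J u"
      using lborel_integral_real_affine[of "1 / l u" "\<lambda>t. F t * \<phi> u t" 0] lu by simp
    finally show ?thesis using lu by (simp add: scaleR_conv_of_real)
  qed
  have lim0: "((\<lambda>u. s / l u) \<longlongrightarrow> 0) at_top" for s
    unfolding l_def by real_asymp
  have "(?J \<longlongrightarrow> (CLBINT s. of_real (b - a) * of_real (exp (- \<bar>s\<bar>)))) at_top"
  proof (rule integral_dominated_convergence_at_top[where w="\<lambda>s. (b - a) * (exp (1 / 2) * exp (- \<bar>s\<bar>))"])
    show "(\<lambda>s. of_real (b - a) * of_real (exp (- \<bar>s\<bar>)) :: complex) \<in> borel_measurable lborel" by measurable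
    show "integrable lborel (\<lambda>s. (b - a) * (exp (1 / 2) * exp (- \<bar>s\<bar>)))"
      by (intro integrable_mult_right int_exp)
    show "eventually (\<lambda>u. AE s in lborel. norm (F (s / l u) * \<phi> u (s / l u)) \<le> (b - a) * (exp (1 / 2) * exp (- \<bar>s\<bar>))) at_top"
      using eventually_gt_at_top[of 1]
    proof eventually_elim
      case (elim u)
      show ?case
        unfolding norm_mult using ab elim by (intro AE_I2 mult_mono F_le \<phi>_le) auto
    qed
    show "AE s in lborel. ((\<lambda>u. F (s / l u) * \<phi> u (s / l u)) \<longlongrightarrow> of_real (b - a) * of_real (exp (- \<bar>s\<bar>))) at_top"
      using AE_lborel_singleton[of "0::real"]
    proof eventually_elim
      case (elim s)
      have "eventually (\<lambda>u. s / l u \<noteq> 0) at_top"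
        using eventually_gt_at_top[of "1::real"]
      proof eventually_elim
        case (elim u)
        then show ?case using l[of u] \<open>s \<noteq> 0\<close> by simp
      qed
      with lim0[of s] have "filterlim (\<lambda>u. s / l u) (at 0) at_top"
        unfolding filterlim_at by simp
      from filterlim_compose[OF Levy_Inversion_aux1[OF less_imp_le[OF ab]] this]
      have "((\<lambda>u. F (s / l u)) \<longlongrightarrow> of_real (b - a)) at_top" unfolding F_def .
      moreover have "((\<lambda>u. \<phi> u (s / l u)) \<longlongrightarrow> of_real (exp (- \<bar>s\<bar>))) at_top"
      proof -
        define c where "c u = Re (\<phi> u (s / l u))" for u
        have c: "\<phi> u (s / l u) = of_real (c u) \<and>
            exp (- 1 / (2 * u)) * spitzer_const \<bar>s / l u\<bar> * exp (- \<bar>s\<bar>) \<le> c u \<and>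
            c u \<le> spitzer_const \<bar>s / l u\<bar> * exp (- \<bar>s\<bar>)" if u: "1 < u" for u
        proof -
          have "0 < u" using u by simp
          then obtain d where d: "\<phi> u (s / l u) = of_real d"
            "exp (- 1 / (2 * u)) * spitzer_const \<bar>s / l u\<bar> * exp (- \<bar>s\<bar>) \<le> d"
            "d \<le> spitzer_const \<bar>s / l u\<bar> * exp (- \<bar>s\<bar>)"
            using char_\<Theta>_law_bounds[of u "s / l u"] u unfolding \<phi>_def upowr[OF u] by auto
          then show ?thesis by (simp add: c_def)
        qed
        have "((\<lambda>u. \<bar>s / l u\<bar>) \<longlongrightarrow> 0) at_top" using lim0[of s] by (rule tendsto_rabs_zero)
        from isCont_tendsto_compose[OF isCont_spitzer_const this]
        have K: "((\<lambda>u. spitzer_const \<bar>s / l u\<bar>) \<longlongrightarrow> 1) at_top" by simp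
        have e: "((\<lambda>u::real. exp (- 1 / (2 * u))) \<longlongrightarrow> 1) at_top" by real_asymp
        have "(c \<longlongrightarrow> exp (- \<bar>s\<bar>)) at_top"
        proof (rule tendsto_sandwich)
          show "eventually (\<lambda>u. exp (- 1 / (2 * u)) * spitzer_const \<bar>s / l u\<bar> * exp (- \<bar>s\<bar>) \<le> c u) at_top"
            using eventually_gt_at_top[of 1] by eventually_elim (use c in blast)
          show "eventually (\<lambda>u. c u \<le> spitzer_const \<bar>s / l u\<bar> * exp (- \<bar>s\<bar>)) at_top"
            using eventually_gt_at_top[of 1] by eventually_elim (use c in blast)
          show "((\<lambda>u. exp (- 1 / (2 * u)) * spitzer_const \<bar>s / l u\<bar> * exp (- \<bar>s\<bar>)) \<longlongrightarrow> exp (- \<bar>s\<bar>)) at_top"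
            using tendsto_mult_right[OF tendsto_mult[OF e K], of "exp (- \<bar>s\<bar>)"] by simp
          show "((\<lambda>u. spitzer_const \<bar>s / l u\<bar> * exp (- \<bar>s\<bar>)) \<longlongrightarrow> exp (- \<bar>s\<bar>)) at_top"
            using tendsto_mult_right[OF K, of "exp (- \<bar>s\<bar>)"] by simp
        qed
        then have "((\<lambda>u. of_real (c u) :: complex) \<longlongrightarrow> of_real (exp (- \<bar>s\<bar>))) at_top" by (rule tendsto_of_real)
        then show ?thesis
        proof (rule Lim_transform_eventually)
          show "eventually (\<lambda>u. of_real (c u) = \<phi> u (s / l u)) at_top"
            using eventually_gt_at_top[of 1] by eventually_elim (use c in metis)
        qed
      qed
      ultimately show ?case by (rule tendsto_mult)
    qed
    show "(\<lambda>s. F (s / l u) * \<phi> u (s / l u)) \<in> borel_measurable lborel" for u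
      by measurable
  qed
  then have "((\<lambda>u. 1 / (2 * pi) * ?J u) \<longlongrightarrow>
      1 / (2 * pi) * (CLBINT s. of_real (b - a) * of_real (exp (- \<bar>s\<bar>)))) at_top"
    by (rule tendsto_mult_left)
  moreover have "(CLBINT s. of_real (b - a) * of_real (exp (- \<bar>s\<bar>))) = of_real (2 * (b - a))"
  proof -
    have "(CLBINT s. of_real (b - a) * of_real (exp (- \<bar>s\<bar>))) = (CLBINT s. complex_of_real ((b - a) * exp (- \<bar>s\<bar>)))"
      by simp
    also have "\<dots> = of_real (LBINT s. (b - a) * exp (- \<bar>s::real\<bar>))" by (rule integral_complex_of_real)
    also have "(LBINT s. (b - a) * exp (- \<bar>s::real\<bar>)) = 2 * (b - a)" by (simp add: exp2)
    finally show ?thesis .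
  qed
  moreover have "complex_of_real (1 / (2 * pi)) * of_real (2 * (b - a)) = of_real (1 / pi * (b - a))"
  proof -
    have "1 / (2 * pi) * (2 * (b - a)) = 1 / pi * (b - a)" by (simp add: field_simps)
    then show ?thesis by (simp only: of_real_mult[symmetric])
  qed
  ultimately have "((\<lambda>u. 1 / (2 * pi) * ?J u) \<longlongrightarrow>
      complex_of_real (1 / pi * (b - a))) at_top" by (simp only:)
  then have "((\<lambda>u. complex_of_real (l u * prob (?A u))) \<longlongrightarrow>
      complex_of_real (1 / pi * (b - a))) at_top"
  proof (rule Lim_transform_eventually)
    show "eventually (\<lambda>u. 1 / (2 * pi) * ?J u =
        complex_of_real (l u * prob (?A u))) at_top"
      using eventually_gt_at_top[of 1] by eventually_elim (rule prob_eq[symmetric])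
  qed
  then show ?thesis unfolding l_def by (simp only: tendsto_of_real_iff)
qed

end


theorem theorem1:
  fixes M :: "'a measure" and W :: "real \<Rightarrow> 'a \<Rightarrow> complex" and a b :: real
  assumes "complex_brownian_motion M 1 W"
    and "a < b"
  shows "((\<lambda>u. ln u / 2 *
            measure M {\<omega> \<in> space M. a < winding (\<lambda>t. W t \<omega>) u \<and> winding (\<lambda>t. W t \<omega>) u < b})
          \<longlongrightarrow> 1 / pi * (b - a)) at_top"
proof -
  interpret brownian_from_1 M W by (rule brownian_from_1.intro[OF assms(1)])
  show ?thesis using winding_local_limit[OF assms(2)] by (simp only: \<Theta>_def)
qed

end
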